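(* There exist absolute constants $c, C > 0$ such that for all integers $d \ge 1$, $n \ge 1$, and every graph $G$ with vertex set $\{1,\dots,d\}$ and $m$ edges, the minimax rate for learning the class $\mathcal{F}_G$ of $d$-dimensional multivariate normal undirected graphical models with respect to $G$ in total variation distance satisfies $$c \min\left\{1, \sqrt{\frac{m+d}{n}}\right\} \le \mathcal{R}_n(\mathcal{F}_G) \le C \min\left\{1, \sqrt{\frac{m+d}{n}}\right\}.$$
   Context: All graphs are undirected, without parallel edges or self-loops. Normal graphical models. For $\mu \in \mathbb{R}^d$ and a (symmetric) positive definite matrix $\Sigma \in \mathbb{R}^{d\times d}$, let $f_{\mu,\Sigma}(x) = \frac{\exp\{-\frac12 (x-\mu)^{\mathsf T}\Sigma^{-1}(x-\mu)\}}{(2\pi)^{d/2}\sqrt{\det \Sigma}}$ be the density of the normal distribution with mean $\mu$ and covariance $\Sigma$. Let $\mathcal{P}_d$ be the set of positive definite $d\times d$ real matrices. For a graph $G = (\{1,\dots,d\},E)$, let $\mathcal{P}_G = \{\Sigma \in \mathcal{P}_d : (\Sigma^{-1})_{ij} = 0 \text{ whenever } i\neq j \text{ and } \{i,j\}\notin E\}$. The class of $d$-dimensional multivariate normal undirected graphical models with respect to $G$ is $\mathcal{F}_G = \{ f_{\mu,\Sigma} : \mu\in\mathbb{R}^d, \Sigma\in\mathcal{P}_G\}$. Minimax risk. Let $\mathcal{F}$ be a class of probability densities on $\mathcal{X}=\mathbb{R}^d$ (with respect to Lebesgue measure). For functions $f,g:\mathcal{X}\to\mathbb{R}$, $\mathrm{TV}(f,g)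 = \frac12\|f-g\|_1 = \frac12\int_{\mathcal{X}}|f-g|\,dx$. An estimator is a (measurable, possibly randomized) map $\hat f:\mathcal{X}^n\to\mathbb{R}^{\mathcal{X}}$ applied to i.i.d. samples $X_1,\dots,X_n$ from an unknown $f\in\mathcal{F}$. Its risk is $\mathcal{R}_n(\hat f,\mathcal{F}) = \sup_{f\in\mathcal{F}}\mathbf{E}\{\mathrm{TV}(\hat f,f)\}$, the expectation being over the $n$ i.i.d. samples from $f$ and any randomization of the estimator. The minimax rate (minimax risk) for learning $\mathcal{F}$ is $\mathcal{R}_n(\mathcal{F}) = \inf_{\hat f}\mathcal{R}_n(\hat f,\mathcal{F})$. *)

theory Defs
  imports
    "HOL-Probability.Probability"
    "Jordan_Normal_Form.Determinant"
    "Jordan_Normal_Form.Gauss_Jordan_Elimination"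
begin

text \<open>
  The dimension \<open>d\<close> is quantified inside the theorem, so \<open>\<real>\<^sup>d\<close> cannot be a type indexed by \<open>d\<close>.
  Coordinates, vertices and matrix indices all run over \<open>{..<d}\<close> (in place of \<open>{1, \<dots>, d}\<close>),
  the convention of the matrix library.  Points of \<open>\<real>\<^sup>d\<close> are extensional functions on \<open>{..<d}\<close>.
\<close>

definition lebesgue_Rd :: "nat \<Rightarrow> (nat \<Rightarrow> real) measure" where
  "lebesgue_Rd d = Pi\<^sub>M {..<d} (\<lambda>_. lborel)"

definition simple_graph :: "'v set \<Rightarrow> 'v set set \<Rightarrow> bool" where
  "simple_graph V E \<longleftrightarrow> (\<forall>e\<in>E. e \<subseteq> V \<and> card e = 2)"


subsection \<open>Normal graphical models\<close>

definition pos_def_mats :: "nat \<Rightarrow> real mat set" where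
  "pos_def_mats d = {S \<in> carrier_mat d d. transpose_mat S = S \<and>
     (\<forall>v \<in> carrier_vec d. v \<noteq> 0\<^sub>v d \<longrightarrow> scalar_prod v (S *\<^sub>v v) > 0)}"

text \<open>The library's \<^const>\<open>mat_inverse\<close> is option-valued; it is \<^const>\<open>Some\<close> on invertible matrices,
  in particular on positive definite ones.\<close>

abbreviation mat_inv :: "real mat \<Rightarrow> real mat" where
  "mat_inv S \<equiv> the (mat_inverse S)"

definition mvn_density :: "nat \<Rightarrow> real vec \<Rightarrow> real mat \<Rightarrow> (nat \<Rightarrow> real) \<Rightarrow> real" where
  "mvn_density d \<mu> S x =
     exp (- (1 / 2) * scalar_prod (Matrix.vec d x - \<mu>) (mat_inv S *\<^sub>v (Matrix.vec d x - \<mu>)))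
     / ((2 * pi) powr (real d / 2) * sqrt (Determinant.det S))"

definition graph_covs :: "nat \<Rightarrow> nat set set \<Rightarrow> real mat set" where
  "graph_covs d E = {S \<in> pos_def_mats d.
     \<forall>i<d. \<forall>j<d. i \<noteq> j \<and> {i, j} \<notin> E \<longrightarrow> mat_inv S $$ (i, j) = 0}"

definition normal_graphical_models :: "nat \<Rightarrow> nat set set \<Rightarrow> ((nat \<Rightarrow> real) \<Rightarrow> real) set" where
  "normal_graphical_models d E =
     {mvn_density d \<mu> S | \<mu> S. \<mu> \<in> carrier_vec d \<and> S \<in> graph_covs d E}"


subsection \<open>Minimax risk\<close>

text \<open>An estimate may be any measurable real function, integrable or not, so distances and risks
  take values in \<^typ>\<open>ennreal\<close>: with the Bochner integral a non-integrable estimate would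
  have distance 0 to every density.\<close>

definition tv_dist :: "'a measure \<Rightarrow> ('a \<Rightarrow> real) \<Rightarrow> ('a \<Rightarrow> real) \<Rightarrow> ennreal" where
  "tv_dist L f g = (1 / 2) * (\<integral>\<^sup>+ x. ennreal \<bar>f x - g x\<bar> \<partial>L)"

definition iid_samples :: "'a measure \<Rightarrow> nat \<Rightarrow> ('a \<Rightarrow> real) \<Rightarrow> (nat \<Rightarrow> 'a) measure" where
  "iid_samples L n f = Pi\<^sub>M {..<n} (\<lambda>_. density L (\<lambda>x. ennreal (f x)))"

text \<open>A randomized estimator is a pair \<open>(W, h)\<close>: a random seed \<open>w\<close> is drawn from the probability
  space \<open>W\<close> independently of the sample \<open>X\<close>, and the estimate is \<open>h X w\<close>.  Measurability is joint
  in the sample, the seed and the point of evaluation.  The seed space is an arbitrary probability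
  space on real numbers (with any \<open>\<sigma>\<close>-algebra); deterministic estimators are those with \<open>h X w\<close>
  independent of \<open>w\<close>.\<close>

definition estimators ::
    "'a measure \<Rightarrow> nat \<Rightarrow> (real measure \<times> ((nat \<Rightarrow> 'a) \<Rightarrow> real \<Rightarrow> 'a \<Rightarrow> real)) set" where
  "estimators L n = {(W, h). prob_space W \<and>
     (\<lambda>((X, w), x). h X w x) \<in> borel_measurable ((Pi\<^sub>M {..<n} (\<lambda>_. L) \<Otimes>\<^sub>M W) \<Otimes>\<^sub>M L)}"

definition estimator_risk ::
    "'a measure \<Rightarrow> nat \<Rightarrow> ('a \<Rightarrow> real) set
      \<Rightarrow> real measure \<times> ((nat \<Rightarrow> 'a) \<Rightarrow> real \<Rightarrow> 'a \<Rightarrow> real) \<Rightarrow> ennreal" where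
  "estimator_risk L n F = (\<lambda>(W, h).
     SUP f\<in>F. \<integral>\<^sup>+ (X, w). tv_dist L (h X w) f \<partial>(iid_samples L n f \<Otimes>\<^sub>M W))"

definition minimax_risk :: "'a measure \<Rightarrow> nat \<Rightarrow> ('a \<Rightarrow> real) set \<Rightarrow> ennreal" where
  "minimax_risk L n F = (INF est\<in>estimators L n. estimator_risk L n F est)"

end

theory Submission imports Defs
begin

text \<open>
  Both bounds are elementary; everything rests on the log-likelihood ratio of two members of the class
  and on the Jeffreys divergence \<open>J(f, g) = KL(f, g) + KL(g, f)\<close>, which bounds the total variation
  through \<open>TV \<le> sqrt (J / 2)\<close> and is additive over independent samples.

  Upper bound.  The class is an exponential family: the logarithm of a member is an affine function of
  the coordinates \<open>x i\<close> and of the products \<open>x i * x j\<close> over vertices and edges, hence of \<open>k = O(m + d)\<close>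
  statistics.  For a member \<open>f\<close>, expanding in an orthonormal basis of the span of the centred statistics
  shows that, simultaneously for all functions \<open>h\<close> in that span, the mean of \<open>h\<close> over a sample from \<open>f\<close> is
  in absolute value at most \<open>Z\<close> times the standard deviation of \<open>h\<close>, where \<open>Z\<close> is random with \<open>E Z\<^sup>2 \<le> k / n\<close>
  (\<open>uniform_average_bound\<close>).  The estimator selects, from a countable dense subfamily, a member \<open>g\<close> whose
  log-likelihood ratios to all other members have sample means close to what \<open>g\<close> predicts, measured
  in standard deviations (\<open>misfit\<close>).  The truth \<open>f\<close> has misfit at most \<open>Z\<close>, so the selected \<open>g\<close> has misfit
  not much larger.  Comparing \<open>f\<close> and \<open>g\<close> with each other, the two sample means cancel and leave
  \<open>J \<le> a * (sd\<^sub>f + sd\<^sub>g)\<close> with \<open>a = O(Z + sqrt (k / n))\<close>.  For normal densities the variance of the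
  log-likelihood ratio is at most \<open>4 * J * (1 + J)\<close> (\<open>mvn_variance_le_jeffreys\<close>); therefore \<open>J = O(a\<^sup>2)\<close>
  and the total variation is \<open>O(a)\<close>.  Truths outside the countable subfamily follow by Fatou's lemma
  (\<open>exponential_family_minimax_le\<close>).

  Lower bound.  Assouad's method is applied to \<open>2 ^ (m + d)\<close> centred normals whose precision matrices
  add \<open>\<delta>\<close> to the identity at the positions of a chosen set of vertices and edges, with \<open>\<delta>\<^sup>2\<close> of order
  \<open>1 / max n (m + d)\<close>.  The Frobenius norm of the perturbation is at most \<open>1 / 2\<close>, whatever the
  degrees of the graph, so that these matrices are positive definite.  Neighbouring models have \<open>J = O(1 / n)\<close> and cannot be
  told apart.  Models at Hamming distance \<open>h\<close> have total variation at least a multiple of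
  \<open>\<delta> * sqrt h \<ge> \<delta> * h / sqrt (m + d)\<close>: the total variation dominates the expectation of
  \<open>min 1 \<bar>Y\<bar> / 4\<close> for the log-likelihood ratio \<open>Y\<close>, and as \<open>Y\<close> is a quadratic polynomial in normal variables,
  its fourth moment is at most 48 times its squared second moment, which prevents \<open>\<bar>Y\<bar>\<close> from being
  much smaller than its \<open>L\<^sup>2\<close> norm (\<open>tv_dist_ge_variance\<close>).

  Normal calculations.  A precision matrix is factored as \<open>R\<^sup>T R\<close> with \<open>R\<close> lower triangular, and a
  triangular change of variables shows that the density is the law of \<open>\<mu> + B z\<close>, \<open>B = R\<^sup>-\<^sup>1\<close>, for standard normal \<open>z\<close>
  (\<open>mvn_whitening\<close>).  In the variable \<open>z\<close> that whitens one density, the log-likelihood ratio to another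
  is quadratic, with coefficients given by the matrix \<open>G = R1 * R0\<^sup>-\<^sup>1\<close> and the vector \<open>u = R1 (\<mu>0 - \<mu>1)\<close>.  Mean,
  variance and \<open>J\<close> are thus explicit in \<open>G\<close>, \<open>G\<^sup>-\<^sup>1\<close> and \<open>u\<close>, and comparing them is linear algebra with \<open>G - (G\<^sup>-\<^sup>1)\<^sup>T\<close>.
\<close>

section \<open>Total variation and the Jeffreys divergence\<close>

text \<open>Positivity is required at every point of the type, also outside the space of \<open>L\<close>, so that identities between logarithms
  of densities hold unconditionally.\<close>

definition positive_density :: "'a measure \<Rightarrow> ('a \<Rightarrow> real) \<Rightarrow> bool" where
  "positive_density L f \<longleftrightarrow>
     f \<in> borel_measurable L \<and> (\<forall>x. f x > 0) \<and> (\<integral>\<^sup>+ x. ennreal (f x) \<partial>L) = 1"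

definition log_ratio :: "('a \<Rightarrow> real) \<Rightarrow> ('a \<Rightarrow> real) \<Rightarrow> 'a \<Rightarrow> real" where
  "log_ratio f g x = ln (f x) - ln (g x)"

definition jeffreys :: "'a measure \<Rightarrow> ('a \<Rightarrow> real) \<Rightarrow> ('a \<Rightarrow> real) \<Rightarrow> real" where
  "jeffreys L f g = (\<integral>x. log_ratio f g x \<partial>density L f) - (\<integral>x. log_ratio f g x \<partial>density L g)"

definition sample_density :: "nat \<Rightarrow> ('a \<Rightarrow> real) \<Rightarrow> (nat \<Rightarrow> 'a) \<Rightarrow> real" where
  "sample_density n f X = (\<Prod>i<n. f (X i))"

lemma positive_densityD:
  assumes "positive_density L f"
  shows "f \<in> borel_measurable L" "f x > 0" "(\<integral>\<^sup>+ x. ennreal (f x) \<partial>L) = 1"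
  using assms by (auto simp: positive_density_def)

lemma prob_space_positive_density:
  assumes "positive_density L f" shows "prob_space (density L f)"
  using assms by (intro prob_spaceI) (auto simp: positive_density_def emeasure_density cong: nn_integral_cong)

lemma log_ratio_measurable [measurable]:
  assumes [measurable]: "f \<in> borel_measurable L" "g \<in> borel_measurable L"
  shows "log_ratio f g \<in> borel_measurable L"
  unfolding log_ratio_def by measurable

text \<open>Integrating this bound and optimizing over \<open>t\<close> replaces Pinsker's inequality.  By the arithmetic-geometric
  mean inequality the left side is at most \<open>t / 2 * ((a - b)\<^sup>2 / (a + b)) + (a + b) / (2 * t)\<close>, and
  \<open>(a - b) / a \<le> ln a - ln b\<close> for \<open>a \<ge> b\<close>.\<close>

lemma abs_diff_le_log_ratio:
  fixes a b t :: real
  assumes "a > 0" "b > 0" "t > 0"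
  shows "\<bar>a - b\<bar> \<le> t / 2 * ((a - b) * (ln a - ln b)) + (a + b) / (2 * t)"
proof -
  have key: "(a - b)\<^sup>2 / (a + b) \<le> (a - b) * (ln a - ln b)" if "a > 0" "b > 0" "a \<ge> b" for a b :: real
  proof -
    have "ln (b / a) \<le> b / a - 1" using that by (intro ln_le_minus_one) auto
    then have "(a - b) / a \<le> ln a - ln b" using that by (simp add: ln_div field_simps)
    moreover have "(a - b) / (a + b) \<le> (a - b) / a" using that by (intro divide_left_mono) auto
    ultimately have "(a - b) * ((a - b) / (a + b)) \<le> (a - b) * (ln a - ln b)"
      using that by (intro mult_left_mono) auto
    then show ?thesis by (simp add: power2_eq_square)
  qed
  have k: "(a - b)\<^sup>2 / (a + b) \<le> (a - b) * (ln a - ln b)"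
  proof (cases "a \<ge> b")
    case False
    then have "(b - a)\<^sup>2 / (b + a) \<le> (b - a) * (ln b - ln a)" using assms by (intro key) auto
    then show ?thesis by (simp add: power2_commute algebra_simps)
  qed (use key assms in auto)
  have "0 \<le> (t * \<bar>a - b\<bar> - (a + b))\<^sup>2" by simp
  then have "2 * t * \<bar>a - b\<bar> * (a + b) \<le> t\<^sup>2 * (a - b)\<^sup>2 + (a + b)\<^sup>2"
    by (simp add: power2_eq_square algebra_simps abs_mult_self_eq)
  then have "2 * t * \<bar>a - b\<bar> \<le> (t\<^sup>2 * (a - b)\<^sup>2 + (a + b)\<^sup>2) / (a + b)"
    using assms by (simp add: pos_le_divide_eq)
  also have "\<dots> = t\<^sup>2 * ((a - b)\<^sup>2 / (a + b)) + (a + b)"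
    using assms by (simp add: add_divide_distrib power2_eq_square)
  finally have "\<bar>a - b\<bar> \<le> (t\<^sup>2 * ((a - b)\<^sup>2 / (a + b)) + (a + b)) / (2 * t)"
    using assms by (simp add: pos_le_divide_eq mult.commute)
  also have "\<dots> = t / 2 * ((a - b)\<^sup>2 / (a + b)) + (a + b) / (2 * t)"
    using assms by (simp add: add_divide_distrib power2_eq_square)
  finally have "\<bar>a - b\<bar> \<le> t / 2 * ((a - b)\<^sup>2 / (a + b)) + (a + b) / (2 * t)" .
  also have "\<dots> \<le> t / 2 * ((a - b) * (ln a - ln b)) + (a + b) / (2 * t)"
    using k assms by (intro add_mono mult_left_mono) auto
  finally show ?thesis .
qed

lemma positive_density_integrable:
  assumes "positive_density L f"
  shows "integrable L f" "(\<integral>x. f x \<partial>L) = 1"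
proof -
  have "(\<lambda>x. f x) \<in> borel_measurable L" "\<And>x. f x \<ge> 0"
    using assms by (auto simp: positive_density_def less_imp_le)
  moreover have "(\<integral>\<^sup>+ x. ennreal (f x) \<partial>L) = ennreal 1"
    using assms by (simp add: positive_density_def)
  ultimately have "has_bochner_integral L f 1"
    by (intro has_bochner_integral_nn_integral) auto
  then show "integrable L f" "(\<integral>x. f x \<partial>L) = 1"
    by (auto simp: has_bochner_integral_iff)
qed

lemma jeffreys_eq:
  assumes f: "positive_density L f" and g: "positive_density L g"
    and "integrable (density L f) (log_ratio f g)" "integrable (density L g) (log_ratio f g)"
  shows "integrable L (\<lambda>x. (f x - g x) * (ln (f x) - ln (g x)))"
    "jeffreys L f g = (\<integral>x. (f x - g x) * (ln (f x) - ln (g x)) \<partial>L)"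
proof -
  note [measurable] = positive_densityD(1)[OF f] positive_densityD(1)[OF g]
  have p: "\<And>x. f x \<ge> 0" "\<And>x. g x \<ge> 0" using f g by (auto simp: positive_density_def less_imp_le)
  have "integrable L (\<lambda>x. f x * log_ratio f g x)" "integrable L (\<lambda>x. g x * log_ratio f g x)"
    using assms(3,4) p by (simp_all add: integrable_density)
  then have "integrable L (\<lambda>x. f x * log_ratio f g x - g x * log_ratio f g x)"
    "jeffreys L f g = (\<integral>x. f x * log_ratio f g x - g x * log_ratio f g x \<partial>L)"
    using p by (auto simp: jeffreys_def integral_density)
  then show "integrable L (\<lambda>x. (f x - g x) * (ln (f x) - ln (g x)))"
    "jeffreys L f g = (\<integral>x. (f x - g x) * (ln (f x) - ln (g x)) \<partial>L)"
    by (simp_all add: log_ratio_def algebra_simps)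
qed

lemma jeffreys_nonneg:
  assumes f: "positive_density L f" and g: "positive_density L g"
    and "integrable (density L f) (log_ratio f g)" "integrable (density L g) (log_ratio f g)"
  shows "jeffreys L f g \<ge> 0"
proof -
  have "(f x - g x) * (ln (f x) - ln (g x)) \<ge> 0" for x
    using positive_densityD(2)[OF f] positive_densityD(2)[OF g]
    by (auto simp: zero_le_mult_iff)
  then show ?thesis unfolding jeffreys_eq(2)[OF assms] by (intro Bochner_Integration.integral_nonneg) auto
qed

text \<open>The integrated form of \<open>abs_diff_le_log_ratio\<close>.  It is applied both to single densities
  and to the densities of whole samples.\<close>

lemma integral_abs_diff_le_jeffreys:
  assumes f: "positive_density L f" and g: "positive_density L g"
    and i: "integrable (density L f) (log_ratio f g)" "integrable (density L g) (log_ratio f g)"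
  shows "(\<integral>x. \<bar>f x - g x\<bar> \<partial>L) \<le> sqrt (2 * jeffreys L f g)"
proof -
  let ?J = "jeffreys L f g" and ?I = "\<integral>x. \<bar>f x - g x\<bar> \<partial>L"
  have J: "?J \<ge> 0" using assms by (rule jeffreys_nonneg)
  note fi = positive_density_integrable[OF f] and gi = positive_density_integrable[OF g]
  have b: "?I \<le> t / 2 * ?J + 1 / t" if t: "t > 0" for t
  proof -
    have "?I \<le> (\<integral>x. t / 2 * ((f x - g x) * (ln (f x) - ln (g x))) + (f x + g x) / (2 * t) \<partial>L)"
      using abs_diff_le_log_ratio[OF positive_densityD(2)[OF f] positive_densityD(2)[OF g] t]
        jeffreys_eq(1)[OF assms] fi gi
      by (intro integral_mono) auto
    also have "\<dots> = t / 2 * ?J + 1 / t"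
      using jeffreys_eq[OF assms] fi gi by simp
    finally show ?thesis .
  qed
  show ?thesis
  proof (cases "?J = 0")
    case True
    have "?I \<le> 0 + e" if "e > 0" for e using b[of "1/e"] that True by simp
    then have "?I \<le> 0" by (rule field_le_epsilon)
    then show ?thesis using True by simp
  next
    case False
    let ?s = "sqrt (2 * ?J)"
    have s: "?s > 0" "?s * ?s = 2 * ?J" using False J by auto
    \<comment> \<open>At this \<open>t\<close> the two terms are equal.\<close>
    have "?I \<le> (2 / ?s) / 2 * ?J + 1 / (2 / ?s)" using s by (intro b) auto
    also have "\<dots> = ?J / ?s + ?s / 2" by simp
    also have "?J / ?s = ?s / 2" using s by (simp add: field_simps)
    finally show ?thesis by simp
  qed
qed

lemma tv_dist_eq_integral:
  assumes "positive_density L f" "positive_density L g"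
  shows "tv_dist L f g = ennreal ((\<integral>x. \<bar>f x - g x\<bar> \<partial>L) / 2)"
proof -
  have "integrable L (\<lambda>x. \<bar>f x - g x\<bar>)"
    using positive_density_integrable[OF assms(1)] positive_density_integrable[OF assms(2)] by auto
  then show ?thesis
    by (simp add: tv_dist_def nn_integral_eq_integral ennreal_divide_numeral[symmetric]
        ennreal_divide_times divide_ennreal_def mult.commute integral_nonneg)
qed

lemma tv_dist_le_jeffreys:
  assumes "positive_density L f" "positive_density L g"
    and "integrable (density L f) (log_ratio f g)" "integrable (density L g) (log_ratio f g)"
  shows "tv_dist L f g \<le> ennreal (sqrt (2 * jeffreys L f g) / 2)"
  unfolding tv_dist_eq_integral[OF assms(1,2)]
  using integral_abs_diff_le_jeffreys[OF assms] by (intro ennreal_leI) auto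

lemma tv_dist_le_1:
  assumes f: "positive_density L f" and g: "positive_density L g"
  shows "tv_dist L f g \<le> 1"
proof -
  note fi = positive_density_integrable[OF f] and gi = positive_density_integrable[OF g]
  have "(\<integral>x. \<bar>f x - g x\<bar> \<partial>L) \<le> (\<integral>x. f x + g x \<partial>L)"
    using fi gi positive_densityD(2)[OF f] positive_densityD(2)[OF g]
    by (intro integral_mono) (auto simp: abs_le_iff intro: add_pos_pos less_imp_le)
  also have "\<dots> = 2" using fi gi by simp
  finally show ?thesis unfolding tv_dist_eq_integral[OF assms] by simp
qed

section \<open>Densities of samples\<close>

lemma sigma_finite_positive_density:
  assumes "positive_density L f" shows "sigma_finite_measure (density L f)"
proof -
  interpret prob_space "density L f" by (rule prob_space_positive_density[OF assms])
  show ?thesis by unfold_locales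
qed

lemma sample_density_measurable:
  assumes f: "f \<in> borel_measurable L"
  shows "sample_density n f \<in> borel_measurable (Pi\<^sub>M {..<n} (\<lambda>_. L))"
  unfolding sample_density_def using f by measurable

lemma iid_samples_eq_density:
  assumes L: "sigma_finite_measure L" and f: "positive_density L f"
  shows "iid_samples L n f = density (Pi\<^sub>M {..<n} (\<lambda>_. L)) (\<lambda>X. ennreal (sample_density n f X))"
proof -
  note [measurable] = positive_densityD(1)[OF f] sample_density_measurable[OF positive_densityD(1)[OF f], of n]
  interpret D: product_sigma_finite "\<lambda>_::nat. density L f"
    using sigma_finite_positive_density[OF f] by (simp add: product_sigma_finite_def)
  interpret P: product_sigma_finite "\<lambda>_::nat. L"
    using L by (simp add: product_sigma_finite_def)
  show ?thesis unfolding iid_samples_def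
  proof (rule D.PiM_eqI[symmetric])
    show "sets (density (Pi\<^sub>M {..<n} (\<lambda>_. L)) (\<lambda>X. ennreal (sample_density n f X)))
        = sets (Pi\<^sub>M {..<n} (\<lambda>_. density L f))"
      by (simp cong: sets_PiM_cong)
  next
    fix A assume A: "\<And>i. i \<in> {..<n} \<Longrightarrow> A i \<in> sets (density L f)"
    then have A': "\<And>i. i \<in> {..<n} \<Longrightarrow> A i \<in> sets L" by simp
    then have AP: "Pi\<^sub>E {..<n} A \<in> sets (Pi\<^sub>M {..<n} (\<lambda>_. L))" by (intro sets_PiM_I_finite) auto
    have "emeasure (density (Pi\<^sub>M {..<n} (\<lambda>_. L)) (\<lambda>X. ennreal (sample_density n f X))) (Pi\<^sub>E {..<n} A)
        = (\<integral>\<^sup>+ X. ennreal (sample_density n f X) * indicator (Pi\<^sub>E {..<n} A) X \<partial>Pi\<^sub>M {..<n} (\<lambda>_. L))"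
      using AP by (intro emeasure_density) auto
    also have "\<dots> = (\<integral>\<^sup>+ X. (\<Prod>i<n. ennreal (f (X i)) * indicator (A i) (X i)) \<partial>Pi\<^sub>M {..<n} (\<lambda>_. L))"
    proof (intro nn_integral_cong)
      fix X assume X: "X \<in> space (Pi\<^sub>M {..<n} (\<lambda>_. L))"
      then have "indicator (Pi\<^sub>E {..<n} A) X = (\<Prod>i<n. indicator (A i) (X i) :: ennreal)"
        by (auto simp: space_PiM indicator_def PiE_iff prod.If_cases split: if_splits)
      moreover have "ennreal (sample_density n f X) = (\<Prod>i<n. ennreal (f (X i)))"
        unfolding sample_density_def using positive_densityD(2)[OF f]
        by (intro prod_ennreal[symmetric]) (auto simp: less_imp_le)
      ultimately show "ennreal (sample_density n f X) * indicator (Pi\<^sub>E {..<n} A) X =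
        (\<Prod>i<n. ennreal (f (X i)) * indicator (A i) (X i))" by (simp add: prod.distrib)
    qed
    also have "\<dots> = (\<Prod>i<n. \<integral>\<^sup>+ x. ennreal (f x) * indicator (A i) x \<partial>L)"
      using A' by (intro P.product_nn_integral_prod) auto
    also have "\<dots> = (\<Prod>i<n. emeasure (density L f) (A i))"
      using A' by (intro prod.cong) (auto simp: emeasure_density)
    finally show "emeasure (density (Pi\<^sub>M {..<n} (\<lambda>_. L)) (\<lambda>X. ennreal (sample_density n f X))) (Pi\<^sub>E {..<n} A)
      = (\<Prod>i<n. emeasure (density L f) (A i))" .
  qed auto
qed

lemma prob_space_iid:
  assumes "positive_density L f" shows "prob_space (iid_samples L n f)"
  unfolding iid_samples_def by (intro prob_space_PiM prob_space_positive_density assms)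

lemma sets_iid: "sets (iid_samples L n f) = sets (Pi\<^sub>M {..<n} (\<lambda>_. L))"
  unfolding iid_samples_def by (simp cong: sets_PiM_cong)

lemma positive_sample_density:
  assumes L: "sigma_finite_measure L" and f: "positive_density L f"
  shows "positive_density (Pi\<^sub>M {..<n} (\<lambda>_. L)) (sample_density n f)"
proof -
  interpret prob_space "iid_samples L n f" by (rule prob_space_iid[OF f])
  note [measurable] = sample_density_measurable[OF positive_densityD(1)[OF f], of n]
  have "emeasure (iid_samples L n f) (space (iid_samples L n f)) = 1" by (rule emeasure_space_1)
  then have "(\<integral>\<^sup>+ x. ennreal (sample_density n f x) \<partial>Pi\<^sub>M {..<n} (\<lambda>_. L)) = 1"
    unfolding iid_samples_eq_density[OF L f] by (simp add: emeasure_density cong: nn_integral_cong)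
  then show ?thesis
    using positive_densityD(2)[OF f] by (auto simp: positive_density_def sample_density_def intro!: prod_pos)
qed

lemma (in prob_space) PiM_component_integral:
  fixes h :: "'a \<Rightarrow> real"
  assumes h: "integrable M h" and i: "i < (n::nat)"
  shows "integrable (Pi\<^sub>M {..<n} (\<lambda>_. M)) (\<lambda>X. h (X i))"
    "(\<integral>X. h (X i) \<partial>Pi\<^sub>M {..<n} (\<lambda>_. M)) = (\<integral>x. h x \<partial>M)"
proof -
  have e: "distr (Pi\<^sub>M {..<n} (\<lambda>_. M)) M (\<lambda>X. X i) = M"
    using i prob_space_axioms by (intro distr_PiM_component) auto
  have m: "(\<lambda>X. X i) \<in> Pi\<^sub>M {..<n} (\<lambda>_. M) \<rightarrow>\<^sub>M M"
    using i by (intro measurable_component_singleton) auto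
  have "integrable (distr (Pi\<^sub>M {..<n} (\<lambda>_. M)) M (\<lambda>X. X i)) h" unfolding e by (rule h)
  then show "integrable (Pi\<^sub>M {..<n} (\<lambda>_. M)) (\<lambda>X. h (X i))" using m by (rule integrable_distr[rotated])
  have "(\<integral>x. h x \<partial>M) = (\<integral>x. h x \<partial>distr (Pi\<^sub>M {..<n} (\<lambda>_. M)) M (\<lambda>X. X i))"
    unfolding e ..
  also have "\<dots> = (\<integral>X. h (X i) \<partial>Pi\<^sub>M {..<n} (\<lambda>_. M))" using h by (intro integral_distr m) auto
  finally show "(\<integral>X. h (X i) \<partial>Pi\<^sub>M {..<n} (\<lambda>_. M)) = (\<integral>x. h x \<partial>M)" ..
qed

lemma log_ratio_sample:
  assumes f: "positive_density L f" and g: "positive_density L g"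
  shows "log_ratio (sample_density n f) (sample_density n g) X = (\<Sum>i<n. log_ratio f g (X i))"
proof -
  have "f (X i) \<noteq> 0" "g (X i) \<noteq> 0" for i
    using positive_densityD(2)[OF f, of "X i"] positive_densityD(2)[OF g, of "X i"] by auto
  then show ?thesis
    unfolding log_ratio_def sample_density_def by (simp add: ln_prod sum_subtractf)
qed

text \<open>Log-likelihood ratios add up over independent observations, hence so does the divergence.\<close>

lemma jeffreys_sample:
  assumes L: "sigma_finite_measure L" and f: "positive_density L f" and g: "positive_density L g"
    and i: "integrable (density L f) (log_ratio f g)" "integrable (density L g) (log_ratio f g)"
  shows "integrable (density (Pi\<^sub>M {..<n} (\<lambda>_. L)) (sample_density n f))
           (log_ratio (sample_density n f) (sample_density n g))"
    "integrable (density (Pi\<^sub>M {..<n} (\<lambda>_. L)) (sample_density n g))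
           (log_ratio (sample_density n f) (sample_density n g))"
    "jeffreys (Pi\<^sub>M {..<n} (\<lambda>_. L)) (sample_density n f) (sample_density n g) = real n * jeffreys L f g"
proof -
  interpret F: prob_space "density L f" by (rule prob_space_positive_density[OF f])
  interpret G: prob_space "density L g" by (rule prob_space_positive_density[OF g])
  note cF = F.PiM_component_integral[OF i(1), where n = n, folded iid_samples_def]
    and cG = G.PiM_component_integral[OF i(2), where n = n, folded iid_samples_def]
  have e: "log_ratio (sample_density n f) (sample_density n g) = (\<lambda>X. \<Sum>i<n. log_ratio f g (X i))"
    by (rule ext) (rule log_ratio_sample[OF f g])
  note q = iid_samples_eq_density[OF L f, of n, symmetric] iid_samples_eq_density[OF L g, of n, symmetric]
  show "integrable (density (Pi\<^sub>M {..<n} (\<lambda>_. L)) (sample_density n f))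
           (log_ratio (sample_density n f) (sample_density n g))"
    "integrable (density (Pi\<^sub>M {..<n} (\<lambda>_. L)) (sample_density n g))
           (log_ratio (sample_density n f) (sample_density n g))"
    unfolding e q using cF(1) cG(1)
    by (auto intro!: Bochner_Integration.integrable_sum)
  have "(\<integral>X. (\<Sum>i<n. log_ratio f g (X i)) \<partial>iid_samples L n f) = real n * (\<integral>x. log_ratio f g x \<partial>density L f)"
    using cF by (subst Bochner_Integration.integral_sum) auto
  moreover have "(\<integral>X. (\<Sum>i<n. log_ratio f g (X i)) \<partial>iid_samples L n g) = real n * (\<integral>x. log_ratio f g x \<partial>density L g)"
    using cG by (subst Bochner_Integration.integral_sum) auto
  ultimately show "jeffreys (Pi\<^sub>M {..<n} (\<lambda>_. L)) (sample_density n f) (sample_density n g) = real n * jeffreys L f g"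
    by (simp add: jeffreys_def e q right_diff_distrib)
qed

section \<open>Sample averages over a finite-dimensional space of functions\<close>

definition sq_integrable :: "'a measure \<Rightarrow> ('a \<Rightarrow> real) \<Rightarrow> bool" where
  "sq_integrable P f \<longleftrightarrow> f \<in> borel_measurable P \<and> integrable P (\<lambda>x. (f x)\<^sup>2)"

lemma sq_integrable_mult:
  assumes "sq_integrable P f" "sq_integrable P g"
  shows "integrable P (\<lambda>x. f x * g x)"
proof (rule Bochner_Integration.integrable_bound)
  show "integrable P (\<lambda>x. (f x)\<^sup>2 + (g x)\<^sup>2)" using assms by (auto simp: sq_integrable_def)
  show "(\<lambda>x. f x * g x) \<in> borel_measurable P" using assms by (auto simp: sq_integrable_def)
  have "\<bar>a * b\<bar> \<le> a\<^sup>2 + b\<^sup>2" for a b :: real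
  proof -
    have "2 * (\<bar>a\<bar> * \<bar>b\<bar>) \<le> a\<^sup>2 + b\<^sup>2"
      using zero_le_power2[of "\<bar>a\<bar> - \<bar>b\<bar>"] by (simp add: power2_diff)
    moreover have "0 \<le> \<bar>a\<bar> * \<bar>b\<bar>" by simp
    ultimately show ?thesis unfolding abs_mult by linarith
  qed
  then show "AE x in P. norm (f x * g x) \<le> norm ((f x)\<^sup>2 + (g x)\<^sup>2)" by simp
qed

lemma sq_integrable_add:
  assumes "sq_integrable P f" "sq_integrable P g"
  shows "sq_integrable P (\<lambda>x. f x + g x)"
  using assms sq_integrable_mult[OF assms]
  by (auto simp: sq_integrable_def power2_sum mult.assoc)

lemma sq_integrable_scale:
  assumes "sq_integrable P f" shows "sq_integrable P (\<lambda>x. c * f x)"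
  using assms by (auto simp: sq_integrable_def power_mult_distrib)

lemma sq_integrable_diff:
  assumes "sq_integrable P f" "sq_integrable P g"
  shows "sq_integrable P (\<lambda>x. f x - g x)"
  using sq_integrable_add[OF assms(1) sq_integrable_scale[OF assms(2), of "-1"]] by simp

lemma sq_integrable_sum:
  assumes "\<And>a. a \<in> A \<Longrightarrow> sq_integrable P (f a)"
  shows "sq_integrable P (\<lambda>x. \<Sum>a\<in>A. f a x)"
  using assms
proof (induction A rule: infinite_finite_induct)
  case (insert a A)
  then show ?case using sq_integrable_add[of P "f a" "\<lambda>x. \<Sum>a\<in>A. f a x"] by simp
qed (auto simp: sq_integrable_def)

lemma (in prob_space) sq_integrable_const: "sq_integrable M (\<lambda>x. c)"
  by (auto simp: sq_integrable_def)

lemma (in prob_space) sq_integrable_integrable: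
  assumes "sq_integrable M f" shows "integrable M f"
  using sq_integrable_mult[OF assms sq_integrable_const[of 1]] by simp

lemma sq_integrable_lincomb:
  assumes "\<And>a. a \<in> A \<Longrightarrow> sq_integrable P (g a)"
  shows "sq_integrable P (\<lambda>x. \<Sum>a\<in>A. w a * g a x)"
  using assms by (intro sq_integrable_sum sq_integrable_scale)

lemma integral_null_square:
  assumes "sq_integrable P h" "sq_integrable P g" "(\<integral>x. (h x)\<^sup>2 \<partial>P) = 0"
  shows "(\<integral>x. g x * h x \<partial>P) = 0"
proof -
  have "AE x in P. (h x)\<^sup>2 = 0"
    using assms integral_nonneg_eq_0_iff_AE[of P "\<lambda>x. (h x)\<^sup>2"] by (auto simp: sq_integrable_def)
  then have "AE x in P. g x * h x = 0" by auto
  then show ?thesis by (rule integral_eq_zero_AE)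
qed

text \<open>One Gram-Schmidt step per element of \<open>A\<close>.  If the functions are linearly dependent in \<open>L\<^sup>2\<close>, a new direction \<open>c'\<close>
  can be null; division by zero then sets its coefficient to \<open>0\<close>, and a null function is orthogonal to everything.\<close>

lemma orthogonal_projection_exists:
  assumes "finite A" "\<And>a. a \<in> A \<Longrightarrow> sq_integrable P (g a)" "sq_integrable P f"
  shows "\<exists>p. \<forall>a\<in>A. (\<integral>x. g a x * (f x - (\<Sum>b\<in>A. p b * g b x)) \<partial>P) = 0"
  using assms
proof (induction A arbitrary: f rule: finite_induct)
  case empty
  then show ?case by simp
next
  case (insert c A)
  obtain p where p: "\<And>a. a \<in> A \<Longrightarrow> (\<integral>x. g a x * (f x - (\<Sum>b\<in>A. p b * g b x)) \<partial>P) = 0"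
    using insert.IH[of f] insert.prems by auto
  obtain q where q: "\<And>a. a \<in> A \<Longrightarrow> (\<integral>x. g a x * (g c x - (\<Sum>b\<in>A. q b * g b x)) \<partial>P) = 0"
    using insert.IH[of "g c"] insert.prems by auto
  define f' where "f' x = f x - (\<Sum>b\<in>A. p b * g b x)" for x
  define c' where "c' x = g c x - (\<Sum>b\<in>A. q b * g b x)" for x
  have sf: "sq_integrable P f'" and sc: "sq_integrable P c'"
    unfolding f'_def c'_def
    using insert.prems by (auto intro!: sq_integrable_diff sq_integrable_lincomb)
  define t where "t = (\<integral>x. c' x * f' x \<partial>P) / (\<integral>x. (c' x)\<^sup>2 \<partial>P)"
  define r where "r b = (if b = c then t else p b - t * q b)" for b
  have r: "f x - (\<Sum>b\<in>insert c A. r b * g b x) = f' x - t * c' x" for x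
  proof -
    have "(\<Sum>b\<in>A. r b * g b x) = (\<Sum>b\<in>A. p b * g b x) - t * (\<Sum>b\<in>A. q b * g b x)"
      unfolding sum_distrib_left sum_subtractf[symmetric]
      using insert.hyps by (intro sum.cong) (auto simp: r_def algebra_simps)
    then show ?thesis using insert.hyps by (simp add: f'_def c'_def r_def algebra_simps)
  qed
  have oA: "(\<integral>x. g a x * (f' x - t * c' x) \<partial>P) = 0" if "a \<in> A" for a
  proof -
    have "integrable P (\<lambda>x. g a x * f' x)" "integrable P (\<lambda>x. g a x * c' x)"
      using sf sc insert.prems that by (auto intro!: sq_integrable_mult)
    then have "(\<integral>x. g a x * f' x - t * (g a x * c' x) \<partial>P) = 0"
      using p[OF that] q[OF that] by (simp add: f'_def c'_def)
    then show ?thesis by (simp add: algebra_simps)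
  qed
  have oc': "(\<integral>x. c' x * (f' x - t * c' x) \<partial>P) = 0"
  proof (cases "(\<integral>x. (c' x)\<^sup>2 \<partial>P) = 0")
    case True
    have "sq_integrable P (\<lambda>x. f' x - t * c' x)"
      using sq_integrable_diff[OF sf sq_integrable_scale[OF sc, of t]] by simp
    from integral_null_square[OF sc this True] show ?thesis by (simp add: mult.commute)
  next
    case False
    have "(\<integral>x. c' x * f' x - t * (c' x)\<^sup>2 \<partial>P) = (\<integral>x. c' x * f' x \<partial>P) - t * (\<integral>x. (c' x)\<^sup>2 \<partial>P)"
      using sq_integrable_mult[OF sc sf] sc by (subst Bochner_Integration.integral_diff) (auto simp: sq_integrable_def)
    also have "\<dots> = 0" using False by (simp add: t_def)
    finally show ?thesis by (simp add: algebra_simps power2_eq_square)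
  qed
  have sd: "sq_integrable P (\<lambda>x. f' x - t * c' x)"
    using sq_integrable_diff[OF sf sq_integrable_scale[OF sc, of t]] by simp
  have "(\<integral>x. g c x * (f' x - t * c' x) \<partial>P)
      = (\<integral>x. c' x * (f' x - t * c' x) + (\<Sum>b\<in>A. q b * (g b x * (f' x - t * c' x))) \<partial>P)"
  proof (intro Bochner_Integration.integral_cong refl)
    fix x
    have "g c x * (f' x - t * c' x) = (c' x + (\<Sum>b\<in>A. q b * g b x)) * (f' x - t * c' x)"
      by (simp add: c'_def)
    also have "\<dots> = c' x * (f' x - t * c' x) + (\<Sum>b\<in>A. q b * (g b x * (f' x - t * c' x)))"
      by (simp only: distrib_right sum_distrib_right mult.assoc)
    finally show "g c x * (f' x - t * c' x)
      = c' x * (f' x - t * c' x) + (\<Sum>b\<in>A. q b * (g b x * (f' x - t * c' x)))" .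
  qed
  also have "\<dots> = 0 + (\<Sum>b\<in>A. q b * 0)"
    using sq_integrable_mult[OF sc sd] sq_integrable_mult[OF _ sd] insert.prems oA oc'
    by (subst Bochner_Integration.integral_add)
      (auto intro!: Bochner_Integration.integrable_sum sum.neutral simp: Bochner_Integration.integral_sum)
  finally have oc: "(\<integral>x. g c x * (f' x - t * c' x) \<partial>P) = 0" by simp
  show ?case using oA oc r by (intro exI[of _ r]) auto
qed

lemma (in prob_space) PiM_cross_integral:
  fixes h :: "'a \<Rightarrow> real"
  assumes h: "integrable M h" "(\<integral>x. h x \<partial>M) = 0" and ij: "i < (n::nat)" "j < n" "i \<noteq> j"
  shows "integrable (Pi\<^sub>M {..<n} (\<lambda>_. M)) (\<lambda>X. h (X i) * h (X j))"
    "(\<integral>X. h (X i) * h (X j) \<partial>Pi\<^sub>M {..<n} (\<lambda>_. M)) = 0"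
proof -
  interpret P: product_sigma_finite "\<lambda>_::nat. M"
    by (simp add: product_sigma_finite_def sigma_finite_measure_axioms)
  define F where "F k = (if k \<in> {i, j} then h else (\<lambda>_. 1))" for k
  have F: "integrable M (F k)" for k using h by (auto simp: F_def)
  have e: "(\<Prod>k<n. F k (X k)) = h (X i) * h (X j)" for X
  proof -
    have "(\<Prod>k<n. F k (X k)) = (\<Prod>k\<in>{i,j}. F k (X k))"
      using ij by (intro prod.mono_neutral_right) (auto simp: F_def)
    then show ?thesis using ij by (simp add: F_def)
  qed
  show "integrable (Pi\<^sub>M {..<n} (\<lambda>_. M)) (\<lambda>X. h (X i) * h (X j))"
    using P.product_integrable_prod[of "{..<n}" F] F by (simp add: e)
  have "(\<integral>X. h (X i) * h (X j) \<partial>Pi\<^sub>M {..<n} (\<lambda>_. M)) = (\<Prod>k<n. (\<integral>x. F k x \<partial>M))"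
    using P.product_integral_prod[of "{..<n}" F] F by (simp add: e)
  also have "\<dots> = 0" using ij h by (intro prod_zero) (auto simp: F_def intro!: bexI[of _ i])
  finally show "(\<integral>X. h (X i) * h (X j) \<partial>Pi\<^sub>M {..<n} (\<lambda>_. M)) = 0" .
qed

text \<open>Off-diagonal products of independent centred variables have expectation \<open>0\<close>.\<close>

lemma (in prob_space) mean_square_sum:
  fixes h :: "'a \<Rightarrow> real"
  assumes h: "sq_integrable M h" "(\<integral>x. h x \<partial>M) = 0"
  shows "integrable (Pi\<^sub>M {..<n::nat} (\<lambda>_. M)) (\<lambda>X. (\<Sum>i<n. h (X i))\<^sup>2)"
    "(\<integral>X. (\<Sum>i<n. h (X i))\<^sup>2 \<partial>Pi\<^sub>M {..<n} (\<lambda>_. M)) = n * (\<integral>x. (h x)\<^sup>2 \<partial>M)"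
proof -
  have hi: "integrable M h" using h by (intro sq_integrable_integrable)
  have h2: "integrable M (\<lambda>x. (h x)\<^sup>2)" using h by (simp add: sq_integrable_def)
  have e: "(\<Sum>i<n. h (X i))\<^sup>2 = (\<Sum>i<n. \<Sum>j<n. h (X i) * h (X j))" for X
    by (simp add: power2_eq_square sum_product)
  have I: "integrable (Pi\<^sub>M {..<n} (\<lambda>_. M)) (\<lambda>X. h (X i) * h (X j))"
    and E: "(\<integral>X. h (X i) * h (X j) \<partial>Pi\<^sub>M {..<n} (\<lambda>_. M)) = (if i = j then (\<integral>x. (h x)\<^sup>2 \<partial>M) else 0)"
    if "i < n" "j < n" for i j
    using PiM_component_integral[OF h2, of i n] PiM_cross_integral[OF hi h(2), of i n j] that
    by (cases "i = j"; simp add: power2_eq_square)+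
  show "integrable (Pi\<^sub>M {..<n} (\<lambda>_. M)) (\<lambda>X. (\<Sum>i<n. h (X i))\<^sup>2)"
    unfolding e using I by (intro Bochner_Integration.integrable_sum) auto
  show "(\<integral>X. (\<Sum>i<n. h (X i))\<^sup>2 \<partial>Pi\<^sub>M {..<n} (\<lambda>_. M)) = n * (\<integral>x. (h x)\<^sup>2 \<partial>M)"
  proof -
    have "(\<integral>X. (\<Sum>i<n. \<Sum>j<n. h (X i) * h (X j)) \<partial>Pi\<^sub>M {..<n} (\<lambda>_. M))
        = (\<Sum>i<n. \<Sum>j<n. (\<integral>X. h (X i) * h (X j) \<partial>Pi\<^sub>M {..<n} (\<lambda>_. M)))"
      using I by (subst Bochner_Integration.integral_sum)
        (auto intro!: sum.cong Bochner_Integration.integral_sum Bochner_Integration.integrable_sum)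
    also have "\<dots> = (\<Sum>i<n. \<Sum>j<n. if i = j then (\<integral>x. (h x)\<^sup>2 \<partial>M) else 0)"
      using E by (intro sum.cong) auto
    finally show ?thesis unfolding e by simp
  qed
qed

lemma cauchy_schwarz_two_terms:
  fixes x y :: real
  assumes "x\<^sup>2 \<le> a * c" "y\<^sup>2 \<le> b * d" "a \<ge> 0" "b \<ge> 0" "c \<ge> 0" "d \<ge> 0"
  shows "(x + y)\<^sup>2 \<le> (a + b) * (c + d)"
proof -
  have "\<bar>x\<bar> \<le> sqrt a * sqrt c" "\<bar>y\<bar> \<le> sqrt b * sqrt d"
    using assms by (auto simp: real_sqrt_mult[symmetric] intro!: real_le_rsqrt)
  then have "\<bar>x\<bar> * \<bar>y\<bar> \<le> (sqrt a * sqrt c) * (sqrt b * sqrt d)"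
    using assms by (intro mult_mono) auto
  moreover have "2 * ((sqrt a * sqrt c) * (sqrt b * sqrt d)) \<le> a * d + b * c"
    using zero_le_power2[of "sqrt a * sqrt d - sqrt b * sqrt c"] assms
    by (simp add: power2_diff power_mult_distrib algebra_simps)
  moreover have "2 * x * y \<le> 2 * (\<bar>x\<bar> * \<bar>y\<bar>)" by (simp add: abs_mult[symmetric])
  ultimately have "2 * x * y \<le> a * d + b * c" by linarith
  then show ?thesis using assms by (simp add: power2_sum algebra_simps)
qed

text \<open>The dimension bound behind the rate.  For an orthonormal basis of the span of the \<open>g a\<close>, take for \<open>V\<close> the sum of the
  squared sample means of the basis functions: each contributes \<open>1 / n\<close> in expectation, and the Cauchy-Schwarz
  inequality handles all linear combinations at once.  The induction adds one basis function at a time, the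
  component \<open>h\<close> of \<open>g b\<close> orthogonal to its predecessors.\<close>

lemma (in prob_space) uniform_average_bound:
  assumes n: "n \<ge> 1" and "finite A" "\<And>a. a \<in> A \<Longrightarrow> sq_integrable M (g a)"
    "\<And>a. a \<in> A \<Longrightarrow> (\<integral>x. g a x \<partial>M) = 0"
  shows "\<exists>V. V \<in> borel_measurable (Pi\<^sub>M {..<n::nat} (\<lambda>_. M)) \<and> (\<forall>X. V X \<ge> (0::real)) \<and>
     (\<integral>\<^sup>+ X. ennreal (V X) \<partial>Pi\<^sub>M {..<n} (\<lambda>_. M)) \<le> ennreal (card A / n) \<and>
     (AE X in Pi\<^sub>M {..<n} (\<lambda>_. M). \<forall>w. ((\<Sum>i<n. \<Sum>a\<in>A. w a * g a (X i)) / n)\<^sup>2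
        \<le> V X * (\<integral>x. (\<Sum>a\<in>A. w a * g a x)\<^sup>2 \<partial>M))"
  using assms(2-)
proof (induction A rule: finite_induct)
  case empty
  show ?case by (intro exI[of _ "\<lambda>_. 0"]) auto
next
  case (insert b A)
  let ?P = "Pi\<^sub>M {..<n} (\<lambda>_. M)"
  from insert obtain V where V: "V \<in> borel_measurable ?P" "\<And>X. V X \<ge> 0"
     "(\<integral>\<^sup>+ X. ennreal (V X) \<partial>?P) \<le> ennreal (card A / n)"
     "AE X in ?P. \<forall>w. ((\<Sum>i<n. \<Sum>a\<in>A. w a * g a (X i)) / n)\<^sup>2
        \<le> V X * (\<integral>x. (\<Sum>a\<in>A. w a * g a x)\<^sup>2 \<partial>M)" by auto
  obtain p where p: "\<And>a. a \<in> A \<Longrightarrow> (\<integral>x. g a x * (g b x - (\<Sum>c\<in>A. p c * g c x)) \<partial>M) = 0"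
    using orthogonal_projection_exists[of A M g "g b"] insert by auto
  define h where "h x = g b x - (\<Sum>c\<in>A. p c * g c x)" for x
  have h: "sq_integrable M h"
    unfolding h_def using insert.prems by (auto intro!: sq_integrable_diff sq_integrable_lincomb)
  have gi: "integrable M (g a)" if "a \<in> insert b A" for a
    using insert.prems that by (intro sq_integrable_integrable)
  have h0: "(\<integral>x. h x \<partial>M) = 0"
    using insert.prems gi by (simp add: h_def Bochner_Integration.integral_sum)
  define \<eta> where "\<eta> = (\<integral>x. (h x)\<^sup>2 \<partial>M)"
  have \<eta>: "\<eta> \<ge> 0" by (simp add: \<eta>_def)
  define H where "H X = ((\<Sum>i<n. h (X i)) / n)\<^sup>2" for X
  have Hnonneg: "H X \<ge> 0" for X by (simp add: H_def)
  note hm = h[unfolded sq_integrable_def, THEN conjunct1]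
  have Hm: "H \<in> borel_measurable ?P" unfolding H_def using hm by measurable
  have Hint: "integrable ?P H" "(\<integral>X. H X \<partial>?P) = \<eta> / n"
    using mean_square_sum[OF h h0, of n] n
    by (simp_all add: H_def[abs_def] power_divide \<eta>_def power2_eq_square[of "real n"])
  have Hnn: "(\<integral>\<^sup>+ X. ennreal (H X) \<partial>?P) = ennreal (\<eta> / n)"
    using Hint Hnonneg by (simp add: nn_integral_eq_integral)
  \<comment> \<open>For \<open>\<eta> = 0\<close> the quotient is \<open>0\<close>, which is harmless: then \<open>H\<close> vanishes almost surely.\<close>
  define W where "W X = V X + H X / \<eta>" for X
  have Wnn: "W X \<ge> 0" for X using V(2)[of X] \<eta> by (auto simp: W_def H_def)
  have Wint: "(\<integral>\<^sup>+ X. ennreal (W X) \<partial>?P) \<le> ennreal (card (insert b A) / n)"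
  proof -
    have "(\<integral>\<^sup>+ X. ennreal (W X) \<partial>?P) = (\<integral>\<^sup>+ X. ennreal (V X) + ennreal (1 / \<eta>) * ennreal (H X) \<partial>?P)"
      using V(2) \<eta> by (intro nn_integral_cong) (auto simp: W_def H_def ennreal_mult[symmetric] ennreal_plus[symmetric] simp del: ennreal_plus)
    also have "\<dots> = (\<integral>\<^sup>+ X. ennreal (V X) \<partial>?P) + ennreal (1 / \<eta>) * ennreal (\<eta> / n)"
      using V(1) Hm by (simp add: nn_integral_add nn_integral_cmult Hnn)
    also have "\<dots> \<le> ennreal (card A / n) + ennreal (1 / n)"
      using V(3) \<eta> by (intro add_mono) (auto simp: ennreal_mult[symmetric] intro!: ennreal_leI)
    also have "\<dots> = ennreal (card (insert b A) / n)"
      using insert.hyps by (simp add: ennreal_plus[symmetric] add_divide_distrib del: ennreal_plus)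
    finally show ?thesis .
  qed
  have AEH: "AE X in ?P. \<eta> = 0 \<longrightarrow> H X = 0"
  proof (cases "\<eta> = 0")
    case True
    then have "(\<integral>X. H X \<partial>?P) = 0" using Hint by simp
    then have "AE X in ?P. H X = 0"
      using integral_nonneg_eq_0_iff_AE[OF Hint(1)] Hnonneg by simp
    then show ?thesis by auto
  qed auto
  have "AE X in ?P. \<forall>w. ((\<Sum>i<n. \<Sum>a\<in>insert b A. w a * g a (X i)) / n)\<^sup>2
        \<le> W X * (\<integral>x. (\<Sum>a\<in>insert b A. w a * g a x)\<^sup>2 \<partial>M)"
    using V(4) AEH
  proof eventually_elim
    case (elim X)
    show ?case
    proof
      fix w
      define w' where "w' a = w a + w b * p a" for a
      have dec: "(\<Sum>a\<in>insert b A. w a * g a x) = (\<Sum>a\<in>A. w' a * g a x) + w b * h x" for x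
        using insert.hyps by (simp add: w'_def h_def algebra_simps sum.distrib sum_distrib_left)
      have s': "sq_integrable M (\<lambda>x. \<Sum>a\<in>A. w' a * g a x)"
        using insert.prems by (intro sq_integrable_lincomb) auto
      have orth: "(\<integral>x. (\<Sum>a\<in>A. w' a * g a x) * h x \<partial>M) = 0"
      proof -
        have "(\<integral>x. (\<Sum>a\<in>A. w' a * g a x) * h x \<partial>M) = (\<integral>x. (\<Sum>a\<in>A. w' a * (g a x * h x)) \<partial>M)"
          by (simp add: sum_distrib_right mult.assoc)
        also have "\<dots> = (\<Sum>a\<in>A. w' a * (\<integral>x. g a x * h x \<partial>M))"
          using insert.prems h by (subst Bochner_Integration.integral_sum) (auto intro!: sq_integrable_mult)
        also have "\<dots> = 0" using p by (simp add: h_def)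
        finally show ?thesis .
      qed
      have var: "(\<integral>x. (\<Sum>a\<in>insert b A. w a * g a x)\<^sup>2 \<partial>M)
          = (\<integral>x. (\<Sum>a\<in>A. w' a * g a x)\<^sup>2 \<partial>M) + (w b)\<^sup>2 * \<eta>"
      proof -
        have "(\<integral>x. (\<Sum>a\<in>insert b A. w a * g a x)\<^sup>2 \<partial>M)
          = (\<integral>x. (\<Sum>a\<in>A. w' a * g a x)\<^sup>2 + (w b)\<^sup>2 * (h x)\<^sup>2 + 2 * w b * ((\<Sum>a\<in>A. w' a * g a x) * h x) \<partial>M)"
          unfolding dec by (intro Bochner_Integration.integral_cong) (auto simp: power2_eq_square algebra_simps)
        also have "\<dots> = (\<integral>x. (\<Sum>a\<in>A. w' a * g a x)\<^sup>2 \<partial>M) + (w b)\<^sup>2 * \<eta>"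
          using s' h sq_integrable_mult[OF s' h] orth by (simp add: sq_integrable_def \<eta>_def)
        finally show ?thesis .
      qed
      have "((\<Sum>i<n. \<Sum>a\<in>insert b A. w a * g a (X i)) / n)\<^sup>2
        = ((\<Sum>i<n. \<Sum>a\<in>A. w' a * g a (X i)) / n + w b * ((\<Sum>i<n. h (X i)) / n))\<^sup>2"
        unfolding dec by (simp add: sum.distrib sum_distrib_left add_divide_distrib)
      also have "\<dots> \<le> (V X + H X / \<eta>) * ((\<integral>x. (\<Sum>a\<in>A. w' a * g a x)\<^sup>2 \<partial>M) + (w b)\<^sup>2 * \<eta>)"
      proof (rule cauchy_schwarz_two_terms)
        show "(w b * ((\<Sum>i<n. h (X i)) / n))\<^sup>2 \<le> H X / \<eta> * ((w b)\<^sup>2 * \<eta>)"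
        proof (cases "\<eta> = 0")
          case True
          then have "(\<Sum>i<n. h (X i)) / n = 0" using elim by (simp add: H_def)
          then show ?thesis using True by (simp only:) simp
        next
          case False
          then have "H X / \<eta> * ((w b)\<^sup>2 * \<eta>) = H X * (w b)\<^sup>2" by simp
          then show ?thesis by (simp only: H_def power_mult_distrib) (simp add: mult.commute)
        qed
      qed (use elim V(2) \<eta> in \<open>auto simp: H_def\<close>)
      finally show "((\<Sum>i<n. \<Sum>a\<in>insert b A. w a * g a (X i)) / n)\<^sup>2
        \<le> W X * (\<integral>x. (\<Sum>a\<in>insert b A. w a * g a x)\<^sup>2 \<partial>M)"
        unfolding var W_def .
    qed
  qed
  moreover have "W \<in> borel_measurable ?P" unfolding W_def using V(1) Hm by measurable
  ultimately show ?case using Wint Wnn by (intro exI[of _ W]) auto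
qed

section \<open>The misfit of a density with a sample\<close>

definition kl :: "'a measure \<Rightarrow> ('a \<Rightarrow> real) \<Rightarrow> ('a \<Rightarrow> real) \<Rightarrow> real" where
  "kl L f g = (\<integral>x. log_ratio f g x \<partial>density L f)"

definition log_ratio_var :: "'a measure \<Rightarrow> ('a \<Rightarrow> real) \<Rightarrow> ('a \<Rightarrow> real) \<Rightarrow> real" where
  "log_ratio_var L f g = (\<integral>x. (log_ratio f g x - kl L f g)\<^sup>2 \<partial>density L f)"

definition excess :: "'a measure \<Rightarrow> nat \<Rightarrow> (nat \<Rightarrow> 'a) \<Rightarrow> ('a \<Rightarrow> real) \<Rightarrow> ('a \<Rightarrow> real) \<Rightarrow> real" where
  "excess L n X f g = (\<Sum>i<n. log_ratio f g (X i)) / n - kl L f g"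

text \<open>Values in \<^typ>\<open>ennreal\<close> make a nonzero excess over a zero standard deviation count as \<open>\<infinity>\<close>, while \<open>0 / 0 = 0\<close>.\<close>

definition misfit :: "'a measure \<Rightarrow> nat \<Rightarrow> (nat \<Rightarrow> 'a \<Rightarrow> real) \<Rightarrow> (nat \<Rightarrow> 'a) \<Rightarrow> nat \<Rightarrow> ennreal" where
  "misfit L n q X j =
     (SUP i. ennreal \<bar>excess L n X (q j) (q i)\<bar> / ennreal (sqrt (log_ratio_var L (q j) (q i))))"

lemma log_ratio_commute: "log_ratio g f x = - log_ratio f g x"
  by (simp add: log_ratio_def)

lemma jeffreys_kl: "jeffreys L f g = kl L f g + kl L g f"
  unfolding jeffreys_def kl_def log_ratio_commute[of g f] by simp

lemma jeffreys_commute: "jeffreys L f g = jeffreys L g f"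
  by (simp add: jeffreys_kl)

lemma log_ratio_var_nonneg: "log_ratio_var L f g \<ge> 0"
  by (simp add: log_ratio_var_def)

text \<open>The two sample averages are negatives of each other; only the expectations survive.\<close>

lemma excess_sum:
  assumes "n \<ge> 1" shows "excess L n X f g + excess L n X g f = - jeffreys L f g"
  unfolding excess_def jeffreys_kl log_ratio_commute[of g f] by (simp add: sum_negf)

lemma ennreal_divide_le_iff:
  assumes "ennreal x / ennreal y \<le> ennreal a" "x \<ge> 0" "y \<ge> 0" "a \<ge> 0"
  shows "x \<le> a * y"
proof (cases "y = 0")
  case True
  then show ?thesis using assms by (cases "x = 0") (auto simp: ennreal_divide_zero top_unique)
next
  case False
  then show ?thesis using assms by (auto simp: divide_ennreal ennreal_le_iff field_simps)
qed

text \<open>By \<open>excess_sum\<close>, \<open>J \<le> 2 * a * sqrt (K * J * (1 + J))\<close>.  For small \<open>a\<close> this forces \<open>J = O(a\<^sup>2)\<close>;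
  for large \<open>a\<close> the claimed bound exceeds \<open>1\<close>.\<close>

lemma tv_from_excess:
  assumes f: "positive_density L f" and g: "positive_density L g"
    and i: "integrable (density L f) (log_ratio f g)" "integrable (density L g) (log_ratio f g)"
    and n: "n \<ge> 1" and a: "a \<ge> 0" and K: "K > 0"
    and e: "\<bar>excess L n X f g\<bar> \<le> a * sqrt (log_ratio_var L f g)"
       "\<bar>excess L n X g f\<bar> \<le> a * sqrt (log_ratio_var L g f)"
    and v: "log_ratio_var L f g \<le> K * (jeffreys L f g * (1 + jeffreys L f g))"
       "log_ratio_var L g f \<le> K * (jeffreys L g f * (1 + jeffreys L g f))"
  shows "tv_dist L f g \<le> ennreal (3 * sqrt K * a)"
proof -
  let ?J = "jeffreys L f g"
  have J: "?J \<ge> 0" using f g i by (rule jeffreys_nonneg)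
  define B where "B = K * (?J * (1 + ?J))"
  have "?J \<le> \<bar>excess L n X f g\<bar> + \<bar>excess L n X g f\<bar>" using excess_sum[OF n, of L X f g] by linarith
  also have "\<dots> \<le> a * sqrt B + a * sqrt B"
  proof (rule add_mono)
    have "sqrt (log_ratio_var L f g) \<le> sqrt B" using v by (simp add: B_def)
    from order_trans[OF e(1) mult_left_mono[OF this a]] show "\<bar>excess L n X f g\<bar> \<le> a * sqrt B" .
    have "sqrt (log_ratio_var L g f) \<le> sqrt B" using v by (simp add: B_def jeffreys_commute[of L g f])
    from order_trans[OF e(2) mult_left_mono[OF this a]] show "\<bar>excess L n X g f\<bar> \<le> a * sqrt B" .
  qed
  finally have "?J \<le> 2 * a * sqrt B" by simp
  then have "?J\<^sup>2 \<le> (2 * a * sqrt B)\<^sup>2" using J by (intro power_mono) auto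
  also have "\<dots> = 4 * a\<^sup>2 * B" using J K by (simp add: power_mult_distrib B_def)
  finally have J2: "?J\<^sup>2 \<le> 4 * a\<^sup>2 * B" .
  show ?thesis
  proof (cases "4 * a\<^sup>2 * K \<le> 1 / 2")
    case True
    have "?J \<le> 8 * a\<^sup>2 * K"
    proof (cases "?J = 0")
      case False
      then have "?J * ?J \<le> ?J * (4 * a\<^sup>2 * K * (1 + ?J))"
        using J2 by (simp add: B_def power2_eq_square algebra_simps)
      then have "?J \<le> 4 * a\<^sup>2 * K * (1 + ?J)" using J False by simp
      also have "\<dots> = 4 * a\<^sup>2 * K + 4 * a\<^sup>2 * K * ?J" by (simp add: algebra_simps)
      also have "\<dots> \<le> 4 * a\<^sup>2 * K + 1/2 * ?J" using True J by (intro add_left_mono mult_right_mono)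
      finally show ?thesis by simp
    qed (use K in simp)
    then have "sqrt (2 * ?J) / 2 \<le> sqrt ((4 * a)\<^sup>2 * K) / 2" by (simp add: power_mult_distrib mult_ac)
    also have "\<dots> = 2 * sqrt K * a" using a by (simp add: real_sqrt_mult)
    also have "\<dots> \<le> 3 * sqrt K * a" using a K by (intro mult_right_mono) auto
    finally show ?thesis using tv_dist_le_jeffreys[OF f g i] by (meson ennreal_leI order_trans)
  next
    case False
    then have "1 \<le> (3 * sqrt K * a)\<^sup>2" using K by (simp add: power_mult_distrib algebra_simps)
    then have "\<bar>1\<bar> \<le> \<bar>3 * sqrt K * a\<bar>" unfolding abs_le_square_iff by simp
    then have "1 \<le> 3 * sqrt K * a" using a K by simp
    then have "1 \<le> ennreal (3 * sqrt K * a)" by simp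
    then show ?thesis using tv_dist_le_1[OF f g] by (rule order_trans[rotated])
  qed
qed

lemma misfit_bound:
  assumes "misfit L n q X j \<le> ennreal a" "a \<ge> 0"
  shows "\<bar>excess L n X (q j) (q i)\<bar> \<le> a * sqrt (log_ratio_var L (q j) (q i))"
proof (rule ennreal_divide_le_iff)
  have "ennreal \<bar>excess L n X (q j) (q i)\<bar> / ennreal (sqrt (log_ratio_var L (q j) (q i))) \<le> misfit L n q X j"
    unfolding misfit_def by (rule SUP_upper) simp
  also note assms(1)
  finally show "ennreal \<bar>excess L n X (q j) (q i)\<bar> / ennreal (sqrt (log_ratio_var L (q j) (q i))) \<le> ennreal a" .
qed (use assms log_ratio_var_nonneg[of L "q j" "q i"] in auto)

lemma log_ratio_square_integrable:
  assumes f: "positive_density L f"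
    and sq: "\<And>a. a \<in> A \<Longrightarrow> sq_integrable (density L f) (T a)"
    and ef: "\<And>x. ln (f x) = c + (\<Sum>a\<in>A. w a * T a x)"
    and eg: "\<And>x. ln (g x) = c' + (\<Sum>a\<in>A. w' a * T a x)"
  shows "sq_integrable (density L f) (log_ratio f g)"
proof -
  interpret prob_space "density L f" by (rule prob_space_positive_density[OF f])
  have e: "log_ratio f g = (\<lambda>x. (c - c') + (\<Sum>a\<in>A. (w a - w' a) * T a x))"
    by (rule ext) (simp add: log_ratio_def ef eg left_diff_distrib sum_subtractf)
  show ?thesis unfolding e using sq
    by (intro sq_integrable_add sq_integrable_const sq_integrable_lincomb)
qed

text \<open>Every log-likelihood ratio, centred under the truth, is a linear combination of the centred statistics,
  so \<open>uniform_average_bound\<close> applies to all of them simultaneously.\<close>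

lemma misfit_truth_bound:
  fixes q :: "nat \<Rightarrow> 'a \<Rightarrow> real"
  assumes n: "n \<ge> 1" and fin: "finite A"
    and pd: "positive_density L (q j)"
    and ef: "\<And>i. \<exists>c w. \<forall>x. ln (q i x) = c + (\<Sum>a\<in>A. w a * T a x)"
    and sq: "\<And>a. a \<in> A \<Longrightarrow> sq_integrable (density L (q j)) (T a)"
  shows "\<exists>V. V \<in> borel_measurable (Pi\<^sub>M {..<n} (\<lambda>_. L)) \<and> (\<forall>X. V X \<ge> (0::real)) \<and>
     (\<integral>\<^sup>+ X. ennreal (V X) \<partial>iid_samples L n (q j)) \<le> ennreal (card A / n) \<and>
     (AE X in iid_samples L n (q j). misfit L n q X j \<le> ennreal (sqrt (V X)))"
proof -
  let ?D = "density L (\<lambda>x. ennreal (q j x))"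
  interpret prob_space ?D by (rule prob_space_positive_density[OF pd])
  have p1: "measure ?D (space L) = 1" using prob_space by simp
  define g where "g a x = T a x - (\<integral>x. T a x \<partial>?D)" for a x
  have sg: "sq_integrable ?D (g a)" if "a \<in> A" for a
    unfolding g_def using sq[OF that] by (intro sq_integrable_diff sq_integrable_const)
  have Ti: "integrable ?D (T a)" if "a \<in> A" for a using sq[OF that] by (rule sq_integrable_integrable)
  have g0: "(\<integral>x. g a x \<partial>?D) = 0" if "a \<in> A" for a
    using Ti[OF that] p1 by (simp add: g_def)
  obtain V where V: "V \<in> borel_measurable (Pi\<^sub>M {..<n} (\<lambda>_. ?D))" "\<And>X. V X \<ge> 0"
     "(\<integral>\<^sup>+ X. ennreal (V X) \<partial>Pi\<^sub>M {..<n} (\<lambda>_. ?D)) \<le> ennreal (card A / n)"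
     "AE X in Pi\<^sub>M {..<n} (\<lambda>_. ?D). \<forall>w. ((\<Sum>i<n. \<Sum>a\<in>A. w a * g a (X i)) / n)\<^sup>2
        \<le> V X * (\<integral>x. (\<Sum>a\<in>A. w a * g a x)\<^sup>2 \<partial>?D)"
    using uniform_average_bound[of n A g] n fin sg g0 by blast
  have Vm: "V \<in> borel_measurable (Pi\<^sub>M {..<n} (\<lambda>_. L))"
    using V(1) by (simp cong: measurable_cong_sets sets_PiM_cong)
  have lin: "\<exists>w. \<forall>x. log_ratio (q j) (q i) x - kl L (q j) (q i) = (\<Sum>a\<in>A. w a * g a x)" for i
  proof -
    obtain c w where cw: "\<And>x. ln (q j x) = c + (\<Sum>a\<in>A. w a * T a x)" using ef[of j] by auto
    obtain c' w' where cw': "\<And>x. ln (q i x) = c' + (\<Sum>a\<in>A. w' a * T a x)" using ef[of i] by auto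
    define v where "v a = w a - w' a" for a
    have e: "log_ratio (q j) (q i) x = (c - c') + (\<Sum>a\<in>A. v a * T a x)" for x
      by (simp add: log_ratio_def cw cw' v_def left_diff_distrib sum_subtractf)
    have "kl L (q j) (q i) = (\<integral>x. (c - c') + (\<Sum>a\<in>A. v a * T a x) \<partial>?D)"
      unfolding kl_def e ..
    also have "\<dots> = (c - c') + (\<Sum>a\<in>A. v a * (\<integral>x. T a x \<partial>?D))"
      using Ti by (simp add: Bochner_Integration.integral_sum p1)
    finally have "log_ratio (q j) (q i) x - kl L (q j) (q i) = (\<Sum>a\<in>A. v a * g a x)" for x
      unfolding e by (simp add: g_def right_diff_distrib sum_subtractf)
    then show ?thesis by auto
  qed
  have "AE X in Pi\<^sub>M {..<n} (\<lambda>_. ?D). misfit L n q X j \<le> ennreal (sqrt (V X))"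
    using V(4)
  proof eventually_elim
    case (elim X)
    show ?case unfolding misfit_def
    proof (rule SUP_least)
      fix i
      obtain w where w: "\<And>x. log_ratio (q j) (q i) x - kl L (q j) (q i) = (\<Sum>a\<in>A. w a * g a x)"
        using lin[of i] by auto
      have "excess L n X (q j) (q i) = (\<Sum>k<n. log_ratio (q j) (q i) (X k) - kl L (q j) (q i)) / n"
        using n by (simp add: excess_def sum_subtractf diff_divide_distrib)
      then have "(excess L n X (q j) (q i))\<^sup>2 \<le> V X * log_ratio_var L (q j) (q i)"
        using elim by (simp add: w log_ratio_var_def)
      then have "\<bar>excess L n X (q j) (q i)\<bar> \<le> sqrt (V X) * sqrt (log_ratio_var L (q j) (q i))"
        by (simp add: real_sqrt_mult[symmetric] real_le_rsqrt)
      then show "ennreal \<bar>excess L n X (q j) (q i)\<bar> / ennreal (sqrt (log_ratio_var L (q j) (q i)))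
          \<le> ennreal (sqrt (V X))"
        using V(2)[of X] log_ratio_var_nonneg[of L "q j" "q i"]
        by (cases "log_ratio_var L (q j) (q i) = 0") (auto simp: divide_ennreal field_simps intro!: ennreal_leI)
    qed
  qed
  then show ?thesis using V Vm unfolding iid_samples_def by (intro exI[of _ V]) auto
qed

lemma excess_measurable:
  assumes [measurable]: "f \<in> borel_measurable L" "g \<in> borel_measurable L"
  shows "(\<lambda>X. excess L n X f g) \<in> borel_measurable (Pi\<^sub>M {..<n} (\<lambda>_. L))"
  unfolding excess_def by measurable

lemma misfit_measurable:
  assumes "\<And>i. q i \<in> borel_measurable L"
  shows "(\<lambda>X. misfit L n q X j) \<in> borel_measurable (Pi\<^sub>M {..<n} (\<lambda>_. L))"
proof -
  note [measurable] = excess_measurable[OF assms assms]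
  show ?thesis unfolding misfit_def by measurable
qed

text \<open>The infimum of the misfits need not be attained; the slack \<open>s > 0\<close> guarantees that some index qualifies,
  and taking the least one keeps the choice measurable.\<close>

definition select :: "'a measure \<Rightarrow> nat \<Rightarrow> real \<Rightarrow> (nat \<Rightarrow> 'a \<Rightarrow> real) \<Rightarrow> (nat \<Rightarrow> 'a) \<Rightarrow> nat" where
  "select L n s q X = (LEAST j. misfit L n q X j \<le> ennreal s + (INF i. misfit L n q X i))"

lemma select_le:
  assumes "s > 0"
  shows "misfit L n q X (select L n s q X) \<le> ennreal s + misfit L n q X j"
proof -
  let ?I = "INF i. misfit L n q X i"
  have "\<exists>j. misfit L n q X j \<le> ennreal s + ?I"
  proof (cases "?I = \<top>")
    case False
    then have "?I < ennreal s + ?I" using assms by (simp add: ennreal_add_less_top less_top[symmetric])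
    then show ?thesis by (auto simp: INF_less_iff intro: less_imp_le)
  qed simp
  then have "misfit L n q X (select L n s q X) \<le> ennreal s + ?I"
    unfolding select_def by (rule LeastI_ex)
  also have "\<dots> \<le> ennreal s + misfit L n q X j" by (intro add_left_mono INF_lower) simp
  finally show ?thesis .
qed

lemma select_measurable:
  assumes "\<And>i. q i \<in> borel_measurable L"
  shows "select L n s q \<in> Pi\<^sub>M {..<n} (\<lambda>_. L) \<rightarrow>\<^sub>M count_space UNIV"
proof -
  note [measurable] = misfit_measurable[OF assms]
  have le: "Measurable.pred (Pi\<^sub>M {..<n} (\<lambda>_. L)) (\<lambda>X. u X \<le> ennreal s + v X)"
    if uv: "u \<in> borel_measurable (Pi\<^sub>M {..<n} (\<lambda>_. L))"
      "v \<in> borel_measurable (Pi\<^sub>M {..<n} (\<lambda>_. L))" for u v :: "(nat \<Rightarrow> 'a) \<Rightarrow> ennreal"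
  proof -
    note [measurable] = uv
    show ?thesis unfolding not_less[symmetric] by measurable
  qed
  have "(\<lambda>X. INF i. misfit L n q X i) \<in> borel_measurable (Pi\<^sub>M {..<n} (\<lambda>_. L))"
    by (intro borel_measurable_INF misfit_measurable assms) auto
  then show ?thesis unfolding select_def[abs_def]
    by (intro measurable_Least le misfit_measurable assms)
qed

section \<open>Minimax upper bound for exponential families\<close>

text \<open>The parameters \<open>(c, w)\<close> of the family form a subset of the second countable metric space \<open>real \<times> ('i \<Rightarrow> real)\<close>,
  and every subset of such a space is separable.  Pointwise convergence is all that Fatou's lemma asks for.\<close>

lemma countable_pointwise_dense:
  fixes T :: "'i::countable \<Rightarrow> 'a \<Rightarrow> real" and F :: "('a \<Rightarrow> real) set"
  assumes F: "F \<noteq> {}" and pos: "\<And>f x. f \<in> F \<Longrightarrow> f x > 0"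
    and ef: "\<And>f. f \<in> F \<Longrightarrow> \<exists>c w. \<forall>x. ln (f x) = c + (\<Sum>a\<in>A. w a * T a x)"
  obtains q :: "nat \<Rightarrow> 'a \<Rightarrow> real" where "range q \<subseteq> F"
    "\<And>f. f \<in> F \<Longrightarrow> \<exists>r. \<forall>x. (\<lambda>m. q (r m) x) \<longlonglongrightarrow> f x"
proof -
  define \<phi> where "\<phi> p x = exp (fst p + (\<Sum>a\<in>A. snd p a * T a x))" for p :: "real \<times> ('i \<Rightarrow> real)" and x
  define S where "S = {p. \<phi> p \<in> F}"
  have FS: "\<exists>p\<in>S. f = \<phi> p" if f: "f \<in> F" for f
  proof -
    obtain c w where cw: "\<And>x. ln (f x) = c + (\<Sum>a\<in>A. w a * T a x)" using ef[OF f] by auto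
    have "f = \<phi> (c, w)"
    proof
      fix x show "f x = \<phi> (c, w) x"
        using pos[OF f, of x] by (simp add: \<phi>_def flip: cw)
    qed
    then show ?thesis using f by (auto simp: S_def)
  qed
  obtain D :: "(real \<times> ('i \<Rightarrow> real)) set" where D: "countable D" "D \<subseteq> S" "S \<subseteq> closure D"
    by (rule separable)
  have "S \<noteq> {}" using F FS by auto
  then have Dne: "D \<noteq> {}" using D by auto
  define q where "q j = \<phi> (from_nat_into D j)" for j
  show ?thesis
  proof
    show "range q \<subseteq> F" using from_nat_into[OF Dne] D(2) by (auto simp: q_def S_def)
  next
    fix f assume "f \<in> F"
    then obtain p where p: "p \<in> S" "f = \<phi> p" using FS by blast
    then have "p \<in> closure D" using D by auto
    then obtain u where u: "\<And>m. u m \<in> D" "u \<longlonglongrightarrow> p" by (auto simp: closure_sequential)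
    have "\<exists>j. u m = from_nat_into D j" for m
      using from_nat_into_surj[OF D(1) u(1)] by metis
    then obtain r where r: "\<And>m. u m = from_nat_into D (r m)" by metis
    have "(\<lambda>m. q (r m) x) \<longlonglongrightarrow> f x" for x
    proof -
      have 1: "(\<lambda>m. fst (u m)) \<longlonglongrightarrow> fst p" using u(2) by (rule tendsto_fst)
      have 2: "(\<lambda>m. snd (u m) a) \<longlonglongrightarrow> snd p a" for a
      proof -
        have "continuous_on UNIV (\<lambda>w::'i \<Rightarrow> real. w a)" by (rule continuous_on_product_coordinates)
        from continuous_on_tendsto_compose[OF this tendsto_snd[OF u(2)]] show ?thesis by simp
      qed
      show ?thesis unfolding q_def r[symmetric] p(2) \<phi>_def
        by (intro tendsto_intros 1 2)
    qed
    then show "\<exists>r. \<forall>x. (\<lambda>m. q (r m) x) \<longlonglongrightarrow> f x" by auto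
  qed
qed

lemma nn_integral_pair_fst:
  assumes W: "prob_space W" and g: "g \<in> borel_measurable M"
  shows "(\<integral>\<^sup>+ (X, w). g X \<partial>(M \<Otimes>\<^sub>M W)) = (\<integral>\<^sup>+ X. g X \<partial>M)"
proof -
  interpret W: prob_space W by (rule W)
  have m: "(\<lambda>(X, w). g X) \<in> borel_measurable (M \<Otimes>\<^sub>M W)"
    using g by (simp add: case_prod_unfold)
  have "(\<integral>\<^sup>+ (X, w). g X \<partial>(M \<Otimes>\<^sub>M W)) = (\<integral>\<^sup>+ X. \<integral>\<^sup>+ w. g X \<partial>W \<partial>M)"
    using W.nn_integral_fst[OF m] by simp
  then show ?thesis by (simp add: W.emeasure_space_1)
qed

lemma tv_dist_measurable:
  assumes L: "sigma_finite_measure L" and f: "f \<in> borel_measurable L"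
    and h: "(\<lambda>(X, x). h X x) \<in> borel_measurable (M \<Otimes>\<^sub>M L)"
  shows "(\<lambda>X. tv_dist L (h X) f) \<in> borel_measurable M"
proof -
  interpret sigma_finite_measure L by (rule L)
  have [measurable]: "(\<lambda>z. h (fst z) (snd z)) \<in> borel_measurable (M \<Otimes>\<^sub>M L)"
    using h by (simp add: case_prod_unfold)
  note [measurable] = f
  show ?thesis unfolding tv_dist_def by measurable
qed

lemma estimator_risk_deterministic:
  assumes L: "sigma_finite_measure L" and f: "positive_density L f" and W: "prob_space W"
    and h: "(\<lambda>(X, x). h X x) \<in> borel_measurable (Pi\<^sub>M {..<n} (\<lambda>_. L) \<Otimes>\<^sub>M L)"
  shows "(\<integral>\<^sup>+ (X, w). tv_dist L (h X) f \<partial>(iid_samples L n f \<Otimes>\<^sub>M W))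
    = (\<integral>\<^sup>+ X. tv_dist L (h X) f \<partial>iid_samples L n f)"
proof -
  have "(\<lambda>X. tv_dist L (h X) f) \<in> borel_measurable (Pi\<^sub>M {..<n} (\<lambda>_. L))"
    by (rule tv_dist_measurable[OF L positive_densityD(1)[OF f] h])
  then show ?thesis
    by (intro nn_integral_pair_fst W) (simp cong: measurable_cong_sets add: sets_iid measurable_cong_sets[OF sets_iid refl])
qed

lemma minimax_risk_le_1:
  assumes L: "sigma_finite_measure L" and pd: "\<And>f. f \<in> F \<Longrightarrow> positive_density L f" and F: "F \<noteq> {}"
  shows "minimax_risk L n F \<le> 1"
proof -
  obtain g where g: "g \<in> F" using F by auto
  let ?W = "return borel (0::real)"
  have W: "prob_space ?W" by (rule prob_space_return) simp
  note [measurable] = positive_densityD(1)[OF pd[OF g]]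
  have "(?W, \<lambda>X w. g) \<in> estimators L n"
    unfolding estimators_def using W by (auto simp: case_prod_unfold)
  then have "minimax_risk L n F \<le> estimator_risk L n F (?W, \<lambda>X w. g)"
    unfolding minimax_risk_def by (rule INF_lower)
  also have "\<dots> \<le> 1" unfolding estimator_risk_def
  proof (simp, intro SUP_least)
    fix f assume f: "f \<in> F"
    interpret pair_prob_space "iid_samples L n f" ?W
      using prob_space_iid[OF pd[OF f]] W by (simp add: pair_prob_space_def pair_sigma_finite_def prob_space_imp_sigma_finite)
    have "(\<integral>\<^sup>+ (X, w). tv_dist L g f \<partial>(iid_samples L n f \<Otimes>\<^sub>M ?W))
      = tv_dist L g f" using emeasure_space_1 by (simp add: case_prod_unfold)
    also have "\<dots> \<le> 1" using tv_dist_le_1 pd f g by auto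
    finally show "(\<integral>\<^sup>+ (X, w). tv_dist L g f \<partial>(iid_samples L n f \<Otimes>\<^sub>M ?W)) \<le> 1" .
  qed
  finally show ?thesis .
qed

text \<open>If the variance of log-likelihood ratios is controlled by the divergence, an exponential family with \<open>card A\<close>
  statistics is learned at the parametric rate.  The truth may lie outside the countable subfamily \<open>q\<close>; its risk is then
  at most the lower limit of the risks along a sequence of members of \<open>q\<close> converging to it, by Fatou's lemma over
  both the sample and the point of evaluation.\<close>

theorem exponential_family_minimax_le:
  fixes T :: "'i::countable \<Rightarrow> 'a \<Rightarrow> real" and F :: "('a \<Rightarrow> real) set"
  assumes L: "sigma_finite_measure L" and pd: "\<And>f. f \<in> F \<Longrightarrow> positive_density L f" and F: "F \<noteq> {}"
    and A: "finite A" "A \<noteq> {}" and n: "n \<ge> 1" and K: "K > 0"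
    and ef: "\<And>f. f \<in> F \<Longrightarrow> \<exists>c w. \<forall>x. ln (f x) = c + (\<Sum>a\<in>A. w a * T a x)"
    and sq: "\<And>f a. f \<in> F \<Longrightarrow> a \<in> A \<Longrightarrow> sq_integrable (density L f) (T a)"
    and var: "\<And>f g. f \<in> F \<Longrightarrow> g \<in> F \<Longrightarrow>
       log_ratio_var L f g \<le> K * (jeffreys L f g * (1 + jeffreys L f g))"
  shows "minimax_risk L n F \<le> ennreal (6 * sqrt K * sqrt (card A / n))"
proof -
  obtain q :: "nat \<Rightarrow> 'a \<Rightarrow> real" where qF: "range q \<subseteq> F"
    and dense: "\<And>f. f \<in> F \<Longrightarrow> \<exists>r. \<forall>x. (\<lambda>m. q (r m) x) \<longlonglongrightarrow> f x"
    by (rule countable_pointwise_dense[where F = F and A = A and T = T, OF F _ ef])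
      (use positive_densityD(2)[OF pd] in auto)
  have q: "q i \<in> F" for i using qF by auto
  let ?P = "Pi\<^sub>M {..<n} (\<lambda>_. L)"
  define s where "s = sqrt (card A / n)"
  have s: "s > 0" using A n by (simp add: s_def card_gt_0_iff)
  define \<sigma> where "\<sigma> = select L n s q"
  note qm = positive_densityD(1)[OF pd[OF q]]
  have \<sigma>m: "\<sigma> \<in> ?P \<rightarrow>\<^sub>M count_space UNIV" unfolding \<sigma>_def by (rule select_measurable[OF qm])
  define h where "h X = q (\<sigma> X)" for X
  have hm: "(\<lambda>(X, x). h X x) \<in> borel_measurable (?P \<Otimes>\<^sub>M L)"
  proof -
    have "(\<lambda>z. q (\<sigma> (fst z)) (snd z)) \<in> borel_measurable (?P \<Otimes>\<^sub>M L)"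
      by (rule measurable_compose_countable[where f = "\<lambda>i z. q i (snd z)"])
        (use \<sigma>m qm in measurable)
    then show ?thesis by (simp add: h_def case_prod_unfold)
  qed
  let ?W = "return borel (0::real)"
  have W: "prob_space ?W" by (rule prob_space_return) simp
  have est: "(?W, \<lambda>X w. h X) \<in> estimators L n"
  proof -
    have "(\<lambda>z. case (fst (fst z), snd z) of (X, x) \<Rightarrow> h X x) \<in> borel_measurable ((?P \<Otimes>\<^sub>M ?W) \<Otimes>\<^sub>M L)"
      by (rule measurable_compose[OF _ hm]) measurable
    then show ?thesis using W by (simp add: estimators_def case_prod_unfold)
  qed
  define R where "R f = (\<integral>\<^sup>+ X. tv_dist L (h X) f \<partial>iid_samples L n f)" for f
  define B where "B = ennreal (6 * sqrt K * s)"
  have Rq: "R (q j) \<le> B" for j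
  proof -
    obtain V where V: "V \<in> borel_measurable ?P" "\<And>X. V X \<ge> 0"
     "(\<integral>\<^sup>+ X. ennreal (V X) \<partial>iid_samples L n (q j)) \<le> ennreal (card A / n)"
     "AE X in iid_samples L n (q j). misfit L n q X j \<le> ennreal (sqrt (V X))"
      using misfit_truth_bound[where q = q and j = j and T = T and L = L, OF n A(1) pd[OF q] ef[OF q] sq[OF q]]
      by blast
    have Vm: "V \<in> borel_measurable (iid_samples L n (q j))"
      using V(1) by (simp add: measurable_cong_sets[OF sets_iid refl])
    interpret I: prob_space "iid_samples L n (q j)" by (rule prob_space_iid[OF pd[OF q]])
    have int: "integrable (density L (q i)) (log_ratio (q i) (q k))" for i k
    proof -
      interpret prob_space "density L (q i)" by (rule prob_space_positive_density[OF pd[OF q]])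
      obtain c w where 1: "\<And>x. ln (q i x) = c + (\<Sum>a\<in>A. w a * T a x)" using ef[OF q] by blast
      obtain c' w' where 2: "\<And>x. ln (q k x) = c' + (\<Sum>a\<in>A. w' a * T a x)" using ef[OF q] by blast
      show ?thesis
        by (rule sq_integrable_integrable[OF log_ratio_square_integrable[OF pd[OF q] sq[OF q] 1 2]])
    qed
    have int': "integrable (density L (q k)) (log_ratio (q i) (q k))" for i k
    proof -
      have "log_ratio (q i) (q k) = (\<lambda>x. - log_ratio (q k) (q i) x)" by (rule ext) (rule log_ratio_commute)
      then show ?thesis using int[of k i] by simp
    qed
    have "AE X in iid_samples L n (q j). tv_dist L (h X) (q j) \<le> ennreal (3 * sqrt K * (s + sqrt (V X)))"
      using V(4)
    proof eventually_elim
      case (elim X)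
      let ?a = "s + sqrt (V X)"
      have a0: "?a \<ge> 0" using s V(2) by (simp add: add_nonneg_nonneg less_imp_le)
      have m1: "misfit L n q X j \<le> ennreal ?a"
        using elim s by (rule_tac order_trans[OF elim]) (auto intro!: ennreal_leI)
      have "misfit L n q X (\<sigma> X) \<le> ennreal s + misfit L n q X j"
        unfolding \<sigma>_def by (rule select_le[OF s])
      also have "\<dots> \<le> ennreal s + ennreal (sqrt (V X))" by (intro add_left_mono elim)
      also have "\<dots> = ennreal ?a" using s V(2) by simp
      finally have m2: "misfit L n q X (\<sigma> X) \<le> ennreal ?a" .
      show ?case unfolding h_def
        by (rule tv_from_excess[OF pd[OF q] pd[OF q] int int' n a0 K misfit_bound[OF m2 a0] misfit_bound[OF m1 a0]
             var[OF q q] var[OF q q]])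
    qed
    then have "R (q j) \<le> (\<integral>\<^sup>+ X. ennreal (3 * sqrt K * (s + sqrt (V X))) \<partial>iid_samples L n (q j))"
      unfolding R_def by (rule nn_integral_mono_AE)
    \<comment> \<open>Bound \<open>sqrt V\<close> by \<open>s / 2 + V / (2 * s)\<close>, as only the expectation of \<open>V\<close> is known.\<close>
    also have "\<dots> \<le> (\<integral>\<^sup>+ X. ennreal (9 / 2 * sqrt K * s) + ennreal (3 / 2 * sqrt K / s) * ennreal (V X) \<partial>iid_samples L n (q j))"
    proof (intro nn_integral_mono)
      fix X
      have "0 \<le> (s - sqrt (V X))\<^sup>2" by simp
      then have "2 * s * sqrt (V X) \<le> s * s + V X"
        using V(2)[of X] unfolding power2_diff by (simp add: power2_eq_square)
      then have "sqrt (V X) \<le> s / 2 + V X / (2 * s)" using s by (simp add: field_simps)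
      then have "3 * sqrt K * (s + sqrt (V X)) \<le> 3 * sqrt K * (s + (s / 2 + V X / (2 * s)))"
        using K by (intro mult_left_mono add_left_mono) auto
      also have "\<dots> = 9 / 2 * sqrt K * s + 3 / 2 * sqrt K / s * V X" using s by (simp add: field_simps)
      finally show "ennreal (3 * sqrt K * (s + sqrt (V X)))
        \<le> ennreal (9 / 2 * sqrt K * s) + ennreal (3 / 2 * sqrt K / s) * ennreal (V X)"
        using s K V(2)[of X] by (simp add: ennreal_mult[symmetric] ennreal_plus[symmetric] ennreal_leI del: ennreal_plus)
    qed
    also have "\<dots> = ennreal (9 / 2 * sqrt K * s) + ennreal (3 / 2 * sqrt K / s) * (\<integral>\<^sup>+ X. ennreal (V X) \<partial>iid_samples L n (q j))"
      using Vm by (simp add: nn_integral_add nn_integral_cmult I.emeasure_space_1)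
    also have "\<dots> \<le> ennreal (9 / 2 * sqrt K * s) + ennreal (3 / 2 * sqrt K / s) * ennreal (s\<^sup>2)"
      using V(3) by (intro add_left_mono mult_left_mono) (auto simp: s_def)
    also have "\<dots> = B" using s K
      by (simp add: ennreal_mult[symmetric] ennreal_plus[symmetric] B_def power2_eq_square del: ennreal_plus)
    finally show ?thesis .
  qed
  \<comment> \<open>The risk as one integral of a function that depends continuously on the values of \<open>f\<close>.\<close>
  define \<Phi> where "\<Phi> f = (\<integral>\<^sup>+ X. \<integral>\<^sup>+ x. ennreal (sample_density n f X * \<bar>h X x - f x\<bar> / 2) \<partial>L \<partial>?P)" for f
  have hX: "h X \<in> borel_measurable L" for X using qm by (simp add: h_def)
  have R\<Phi>: "R f = \<Phi> f" if f: "positive_density L f" for f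
  proof -
    note fm = positive_densityD(1)[OF f]
    have sp: "sample_density n f X \<ge> 0" for X
      using positive_densityD(2)[OF f] unfolding sample_density_def
      by (intro prod_nonneg) (auto intro: less_imp_le)
    have "R f = (\<integral>\<^sup>+ X. ennreal (sample_density n f X) * tv_dist L (h X) f \<partial>?P)"
      unfolding R_def iid_samples_eq_density[OF L f]
      using sample_density_measurable[OF fm, of n] tv_dist_measurable[OF L fm hm]
      by (intro nn_integral_density) auto
    also have "\<dots> = \<Phi> f" unfolding \<Phi>_def
    proof (intro nn_integral_cong)
      fix X
      have "(\<integral>\<^sup>+ x. ennreal (sample_density n f X * \<bar>h X x - f x\<bar> / 2) \<partial>L)
        = (\<integral>\<^sup>+ x. (ennreal (sample_density n f X) * (1 / 2)) * ennreal \<bar>h X x - f x\<bar> \<partial>L)"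
      proof (intro nn_integral_cong)
        fix x
        have "(1/2 :: ennreal) = ennreal (1/2)" by (simp add: divide_ennreal_def)
        then show "ennreal (sample_density n f X * \<bar>h X x - f x\<bar> / 2)
          = ennreal (sample_density n f X) * (1 / 2) * ennreal \<bar>h X x - f x\<bar>"
          using sp[of X] by (simp add: ennreal_mult[symmetric] mult_ac del: ennreal_half)
      qed
      also have "\<dots> = ennreal (sample_density n f X) * tv_dist L (h X) f"
        unfolding tv_dist_def using hX fm by (subst nn_integral_cmult) (auto simp: mult.assoc)
      finally show "ennreal (sample_density n f X) * tv_dist L (h X) f
        = (\<integral>\<^sup>+ x. ennreal (sample_density n f X * \<bar>h X x - f x\<bar> / 2) \<partial>L)" ..
    qed
    finally show ?thesis .
  qed
  have RF: "R f \<le> B" if f: "f \<in> F" for f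
  proof -
    obtain r where r: "\<And>x. (\<lambda>m. q (r m) x) \<longlonglongrightarrow> f x" using dense[OF f] by blast
    let ?u = "\<lambda>m X x. ennreal (sample_density n (q (r m)) X * \<bar>h X x - q (r m) x\<bar> / 2)"
    have um: "(\<lambda>z. ?u m (fst z) (snd z)) \<in> borel_measurable (?P \<Otimes>\<^sub>M L)" for m
    proof -
      have [measurable]: "(\<lambda>z. h (fst z) (snd z)) \<in> borel_measurable (?P \<Otimes>\<^sub>M L)"
        using hm by (simp add: case_prod_unfold)
      note [measurable] = sample_density_measurable[OF qm[of "r m"], of n] qm
      show ?thesis by measurable
    qed
    have um2: "(\<lambda>X. \<integral>\<^sup>+ x. ?u m X x \<partial>L) \<in> borel_measurable ?P" for m
    proof -
      interpret sigma_finite_measure L by (rule L)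
      show ?thesis using um[of m] by (intro borel_measurable_nn_integral) (simp add: case_prod_unfold)
    qed
    have lim: "(\<lambda>m. ?u m X x) \<longlonglongrightarrow> ennreal (sample_density n f X * \<bar>h X x - f x\<bar> / 2)" for X x
      unfolding sample_density_def by (intro tendsto_intros tendsto_ennrealI r) auto
    have "\<Phi> f = (\<integral>\<^sup>+ X. \<integral>\<^sup>+ x. liminf (\<lambda>m. ?u m X x) \<partial>L \<partial>?P)"
      unfolding \<Phi>_def using lim_imp_Liminf[OF trivial_limit_sequentially lim] by simp
    also have "\<dots> \<le> (\<integral>\<^sup>+ X. liminf (\<lambda>m. \<integral>\<^sup>+ x. ?u m X x \<partial>L) \<partial>?P)"
      using hX qm by (intro nn_integral_mono nn_integral_liminf) auto
    also have "\<dots> \<le> liminf (\<lambda>m. \<integral>\<^sup>+ X. \<integral>\<^sup>+ x. ?u m X x \<partial>L \<partial>?P)"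
      by (intro nn_integral_liminf um2)
    also have "\<dots> = liminf (\<lambda>m. R (q (r m)))"
      using R\<Phi>[OF pd[OF q]] by (simp add: \<Phi>_def)
    also have "\<dots> \<le> B"
      using Rq by (intro Liminf_le) auto
    finally show ?thesis using R\<Phi>[OF pd[OF f]] by simp
  qed
  have "minimax_risk L n F \<le> estimator_risk L n F (?W, \<lambda>X w. h X)"
    unfolding minimax_risk_def by (rule INF_lower[OF est])
  also have "\<dots> = (SUP f\<in>F. R f)"
    unfolding estimator_risk_def R_def using estimator_risk_deterministic[OF L pd W hm] by simp
  also have "\<dots> \<le> B" using RF by (rule SUP_least)
  finally show ?thesis by (simp add: B_def s_def)
qed

section \<open>Minimax lower bound from a hypercube of densities\<close>

lemma sum_Pow_split:
  assumes "e \<in> I" "finite I"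
  shows "(\<Sum>\<sigma>\<in>Pow I. g \<sigma>) = (\<Sum>\<sigma>\<in>Pow (I - {e}). g \<sigma> + g (insert e \<sigma>))"
proof -
  let ?J = "I - {e}"
  have "Pow I = Pow ?J \<union> insert e ` Pow ?J" using assms Pow_insert[of e ?J] by (simp add: insert_absorb)
  moreover have "Pow ?J \<inter> insert e ` Pow ?J = {}" by auto
  moreover have "inj_on (insert e) (Pow ?J)" by (auto simp: inj_on_def)
  ultimately show ?thesis using assms
    by (simp add: sum.union_disjoint sum.reindex sum.distrib)
qed

text \<open>Each coordinate \<open>e\<close> is paired off separately: whichever value \<open>\<tau>\<close> assigns to \<open>e\<close>, one vertex of each edge
  \<open>(\<sigma>, insert e \<sigma>)\<close> of the cube disagrees with it.\<close>

lemma hamming_vote: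
  fixes p :: "'e set \<Rightarrow> ennreal"
  assumes I: "finite I" and \<tau>: "\<tau> \<subseteq> I"
  shows "(\<Sum>e\<in>I. \<Sum>\<sigma>\<in>Pow (I - {e}). min (p \<sigma>) (p (insert e \<sigma>)))
      \<le> (\<Sum>\<sigma>\<in>Pow I. p \<sigma> * of_nat (card (sym_diff \<sigma> \<tau>)))"
proof -
  define d where "d \<sigma> e = (of_bool (e \<in> sym_diff \<sigma> \<tau>) :: ennreal)" for \<sigma> e
  have c: "of_nat (card (sym_diff \<sigma> \<tau>)) = (\<Sum>e\<in>I. d \<sigma> e)" if "\<sigma> \<subseteq> I" for \<sigma>
  proof -
    have "sym_diff \<sigma> \<tau> = {e\<in>I. e \<in> sym_diff \<sigma> \<tau>}" using that \<tau> by auto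
    then show ?thesis using I by (simp add: d_def sum.If_cases of_bool_def Int_def conj_commute)
  qed
  have "(\<Sum>\<sigma>\<in>Pow I. p \<sigma> * of_nat (card (sym_diff \<sigma> \<tau>))) = (\<Sum>\<sigma>\<in>Pow I. \<Sum>e\<in>I. p \<sigma> * d \<sigma> e)"
    using c by (intro sum.cong) (auto simp: sum_distrib_left)
  also have "\<dots> = (\<Sum>e\<in>I. \<Sum>\<sigma>\<in>Pow I. p \<sigma> * d \<sigma> e)" by (rule sum.swap)
  also have "\<dots> = (\<Sum>e\<in>I. \<Sum>\<sigma>\<in>Pow (I - {e}). p \<sigma> * d \<sigma> e + p (insert e \<sigma>) * d (insert e \<sigma>) e)"
    using I by (intro sum.cong sum_Pow_split) auto
  also have "\<dots> \<ge> (\<Sum>e\<in>I. \<Sum>\<sigma>\<in>Pow (I - {e}). min (p \<sigma>) (p (insert e \<sigma>)))"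
  proof (intro sum_mono)
    fix e \<sigma> assume "e \<in> I" "\<sigma> \<in> Pow (I - {e})"
    then show "min (p \<sigma>) (p (insert e \<sigma>)) \<le> p \<sigma> * d \<sigma> e + p (insert e \<sigma>) * d (insert e \<sigma>) e"
      by (cases "e \<in> \<tau>") (auto simp: d_def min_def)
  qed
  finally show ?thesis .
qed

lemma tv_dist_triangle:
  assumes [measurable]: "h \<in> borel_measurable L" "f \<in> borel_measurable L" "g \<in> borel_measurable L"
  shows "tv_dist L f g \<le> tv_dist L h f + tv_dist L h g"
proof -
  have "(\<integral>\<^sup>+ x. ennreal \<bar>f x - g x\<bar> \<partial>L) \<le> (\<integral>\<^sup>+ x. ennreal \<bar>h x - f x\<bar> + ennreal \<bar>h x - g x\<bar> \<partial>L)"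
    by (intro nn_integral_mono) (auto simp: ennreal_plus[symmetric] intro!: ennreal_leI simp del: ennreal_plus)
  also have "\<dots> = (\<integral>\<^sup>+ x. ennreal \<bar>h x - f x\<bar> \<partial>L) + (\<integral>\<^sup>+ x. ennreal \<bar>h x - g x\<bar> \<partial>L)"
    by (intro nn_integral_add) auto
  finally have "(1/2) * (\<integral>\<^sup>+ x. ennreal \<bar>f x - g x\<bar> \<partial>L)
      \<le> (1/2) * ((\<integral>\<^sup>+ x. ennreal \<bar>h x - f x\<bar> \<partial>L) + (\<integral>\<^sup>+ x. ennreal \<bar>h x - g x\<bar> \<partial>L))"
    by (intro mult_left_mono) auto
  then show ?thesis unfolding tv_dist_def by (simp only: distrib_left)
qed

lemma iid_pair_density:
  assumes L: "sigma_finite_measure L" and f: "positive_density L f" and W: "prob_space W"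
  shows "iid_samples L n f \<Otimes>\<^sub>M W
    = density (Pi\<^sub>M {..<n} (\<lambda>_. L) \<Otimes>\<^sub>M W) (\<lambda>z. ennreal (sample_density n f (fst z)))"
proof -
  interpret W: prob_space W by (rule W)
  interpret P: product_sigma_finite "\<lambda>_::nat. L" using L by (simp add: product_sigma_finite_def)
  have Wd: "density W (\<lambda>_. 1) = W" by (rule density_1)
  have sfP: "sigma_finite_measure (Pi\<^sub>M {..<n} (\<lambda>_. L))" by (rule P.sigma_finite) simp
  have "density (Pi\<^sub>M {..<n} (\<lambda>_. L)) (\<lambda>X. ennreal (sample_density n f X)) \<Otimes>\<^sub>M density W (\<lambda>_. 1)
     = density (Pi\<^sub>M {..<n} (\<lambda>_. L) \<Otimes>\<^sub>M W) (\<lambda>(X, w). ennreal (sample_density n f X) * 1)"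
    using sample_density_measurable[OF positive_densityD(1)[OF f], of n] W.sigma_finite_measure_axioms sfP
    by (intro pair_measure_density) (auto simp: Wd)
  then show ?thesis unfolding Wd iid_samples_eq_density[OF L f]
    by (simp add: case_prod_unfold)
qed

text \<open>The affinity is \<open>1 - TV\<close> of the sample densities, whose divergence is \<open>n * J\<close>.\<close>

lemma nn_integral_min_sample_density:
  assumes L: "sigma_finite_measure L" and f: "positive_density L f" and g: "positive_density L g"
    and i: "integrable (density L f) (log_ratio f g)" "integrable (density L g) (log_ratio f g)"
    and J: "real n * jeffreys L f g \<le> 1 / 2"
  shows "(\<integral>\<^sup>+ X. min (ennreal (sample_density n f X)) (ennreal (sample_density n g X)) \<partial>Pi\<^sub>M {..<n} (\<lambda>_. L)) \<ge> ennreal (1/2)"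
proof -
  let ?P = "Pi\<^sub>M {..<n} (\<lambda>_. L)" and ?p = "sample_density n f" and ?q = "sample_density n g"
  note F = positive_sample_density[OF L f, of n] and G = positive_sample_density[OF L g, of n]
  note js = jeffreys_sample[OF L f g i, of n]
  note Fi = positive_density_integrable[OF F] and Gi = positive_density_integrable[OF G]
  have "(\<integral>X. \<bar>?p X - ?q X\<bar> \<partial>?P) \<le> sqrt (2 * jeffreys ?P ?p ?q)"
    by (rule integral_abs_diff_le_jeffreys[OF F G js(1,2)])
  also have "\<dots> \<le> sqrt 1" using J by (intro real_sqrt_le_mono) (simp add: js(3))
  finally have a: "(\<integral>X. \<bar>?p X - ?q X\<bar> \<partial>?P) \<le> 1" by simp
  have m: "min x y = (x + y - \<bar>x - y\<bar>) / 2" for x y :: real by (simp add: min_def abs_if)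
  have mi: "integrable ?P (\<lambda>X. min (?p X) (?q X))" unfolding m using Fi Gi by auto
  have "1 / 2 \<le> (\<integral>X. min (?p X) (?q X) \<partial>?P)" unfolding m using a Fi Gi by simp
  then have "ennreal (1/2) \<le> ennreal (\<integral>X. min (?p X) (?q X) \<partial>?P)" by (rule ennreal_leI)
  also have "\<dots> = (\<integral>\<^sup>+ X. ennreal (min (?p X) (?q X)) \<partial>?P)"
    using mi positive_densityD(2)[OF F] positive_densityD(2)[OF G]
    by (intro nn_integral_eq_integral[symmetric]) (auto simp: less_imp_le)
  also have "\<dots> = (\<integral>\<^sup>+ X. min (ennreal (?p X)) (ennreal (?q X)) \<partial>?P)"
    using positive_densityD(2)[OF F] positive_densityD(2)[OF G]
    by (intro nn_integral_cong) (auto simp: min_def less_imp_le)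
  finally show ?thesis .
qed

text \<open>Assouad's lemma.  The average risk over the cube is bounded from below pointwise in the sample: the vertex \<open>\<tau>\<close> nearest
  to the estimate turns the loss at \<open>\<sigma>\<close> into half the separation of \<open>\<sigma>\<close> and \<open>\<tau>\<close>, and \<open>hamming_vote\<close> reduces the
  sum to affinities between neighbours.\<close>

theorem assouad_minimax_ge:
  fixes f :: "'e set \<Rightarrow> 'a \<Rightarrow> real" and \<kappa> :: real
  assumes L: "sigma_finite_measure L" and I: "finite I" "I \<noteq> {}" and \<kappa>: "\<kappa> \<ge> 0"
    and F: "\<And>\<sigma>. \<sigma> \<subseteq> I \<Longrightarrow> f \<sigma> \<in> F"
    and pd: "\<And>\<sigma>. \<sigma> \<subseteq> I \<Longrightarrow> positive_density L (f \<sigma>)"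
    and sep: "\<And>\<sigma> \<tau>. \<sigma> \<subseteq> I \<Longrightarrow> \<tau> \<subseteq> I \<Longrightarrow>
       ennreal (\<kappa> * card (sym_diff \<sigma> \<tau>)) \<le> tv_dist L (f \<sigma>) (f \<tau>)"
    and int: "\<And>\<sigma> \<tau>. \<sigma> \<subseteq> I \<Longrightarrow> \<tau> \<subseteq> I \<Longrightarrow> integrable (density L (f \<sigma>)) (log_ratio (f \<sigma>) (f \<tau>))"
    and close: "\<And>\<sigma> e. \<sigma> \<subseteq> I \<Longrightarrow> e \<in> I \<Longrightarrow> e \<notin> \<sigma> \<Longrightarrow>
       real n * jeffreys L (f \<sigma>) (f (insert e \<sigma>)) \<le> 1 / 2"
  shows "ennreal (\<kappa> * card I / 8) \<le> minimax_risk L n F"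
  unfolding minimax_risk_def
proof (rule INF_greatest, clarify)
  fix W and h :: "(nat \<Rightarrow> 'a) \<Rightarrow> real \<Rightarrow> 'a \<Rightarrow> real"
  assume est: "(W, h) \<in> estimators L n"
  let ?P = "Pi\<^sub>M {..<n} (\<lambda>_. L)"
  let ?R = "estimator_risk L n F (W, h)"
  have W: "prob_space W" using est by (simp add: estimators_def)
  interpret W: prob_space W by (rule W)
  have hm: "(\<lambda>(z, x). h (fst z) (snd z) x) \<in> borel_measurable ((?P \<Otimes>\<^sub>M W) \<Otimes>\<^sub>M L)"
    using est by (simp add: estimators_def case_prod_unfold)
  define p where "p \<sigma> z = ennreal (sample_density n (f \<sigma>) (fst z))" for \<sigma> and z :: "(nat \<Rightarrow> 'a) \<times> real"
  define a where "a \<sigma> z = tv_dist L (h (fst z) (snd z)) (f \<sigma>)" for \<sigma> and z :: "(nat \<Rightarrow> 'a) \<times> real"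
  have am: "a \<sigma> \<in> borel_measurable (?P \<Otimes>\<^sub>M W)" if "\<sigma> \<subseteq> I" for \<sigma>
    unfolding a_def using tv_dist_measurable[OF L positive_densityD(1)[OF pd[OF that]] hm] .
  have pm: "p \<sigma> \<in> borel_measurable (?P \<Otimes>\<^sub>M W)" if "\<sigma> \<subseteq> I" for \<sigma>
  proof -
    note [measurable] = sample_density_measurable[OF positive_densityD(1)[OF pd[OF that]], of n]
    show ?thesis unfolding p_def by measurable
  qed
  have hx: "h (fst z) (snd z) \<in> borel_measurable L" if "z \<in> space (?P \<Otimes>\<^sub>M W)" for z
    using measurable_Pair2[OF hm that] by simp
  have risk: "(\<integral>\<^sup>+ z. p \<sigma> z * a \<sigma> z \<partial>(?P \<Otimes>\<^sub>M W)) \<le> ?R" if s: "\<sigma> \<subseteq> I" for \<sigma>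
  proof -
    have "(\<integral>\<^sup>+ z. p \<sigma> z * a \<sigma> z \<partial>(?P \<Otimes>\<^sub>M W)) = (\<integral>\<^sup>+ (X, w). tv_dist L (h X w) (f \<sigma>) \<partial>(iid_samples L n (f \<sigma>) \<Otimes>\<^sub>M W))"
      unfolding iid_pair_density[OF L pd[OF s] W] p_def a_def case_prod_unfold
      using am[OF s, unfolded a_def[abs_def]] pm[OF s, unfolded p_def[abs_def]]
      by (rule nn_integral_density[symmetric, rotated])
    also have "\<dots> \<le> ?R" unfolding estimator_risk_def using F[OF s] by (auto intro: SUP_upper)
    finally show ?thesis .
  qed
  define m where "m e \<sigma> z = min (p \<sigma> z) (p (insert e \<sigma>) z)" for e \<sigma> and z
  have mm: "m e \<sigma> \<in> borel_measurable (?P \<Otimes>\<^sub>M W)" if "e \<in> I" "\<sigma> \<subseteq> I - {e}" for e \<sigma>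
  proof -
    have [measurable]: "p \<sigma> \<in> borel_measurable (?P \<Otimes>\<^sub>M W)" "p (insert e \<sigma>) \<in> borel_measurable (?P \<Otimes>\<^sub>M W)"
      using that by (auto intro!: pm)
    show ?thesis unfolding m_def by measurable
  qed
  have mi: "ennreal (1/2) \<le> (\<integral>\<^sup>+ z. m e \<sigma> z \<partial>(?P \<Otimes>\<^sub>M W))" if e: "e \<in> I" "\<sigma> \<subseteq> I - {e}" for e \<sigma>
  proof -
    let ?g = "\<lambda>X. min (ennreal (sample_density n (f \<sigma>) X)) (ennreal (sample_density n (f (insert e \<sigma>)) X))"
    have s: "\<sigma> \<subseteq> I" "insert e \<sigma> \<subseteq> I" "e \<notin> \<sigma>" using e by auto
    have "integrable (density L (f (insert e \<sigma>))) (\<lambda>x. - log_ratio (f (insert e \<sigma>)) (f \<sigma>) x)"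
      using int[OF s(2,1)] by simp
    then have i2: "integrable (density L (f (insert e \<sigma>))) (log_ratio (f \<sigma>) (f (insert e \<sigma>)))"
      unfolding log_ratio_commute[symmetric] .
    have "?g \<in> borel_measurable ?P"
      using sample_density_measurable[OF positive_densityD(1)[OF pd[OF s(1)]], of n]
        sample_density_measurable[OF positive_densityD(1)[OF pd[OF s(2)]], of n] by measurable
    from nn_integral_pair_fst[OF W this]
    have "(\<integral>\<^sup>+ z. m e \<sigma> z \<partial>(?P \<Otimes>\<^sub>M W)) = (\<integral>\<^sup>+ X. ?g X \<partial>?P)"
      by (simp add: m_def p_def case_prod_unfold)
    then show ?thesis
      using nn_integral_min_sample_density[OF L pd[OF s(1)] pd[OF s(2)] int[OF s(1,2)] i2 close[OF s(1) e(1) s(3)]]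
      by simp
  qed
  have pw: "ennreal (\<kappa> / 2) * (\<Sum>e\<in>I. \<Sum>\<sigma>\<in>Pow (I - {e}). m e \<sigma> z) \<le> (\<Sum>\<sigma>\<in>Pow I. p \<sigma> z * a \<sigma> z)"
    if z: "z \<in> space (?P \<Otimes>\<^sub>M W)" for z
  proof -
    \<comment> \<open>The nearest vertex depends on \<open>z\<close>; it disappears from the inequality before the integration.\<close>
    obtain \<tau> where \<tau>: "\<tau> \<in> Pow I" "\<And>\<sigma>. \<sigma> \<in> Pow I \<Longrightarrow> a \<tau> z \<le> a \<sigma> z"
    proof -
      have fin: "finite ((\<lambda>\<sigma>. a \<sigma> z) ` Pow I)" "(\<lambda>\<sigma>. a \<sigma> z) ` Pow I \<noteq> {}" using I by auto
      obtain \<tau> where "\<tau> \<in> Pow I" "a \<tau> z = Min ((\<lambda>\<sigma>. a \<sigma> z) ` Pow I)" using Min_in[OF fin] by auto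
      then show ?thesis using that[of \<tau>] fin by auto
    qed
    have lower: "ennreal (\<kappa> / 2) * of_nat (card (sym_diff \<sigma> \<tau>)) \<le> a \<sigma> z" if s: "\<sigma> \<in> Pow I" for \<sigma>
    proof -
      let ?c = "real (card (sym_diff \<sigma> \<tau>))"
      have "ennreal (\<kappa> * ?c) \<le> tv_dist L (f \<sigma>) (f \<tau>)" using sep s \<tau> by auto
      also have "\<dots> \<le> a \<sigma> z + a \<tau> z" unfolding a_def
        using s \<tau>(1) by (intro tv_dist_triangle hx[OF z] positive_densityD(1) pd) auto
      also have "\<dots> \<le> a \<sigma> z + a \<sigma> z" by (intro add_left_mono \<tau>(2) s)
      also have "\<dots> = 2 * a \<sigma> z" by (simp add: mult_2)
      finally have "ennreal (\<kappa> * ?c) \<le> 2 * a \<sigma> z" .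
      moreover have "ennreal (\<kappa> * ?c) = 2 * (ennreal (\<kappa> / 2) * of_nat (card (sym_diff \<sigma> \<tau>)))"
      proof -
        have "ennreal (\<kappa> * ?c) = ennreal (2 * (\<kappa> / 2 * ?c))" by simp
        also have "\<dots> = ennreal 2 * (ennreal (\<kappa> / 2) * ennreal ?c)"
          using \<kappa> by (subst ennreal_mult, simp, simp, subst ennreal_mult) auto
        finally show ?thesis by (simp add: ennreal_of_nat_eq_real_of_nat)
      qed
      ultimately show ?thesis by (simp add: ennreal_mult_le_mult_iff)
    qed
    have "ennreal (\<kappa> / 2) * (\<Sum>e\<in>I. \<Sum>\<sigma>\<in>Pow (I - {e}). m e \<sigma> z)
        \<le> ennreal (\<kappa> / 2) * (\<Sum>\<sigma>\<in>Pow I. p \<sigma> z * of_nat (card (sym_diff \<sigma> \<tau>)))"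
      unfolding m_def using hamming_vote[OF I(1), of \<tau> "\<lambda>\<sigma>. p \<sigma> z"] \<tau>(1) by (intro mult_left_mono) auto
    also have "\<dots> = (\<Sum>\<sigma>\<in>Pow I. p \<sigma> z * (ennreal (\<kappa> / 2) * of_nat (card (sym_diff \<sigma> \<tau>))))"
      by (simp add: sum_distrib_left mult_ac)
    also have "\<dots> \<le> (\<Sum>\<sigma>\<in>Pow I. p \<sigma> z * a \<sigma> z)" by (intro sum_mono mult_left_mono lower) auto
    finally show ?thesis .
  qed
  have card1: "card (Pow (I - {e})) = 2 ^ (card I - 1)" if "e \<in> I" for e
    using that I by (simp add: card_Pow)
  obtain N where N: "card I = Suc N" using I by (metis card_gt_0_iff gr0_implies_Suc)
  have "ennreal (2 ^ card I) * ennreal (\<kappa> * card I / 8)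
      = ennreal (\<kappa> / 2) * (\<Sum>e\<in>I. \<Sum>\<sigma>\<in>Pow (I - {e}). ennreal (1/2))"
  proof -
    have "(\<Sum>e\<in>I. \<Sum>\<sigma>\<in>Pow (I - {e}). ennreal (1/2)) = ennreal (\<Sum>e\<in>I. \<Sum>\<sigma>\<in>Pow (I - {e}). 1/2)"
      by (simp only: sum_ennreal sum_nonneg zero_le_divide_1_iff zero_le_numeral)
    also have "(\<Sum>e\<in>I. \<Sum>\<sigma>\<in>Pow (I - {e}). (1::real)/2) = card I * (2 ^ N * (1/2))"
      using card1 N by simp
    finally show ?thesis using \<kappa> by (simp add: ennreal_mult[symmetric] N del: ennreal_half)
  qed
  also have "\<dots> \<le> ennreal (\<kappa> / 2) * (\<Sum>e\<in>I. \<Sum>\<sigma>\<in>Pow (I - {e}). \<integral>\<^sup>+ z. m e \<sigma> z \<partial>(?P \<Otimes>\<^sub>M W))"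
    using mi by (intro mult_left_mono sum_mono) auto
  also have "\<dots> = (\<integral>\<^sup>+ z. ennreal (\<kappa> / 2) * (\<Sum>e\<in>I. \<Sum>\<sigma>\<in>Pow (I - {e}). m e \<sigma> z) \<partial>(?P \<Otimes>\<^sub>M W))"
  proof -
    have "(\<integral>\<^sup>+ z. (\<Sum>e\<in>I. \<Sum>\<sigma>\<in>Pow (I - {e}). m e \<sigma> z) \<partial>(?P \<Otimes>\<^sub>M W))
      = (\<Sum>e\<in>I. \<integral>\<^sup>+ z. (\<Sum>\<sigma>\<in>Pow (I - {e}). m e \<sigma> z) \<partial>(?P \<Otimes>\<^sub>M W))"
      using mm by (intro nn_integral_sum borel_measurable_sum) auto
    also have "\<dots> = (\<Sum>e\<in>I. \<Sum>\<sigma>\<in>Pow (I - {e}). \<integral>\<^sup>+ z. m e \<sigma> z \<partial>(?P \<Otimes>\<^sub>M W))"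
      using mm by (intro sum.cong nn_integral_sum) auto
    finally show ?thesis using mm
      by (subst nn_integral_cmult) (auto intro!: borel_measurable_sum)
  qed
  also have "\<dots> \<le> (\<integral>\<^sup>+ z. (\<Sum>\<sigma>\<in>Pow I. p \<sigma> z * a \<sigma> z) \<partial>(?P \<Otimes>\<^sub>M W))"
    by (intro nn_integral_mono pw)
  also have "\<dots> = (\<Sum>\<sigma>\<in>Pow I. \<integral>\<^sup>+ z. p \<sigma> z * a \<sigma> z \<partial>(?P \<Otimes>\<^sub>M W))"
    using am pm by (intro nn_integral_sum) auto
  also have "\<dots> \<le> (\<Sum>\<sigma>\<in>Pow I. ?R)" using risk by (intro sum_mono) auto
  also have "\<dots> = ennreal (2 ^ card I) * ?R" using I
    by (simp add: card_Pow ennreal_of_nat_eq_real_of_nat)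
  finally show "ennreal (\<kappa> * card I / 8) \<le> ?R"
    by (subst (asm) ennreal_mult_le_mult_iff) auto
qed

section \<open>Quadratic polynomials in independent standard normals\<close>

definition std_normal :: "real measure" where
  "std_normal = density lborel (\<lambda>x. ennreal (std_normal_density x))"

definition std_normal_Rd :: "nat \<Rightarrow> (nat \<Rightarrow> real) measure" where
  "std_normal_Rd d = Pi\<^sub>M {..<d} (\<lambda>_. std_normal)"

interpretation std_normal: prob_space std_normal
  unfolding std_normal_def by (rule prob_space_normal_density) simp

interpretation std_normal_prod: product_sigma_finite "\<lambda>_::nat. std_normal"
  by unfold_locales

lemma prob_space_std_normal_Rd: "prob_space (std_normal_Rd d)"
  unfolding std_normal_Rd_def by (intro prob_space_PiM std_normal.prob_space_axioms)

lemma sets_std_normal [measurable_cong]: "sets std_normal = sets borel"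
  by (simp add: std_normal_def)

lemma std_normal_moment:
  "integrable std_normal (\<lambda>t. t ^ k)"
  "(\<integral>t. t ^ (2 * k) \<partial>std_normal) = fact (2 * k) / (2 ^ k * fact k)"
  "(\<integral>t. t ^ (2 * k + 1) \<partial>std_normal) = 0"
  using integrable_std_normal_moment[of k] integral_std_normal_moment_even[of k]
    integral_std_normal_moment_odd[of k]
  unfolding std_normal_def by (simp_all add: integrable_density integral_density)

lemma std_normal_integral_poly:
  "(\<integral>t. c0 + c1 * t + c2 * t^2 + c3 * t^3 + c4 * t^4 + c5 * t^5 + c6 * t^6 + c7 * t^7 + c8 * t^8 \<partial>std_normal)
    = c0 + c2 + 3 * c4 + 15 * c6 + 105 * c8"
proof -
  have m: "(\<integral>t. t \<partial>std_normal) = 0" "(\<integral>t. t^2 \<partial>std_normal) = 1" "(\<integral>t. t^3 \<partial>std_normal) = 0"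
    "(\<integral>t. t^4 \<partial>std_normal) = 3" "(\<integral>t. t^5 \<partial>std_normal) = 0" "(\<integral>t. t^6 \<partial>std_normal) = 15"
    "(\<integral>t. t^7 \<partial>std_normal) = 0" "(\<integral>t. t^8 \<partial>std_normal) = 105"
    using std_normal_moment(2)[of 1] std_normal_moment(2)[of 2] std_normal_moment(2)[of 3] std_normal_moment(2)[of 4]
      std_normal_moment(3)[of 0] std_normal_moment(3)[of 1] std_normal_moment(3)[of 2] std_normal_moment(3)[of 3]
    by (simp_all add: fact_numeral)
  have i: "integrable std_normal (\<lambda>t. t)" using std_normal_moment(1)[of 1] by simp
  show ?thesis using m i std_normal_moment(1) std_normal.prob_space
    by (simp add: Bochner_Integration.integral_add)
qed

text \<open>The polynomials \<open>1\<close>, \<open>t\<close> and \<open>t\<^sup>2 - 1\<close> are orthogonal under the standard normal law.\<close>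

lemma hermite_moments:
  fixes P Q r :: real
  shows "(\<integral>t. P + t * Q + (t\<^sup>2 - 1) * r \<partial>std_normal) = P"
    "(\<integral>t. (P + t * Q + (t\<^sup>2 - 1) * r)^2 \<partial>std_normal) = P^2 + Q^2 + 2 * r^2"
    "(\<integral>t. (P + t * Q + (t\<^sup>2 - 1) * r)^4 \<partial>std_normal)
      = P^4 + 6 * (P^2 * Q^2) + 12 * r^2 * P^2 + 24 * r * (P * Q^2) + 32 * r^3 * P + 3 * Q^4 + 60 * r^2 * Q^2 + 60 * r^4"
proof -
  \<comment> \<open>In powers of \<open>t\<close> the constant term is \<open>a\<close>.\<close>
  define a where "a = P - r"
  have P: "P = a + r" by (simp add: a_def)
  have e1: "P + t * Q + (t\<^sup>2 - 1) * r = a + Q * t + r * t^2 + 0 * t^3 + 0 * t^4 + 0 * t^5 + 0 * t^6 + 0 * t^7 + 0 * t^8" for t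
    by (simp add: P algebra_simps)
  show "(\<integral>t. P + t * Q + (t\<^sup>2 - 1) * r \<partial>std_normal) = P"
    unfolding e1 std_normal_integral_poly by (simp add: P)
  have e2: "(P + t * Q + (t\<^sup>2 - 1) * r)^2 = a^2 + (2*a*Q) * t + (Q^2 + 2*a*r) * t^2 + (2*Q*r) * t^3 + r^2 * t^4 + 0 * t^5 + 0 * t^6 + 0 * t^7 + 0 * t^8" for t
    unfolding P by (simp add: power2_eq_square power3_eq_cube power4_eq_xxxx algebra_simps)
  show "(\<integral>t. (P + t * Q + (t\<^sup>2 - 1) * r)^2 \<partial>std_normal) = P^2 + Q^2 + 2 * r^2"
    unfolding e2 std_normal_integral_poly unfolding P by (simp add: power2_eq_square algebra_simps)
  have e4: "(P + t * Q + (t\<^sup>2 - 1) * r)^4 = a^4 + (4*a^3*Q) * t + (6*a^2*Q^2 + 4*a^3*r) * t^2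
     + (4*a*Q^3 + 12*a^2*Q*r) * t^3 + (Q^4 + 12*a*Q^2*r + 6*a^2*r^2) * t^4
     + (4*Q^3*r + 12*a*Q*r^2) * t^5 + (6*Q^2*r^2 + 4*a*r^3) * t^6 + (4*Q*r^3) * t^7 + r^4 * t^8" for t
    unfolding P by (simp add: power_numeral_reduce algebra_simps)
  show "(\<integral>t. (P + t * Q + (t\<^sup>2 - 1) * r)^4 \<partial>std_normal)
      = P^4 + 6 * (P^2 * Q^2) + 12 * r^2 * P^2 + 24 * r * (P * Q^2) + 32 * r^3 * P + 3 * Q^4 + 60 * r^2 * Q^2 + 60 * r^4"
    unfolding e4 std_normal_integral_poly unfolding P
    by (simp add: power_numeral_reduce algebra_simps)
qed

text \<open>A class closed under sums and products whose members are integrable, because the bound is a product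
  of functions of one coordinate each.\<close>

definition poly_growth :: "nat \<Rightarrow> ((nat \<Rightarrow> real) \<Rightarrow> real) \<Rightarrow> bool" where
  "poly_growth d f \<longleftrightarrow> f \<in> borel_measurable (std_normal_Rd d) \<and>
     (\<exists>C p. \<forall>z. \<bar>f z\<bar> \<le> C * (\<Prod>i<d. (1 + (z i)\<^sup>2) ^ p))"

lemma growth_ge_1: "1 \<le> (\<Prod>i<d. (1 + (z i :: real)\<^sup>2) ^ p)"
  by (intro prod_ge_1 one_le_power) auto

lemma growth_mono: "p \<le> q \<Longrightarrow> (\<Prod>i<d. (1 + (z i :: real)\<^sup>2) ^ p) \<le> (\<Prod>i<d. (1 + (z i)\<^sup>2) ^ q)"
  by (intro prod_mono) (auto intro: power_increasing)

lemma poly_growth_const: "poly_growth d (\<lambda>_. c)"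
proof -
  have "\<bar>c\<bar> \<le> \<bar>c\<bar> * (\<Prod>i<d. (1 + (z i :: real)\<^sup>2) ^ 1)" for z
    using growth_ge_1[where z = z and d = d and p = 1] mult_left_mono[of 1 "\<Prod>i<d. (1 + (z i :: real)\<^sup>2) ^ 1" "\<bar>c\<bar>"] by simp
  then show ?thesis unfolding poly_growth_def by (intro conjI) (simp, blast)
qed

lemma poly_growth_coord:
  assumes "i < d" shows "poly_growth d (\<lambda>z. z i)"
proof -
  have m: "(\<lambda>z. z i) \<in> borel_measurable (std_normal_Rd d)"
  proof -
    have "(\<lambda>z. z i) \<in> std_normal_Rd d \<rightarrow>\<^sub>M std_normal" unfolding std_normal_Rd_def
      using assms by (intro measurable_component_singleton) auto
    then show ?thesis by (simp add: measurable_cong_sets[OF refl sets_std_normal])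
  qed
  have "\<bar>z i\<bar> \<le> 1 * (\<Prod>i<d. (1 + (z i)\<^sup>2) ^ 1)" for z :: "nat \<Rightarrow> real"
  proof -
    have "\<bar>z i\<bar> \<le> 1 + (z i)\<^sup>2"
    proof (cases "\<bar>z i\<bar> \<le> 1")
      case False
      then have "\<bar>z i\<bar> * 1 \<le> \<bar>z i\<bar> * \<bar>z i\<bar>" by (intro mult_left_mono) auto
      then show ?thesis by (simp add: power2_eq_square)
    qed (use zero_le_power2[of "z i"] in linarith)
    also have "\<dots> \<le> (1 + (z i)\<^sup>2) * (\<Prod>j\<in>{..<d} - {i}. (1 + (z j)\<^sup>2))"
      using mult_left_mono[of 1 "\<Prod>j\<in>{..<d} - {i}. (1 + (z j)\<^sup>2)" "1 + (z i)\<^sup>2"]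
      by (simp add: prod_ge_1)
    also have "\<dots> = (\<Prod>j<d. (1 + (z j)\<^sup>2))" using assms by (subst prod.remove[of _ i]) auto
    finally show ?thesis by simp
  qed
  then show ?thesis using m unfolding poly_growth_def by blast
qed

lemma poly_growth_add:
  assumes "poly_growth d f" "poly_growth d g" shows "poly_growth d (\<lambda>z. f z + g z)"
proof -
  let ?G = "\<lambda>p z. \<Prod>i<d. (1 + (z i :: real)\<^sup>2) ^ p"
  obtain C p C' p' where b: "\<And>z. \<bar>f z\<bar> \<le> C * ?G p z" "\<And>z. \<bar>g z\<bar> \<le> C' * ?G p' z"
    using assms unfolding poly_growth_def by blast
  have "\<bar>f z + g z\<bar> \<le> (\<bar>C\<bar> + \<bar>C'\<bar>) * ?G (p + p') z" for z
  proof -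
    have "\<bar>f z\<bar> \<le> \<bar>C\<bar> * ?G p z" "\<bar>g z\<bar> \<le> \<bar>C'\<bar> * ?G p' z"
      using growth_ge_1[where z = z and d = d and p = p] growth_ge_1[where z = z and d = d and p = p']
      by (auto intro!: order_trans[OF b(1)] order_trans[OF b(2)] mult_right_mono)
    moreover have "\<bar>C\<bar> * ?G p z \<le> \<bar>C\<bar> * ?G (p + p') z" "\<bar>C'\<bar> * ?G p' z \<le> \<bar>C'\<bar> * ?G (p + p') z"
      by (intro mult_left_mono growth_mono; simp)+
    ultimately show ?thesis
      unfolding distrib_right using abs_triangle_ineq[of "f z" "g z"] by linarith
  qed
  moreover have "(\<lambda>z. f z + g z) \<in> borel_measurable (std_normal_Rd d)"
    using assms unfolding poly_growth_def by auto
  ultimately show ?thesis unfolding poly_growth_def by blast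
qed

lemma poly_growth_mult:
  assumes "poly_growth d f" "poly_growth d g" shows "poly_growth d (\<lambda>z. f z * g z)"
proof -
  let ?G = "\<lambda>p z. \<Prod>i<d. (1 + (z i :: real)\<^sup>2) ^ p"
  obtain C p C' p' where b: "\<And>z. \<bar>f z\<bar> \<le> C * ?G p z" "\<And>z. \<bar>g z\<bar> \<le> C' * ?G p' z"
    using assms unfolding poly_growth_def by blast
  have "\<bar>f z * g z\<bar> \<le> (C * C') * ?G (p + p') z" for z
  proof -
    have "\<bar>f z\<bar> * \<bar>g z\<bar> \<le> (C * ?G p z) * (C' * ?G p' z)"
      using b by (intro mult_mono) (auto intro: order_trans[OF abs_ge_zero])
    also have "\<dots> = (C * C') * ?G (p + p') z" by (simp add: power_add prod.distrib mult_ac)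
    finally show ?thesis by (simp add: abs_mult)
  qed
  moreover have "(\<lambda>z. f z * g z) \<in> borel_measurable (std_normal_Rd d)"
    using assms unfolding poly_growth_def by auto
  ultimately show ?thesis unfolding poly_growth_def by blast
qed

lemma poly_growth_power:
  assumes "poly_growth d f" shows "poly_growth d (\<lambda>z. f z ^ k)"
  by (induction k) (auto intro!: poly_growth_const poly_growth_mult assms)

lemma poly_growth_sum:
  assumes "\<And>a. a \<in> A \<Longrightarrow> poly_growth d (f a)" shows "poly_growth d (\<lambda>z. \<Sum>a\<in>A. f a z)"
  using assms by (induction A rule: infinite_finite_induct) (auto intro!: poly_growth_const poly_growth_add)

lemma poly_growth_integrable:
  assumes "poly_growth d f" shows "integrable (std_normal_Rd d) f"
proof -
  obtain C p where b: "\<And>z. \<bar>f z\<bar> \<le> C * (\<Prod>i<d. (1 + (z i)\<^sup>2) ^ p)" and m: "f \<in> borel_measurable (std_normal_Rd d)"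
    using assms unfolding poly_growth_def by blast
  have "integrable std_normal (\<lambda>t. (1 + t\<^sup>2) ^ p)"
  proof -
    have "(1 + t\<^sup>2) ^ p = (\<Sum>k\<le>p. of_nat (p choose k) * t ^ (2 * (p - k)))" for t :: real
      by (simp add: binomial_ring power_mult)
    then show ?thesis using std_normal_moment(1) by simp
  qed
  then have "integrable (std_normal_Rd d) (\<lambda>z. \<Prod>i<d. (1 + (z i)\<^sup>2) ^ p)"
    unfolding std_normal_Rd_def by (intro std_normal_prod.product_integrable_prod) auto
  then have "integrable (std_normal_Rd d) (\<lambda>z. C * (\<Prod>i<d. (1 + (z i)\<^sup>2) ^ p))" by simp
  then show ?thesis
  proof (rule Bochner_Integration.integrable_bound[OF _ m])
    show "AE z in std_normal_Rd d. norm (f z) \<le> norm (C * (\<Prod>i<d. (1 + (z i)\<^sup>2) ^ p))"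
      using b by (intro AE_I2) (auto intro: order_trans[OF b])
  qed
qed

lemma poly_growth_sq_integrable:
  assumes "poly_growth d f" shows "sq_integrable (std_normal_Rd d) f"
  using poly_growth_integrable[OF poly_growth_power[OF assms, of 2]] assms
  by (simp add: sq_integrable_def poly_growth_def)

lemma integral_std_normal_Suc:
  assumes "poly_growth (Suc d) f"
  shows "(\<integral>z. f z \<partial>std_normal_Rd (Suc d)) = (\<integral>z. \<integral>t. f (z(d := t)) \<partial>std_normal \<partial>std_normal_Rd d)"
  using std_normal_prod.product_integral_insert[of "{..<d}" d f] poly_growth_integrable[OF assms]
  by (simp add: std_normal_Rd_def lessThan_Suc)

definition quadratic :: "nat \<Rightarrow> (nat \<Rightarrow> nat \<Rightarrow> real) \<Rightarrow> (nat \<Rightarrow> real) \<Rightarrow> real \<Rightarrow> (nat \<Rightarrow> real) \<Rightarrow> real" where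
  "quadratic d A b c z = c + (\<Sum>i<d. b i * z i) + (\<Sum>i<d. \<Sum>j<d. A i j * (z i * z j))"

lemma poly_growth_quadratic: "poly_growth d (quadratic d A b c)"
  unfolding quadratic_def
  by (intro poly_growth_add poly_growth_sum poly_growth_mult poly_growth_const poly_growth_coord) auto

text \<open>Split off the last coordinate in the Hermite basis; its coefficients are a quadratic and an affine polynomial
  in the other coordinates and a constant.\<close>

lemma quadratic_Suc:
  assumes sym: "\<And>i. i < d \<Longrightarrow> A i d = A d i"
  shows "quadratic (Suc d) A b c (z(d := t)) =
    quadratic d A b (c + A d d) z + t * quadratic d (\<lambda>_ _. 0) (\<lambda>i. 2 * A i d) (b d) z + (t\<^sup>2 - 1) * A d d"
proof -
  let ?y = "z(d := t)"
  have 1: "(\<Sum>i<Suc d. b i * ?y i) = (\<Sum>i<d. b i * z i) + b d * t" by simp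
  have "(\<Sum>i<Suc d. \<Sum>j<Suc d. A i j * (?y i * ?y j))
     = (\<Sum>i<d. (\<Sum>j<d. A i j * (z i * z j)) + A i d * (z i * t)) + ((\<Sum>j<d. A d j * (t * z j)) + A d d * (t * t))"
    by simp
  also have "(\<Sum>j<d. A d j * (t * z j)) = (\<Sum>i<d. A i d * (z i * t))"
    using sym by (intro sum.cong) auto
  finally have 2: "(\<Sum>i<Suc d. \<Sum>j<Suc d. A i j * (?y i * ?y j))
     = (\<Sum>i<d. \<Sum>j<d. A i j * (z i * z j)) + 2 * (\<Sum>i<d. A i d * (z i * t)) + A d d * t\<^sup>2"
    by (simp add: sum.distrib power2_eq_square)
  have 3: "t * quadratic d (\<lambda>_ _. 0) (\<lambda>i. 2 * A i d) (b d) z = b d * t + 2 * (\<Sum>i<d. A i d * (z i * t))"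
    by (simp add: quadratic_def sum_distrib_left sum_distrib_right algebra_simps)
  show ?thesis unfolding 3 unfolding quadratic_def 1 2 by (simp add: algebra_simps)
qed

lemma quadratic_mean:
  assumes "\<And>i j. i < d \<Longrightarrow> j < d \<Longrightarrow> A i j = A j i"
  shows "(\<integral>z. quadratic d A b c z \<partial>std_normal_Rd d) = c + (\<Sum>i<d. A i i)"
  using assms
proof (induction d arbitrary: A b c)
  case 0
  interpret prob_space "std_normal_Rd 0" by (rule prob_space_std_normal_Rd)
  show ?case by (simp add: quadratic_def prob_space)
next
  case (Suc d)
  have "(\<integral>z. quadratic (Suc d) A b c z \<partial>std_normal_Rd (Suc d))
      = (\<integral>z. quadratic d A b (c + A d d) z \<partial>std_normal_Rd d)"
    using Suc.prems by (simp add: integral_std_normal_Suc[OF poly_growth_quadratic] quadratic_Suc hermite_moments)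
  then show ?case using Suc by simp
qed

lemma quadratic_second_moment:
  assumes "\<And>i j. i < d \<Longrightarrow> j < d \<Longrightarrow> A i j = A j i"
  shows "(\<integral>z. (quadratic d A b c z)\<^sup>2 \<partial>std_normal_Rd d)
    = (c + (\<Sum>i<d. A i i))\<^sup>2 + 2 * (\<Sum>i<d. \<Sum>j<d. (A i j)\<^sup>2) + (\<Sum>i<d. (b i)\<^sup>2)"
  using assms
proof (induction d arbitrary: A b c)
  case 0
  interpret prob_space "std_normal_Rd 0" by (rule prob_space_std_normal_Rd)
  show ?case by (simp add: quadratic_def prob_space)
next
  case (Suc d)
  interpret prob_space "std_normal_Rd d" by (rule prob_space_std_normal_Rd)
  let ?P = "quadratic d A b (c + A d d)" and ?Q = "quadratic d (\<lambda>_ _. 0) (\<lambda>i. 2 * A i d) (b d)"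
  note int = poly_growth_integrable[OF poly_growth_power[OF poly_growth_quadratic]]
  have "(\<integral>z. (quadratic (Suc d) A b c z)\<^sup>2 \<partial>std_normal_Rd (Suc d))
      = (\<integral>z. (?P z)\<^sup>2 + (?Q z)\<^sup>2 + 2 * (A d d)\<^sup>2 \<partial>std_normal_Rd d)"
    using Suc.prems
    by (simp add: integral_std_normal_Suc[OF poly_growth_power[OF poly_growth_quadratic]] quadratic_Suc hermite_moments)
  also have "\<dots> = (\<integral>z. (?P z)\<^sup>2 \<partial>std_normal_Rd d) + (\<integral>z. (?Q z)\<^sup>2 \<partial>std_normal_Rd d) + 2 * (A d d)\<^sup>2"
    using int by (simp add: prob_space)
  also have "(\<integral>z. (?Q z)\<^sup>2 \<partial>std_normal_Rd d) = (b d)\<^sup>2 + 4 * (\<Sum>i<d. (A i d)\<^sup>2)"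
    by (subst Suc.IH) (auto simp: power_mult_distrib sum_distrib_left)
  also have "(\<integral>z. (?P z)\<^sup>2 \<partial>std_normal_Rd d)
     = (c + A d d + (\<Sum>i<d. A i i))\<^sup>2 + 2 * (\<Sum>i<d. \<Sum>j<d. (A i j)\<^sup>2) + (\<Sum>i<d. (b i)\<^sup>2)"
    using Suc.prems by (subst Suc.IH) auto
  also have "(\<Sum>i<d. (A i d)\<^sup>2) = (\<Sum>i<d. (A d i)\<^sup>2)" using Suc.prems by (intro sum.cong) auto
  finally show ?case
    using Suc.prems by (simp add: sum.distrib algebra_simps)
qed

lemma integral_cauchy_schwarz:
  assumes f: "sq_integrable P f" and g: "sq_integrable P g"
  shows "(\<integral>x. f x * g x \<partial>P)\<^sup>2 \<le> (\<integral>x. (f x)\<^sup>2 \<partial>P) * (\<integral>x. (g x)\<^sup>2 \<partial>P)"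
proof (cases "(\<integral>x. (g x)\<^sup>2 \<partial>P) = 0")
  case True
  then show ?thesis using integral_null_square[OF g f] by simp
next
  case False
  let ?G = "\<integral>x. (g x)\<^sup>2 \<partial>P" and ?F = "\<integral>x. (f x)\<^sup>2 \<partial>P" and ?I = "\<integral>x. f x * g x \<partial>P"
  have G: "?G > 0" using False by (simp add: less_le)
  define t where "t = ?I / ?G"
  have "0 \<le> (\<integral>x. (f x - t * g x)\<^sup>2 \<partial>P)" by simp
  also have "\<dots> = (\<integral>x. (f x)\<^sup>2 - 2 * t * (f x * g x) + t\<^sup>2 * (g x)\<^sup>2 \<partial>P)"
    by (simp add: power2_diff power_mult_distrib algebra_simps)
  also have "\<dots> = ?F - 2 * t * ?I + t\<^sup>2 * ?G"
    using f g sq_integrable_mult[OF f g] by (simp add: sq_integrable_def)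
  also have "\<dots> = ?F - ?I\<^sup>2 / ?G" using G by (simp add: t_def power2_eq_square field_simps)
  finally show ?thesis using G by (simp add: field_simps)
qed

lemma affine_fourth_moment:
  "(\<integral>z. (quadratic d (\<lambda>_ _. 0) b c z)^4 \<partial>std_normal_Rd d)
     \<le> 3 * (\<integral>z. (quadratic d (\<lambda>_ _. 0) b c z)\<^sup>2 \<partial>std_normal_Rd d)\<^sup>2"
proof (induction d arbitrary: b c)
  case 0
  interpret prob_space "std_normal_Rd 0" by (rule prob_space_std_normal_Rd)
  show ?case by (simp add: quadratic_def prob_space)
next
  case (Suc d)
  interpret prob_space "std_normal_Rd d" by (rule prob_space_std_normal_Rd)
  let ?P = "quadratic d (\<lambda>_ _. 0) b c"
  note int = poly_growth_integrable[OF poly_growth_power[OF poly_growth_quadratic]]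
  have b: "quadratic d (\<lambda>_ _. 0) (\<lambda>_. 0) c z = c" for c z by (simp add: quadratic_def)
  have step: "quadratic (Suc d) (\<lambda>_ _. 0) b c (z(d := t)) = ?P z + t * b d + (t\<^sup>2 - 1) * 0" for z t
    by (subst quadratic_Suc) (auto simp: b)
  have 2: "(\<integral>z. (quadratic (Suc d) (\<lambda>_ _. 0) b c z)\<^sup>2 \<partial>std_normal_Rd (Suc d))
      = (\<integral>z. (?P z)\<^sup>2 \<partial>std_normal_Rd d) + (b d)\<^sup>2"
    unfolding integral_std_normal_Suc[OF poly_growth_power[OF poly_growth_quadratic]] step hermite_moments
    using int by (simp add: prob_space)
  have "(\<integral>z. (quadratic (Suc d) (\<lambda>_ _. 0) b c z)^4 \<partial>std_normal_Rd (Suc d))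
      = (\<integral>z. (?P z)^4 \<partial>std_normal_Rd d) + 6 * (b d)\<^sup>2 * (\<integral>z. (?P z)\<^sup>2 \<partial>std_normal_Rd d) + 3 * (b d)^4"
    unfolding integral_std_normal_Suc[OF poly_growth_power[OF poly_growth_quadratic]] step hermite_moments
    using int by (simp add: prob_space)
  also have "\<dots> \<le> 3 * (\<integral>z. (?P z)\<^sup>2 \<partial>std_normal_Rd d)\<^sup>2 + 6 * (b d)\<^sup>2 * (\<integral>z. (?P z)\<^sup>2 \<partial>std_normal_Rd d) + 3 * (b d)^4"
    by (intro add_right_mono Suc.IH)
  also have "\<dots> = 3 * ((\<integral>z. (?P z)\<^sup>2 \<partial>std_normal_Rd d) + (b d)\<^sup>2)\<^sup>2"
    by (simp add: power2_eq_square power4_eq_xxxx algebra_simps)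
  finally show ?case unfolding 2 .
qed

text \<open>Induction on the number of coordinates, as for Bonami's lemma.  In the expansion of \<open>hermite_moments\<close> all terms but the
  fourth moment of \<open>P\<close> are bounded by second moments.  The critical one is \<open>6 * E(P\<^sup>2 Q\<^sup>2)\<close>, which the Cauchy-Schwarz
  inequality bounds by \<open>72 * p * q\<close> since \<open>48 * 3 = 12\<^sup>2\<close>; the square on the right offers \<open>96 * p * q\<close>.\<close>

lemma quadratic_fourth_moment:
  assumes "\<And>i j. i < d \<Longrightarrow> j < d \<Longrightarrow> A i j = A j i"
  shows "(\<integral>z. (quadratic d A b c z)^4 \<partial>std_normal_Rd d)
     \<le> 48 * (\<integral>z. (quadratic d A b c z)\<^sup>2 \<partial>std_normal_Rd d)\<^sup>2"
  using assms
proof (induction d arbitrary: A b c)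
  case 0
  interpret prob_space "std_normal_Rd 0" by (rule prob_space_std_normal_Rd)
  show ?case by (simp add: quadratic_def prob_space)
next
  case (Suc d)
  interpret prob_space "std_normal_Rd d" by (rule prob_space_std_normal_Rd)
  let ?N = "std_normal_Rd d"
  let ?P = "quadratic d A b (c + A d d)" and ?Q = "quadratic d (\<lambda>_ _. 0) (\<lambda>i. 2 * A i d) (b d)"
  let ?r = "A d d"
  note pg = poly_growth_power poly_growth_quadratic poly_growth_mult poly_growth_const
  define p where "p = (\<integral>z. (?P z)\<^sup>2 \<partial>?N)"
  define q where "q = (\<integral>z. (?Q z)\<^sup>2 \<partial>?N)"
  define P4 where "P4 = (\<integral>z. (?P z)^4 \<partial>?N)"
  define Q4 where "Q4 = (\<integral>z. (?Q z)^4 \<partial>?N)"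
  define PQ where "PQ = (\<integral>z. (?P z)\<^sup>2 * (?Q z)\<^sup>2 \<partial>?N)"
  define X where "X = ?r * (\<integral>z. ?P z * (?Q z)\<^sup>2 \<partial>?N)"
  define Y where "Y = ?r^3 * (\<integral>z. ?P z \<partial>?N)"
  define R where "R = ?r\<^sup>2"
  have nn: "p \<ge> 0" "q \<ge> 0" "R \<ge> 0" by (auto simp: p_def q_def R_def)
  have iP: "integrable ?N ?P" by (rule poly_growth_integrable[OF poly_growth_quadratic])
  have iP2: "integrable ?N (\<lambda>z. (?P z)\<^sup>2)" and iP4: "integrable ?N (\<lambda>z. (?P z)^4)"
    and iQ2: "integrable ?N (\<lambda>z. (?Q z)\<^sup>2)" and iQ4: "integrable ?N (\<lambda>z. (?Q z)^4)"
    and iPQ: "integrable ?N (\<lambda>z. (?P z)\<^sup>2 * (?Q z)\<^sup>2)" and iX: "integrable ?N (\<lambda>z. ?P z * (?Q z)\<^sup>2)"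
    by (intro poly_growth_integrable pg)+
  have step: "quadratic (Suc d) A b c (z(d := t)) = ?P z + t * ?Q z + (t\<^sup>2 - 1) * ?r" for z t
    using Suc.prems by (intro quadratic_Suc) auto
  have 2: "(\<integral>z. (quadratic (Suc d) A b c z)\<^sup>2 \<partial>std_normal_Rd (Suc d)) = p + q + 2 * R"
    unfolding integral_std_normal_Suc[OF poly_growth_power[OF poly_growth_quadratic]] step hermite_moments
    using iP2 iQ2 by (simp add: prob_space p_def q_def R_def)
  have 4: "(\<integral>z. (quadratic (Suc d) A b c z)^4 \<partial>std_normal_Rd (Suc d))
    = P4 + 6 * PQ + 12 * R * p + 24 * X + 32 * Y + 3 * Q4 + 60 * R * q + 60 * R\<^sup>2"
    unfolding integral_std_normal_Suc[OF poly_growth_power[OF poly_growth_quadratic]] step hermite_moments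
    using iP iP2 iP4 iQ2 iQ4 iPQ iX
    by (simp add: prob_space p_def q_def R_def P4_def Q4_def PQ_def X_def Y_def)
  have bP: "P4 \<le> 48 * p\<^sup>2" unfolding P4_def p_def using Suc.prems by (intro Suc.IH) auto
  have bQ: "Q4 \<le> 3 * q\<^sup>2" unfolding Q4_def q_def by (rule affine_fourth_moment)
  have bPQ: "PQ \<le> 12 * p * q"
  proof -
    have "PQ\<^sup>2 \<le> P4 * Q4"
      using integral_cauchy_schwarz[of ?N "\<lambda>z. (?P z)\<^sup>2" "\<lambda>z. (?Q z)\<^sup>2"]
      by (simp add: PQ_def P4_def Q4_def power_mult[symmetric] poly_growth_sq_integrable pg)
    also have "\<dots> \<le> (48 * p\<^sup>2) * (3 * q\<^sup>2)"
      using bP bQ by (intro mult_mono) (auto simp: Q4_def)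
    also have "\<dots> = (12 * p * q)\<^sup>2" by (simp add: power_mult_distrib)
    finally show ?thesis by (rule power2_le_imp_le) (use nn in simp)
  qed
  have bX: "X \<le> (p * R + Q4) / 2"
  proof -
    have "X = (\<integral>z. ?r * (?P z * (?Q z)\<^sup>2) \<partial>?N)" by (simp add: X_def)
    also have "\<dots> \<le> (\<integral>z. ((?P z)\<^sup>2 * R + (?Q z)^4) / 2 \<partial>?N)"
    proof (intro integral_mono)
      fix z
      show "?r * (?P z * (?Q z)\<^sup>2) \<le> ((?P z)\<^sup>2 * R + (?Q z)^4) / 2"
        using zero_le_power2[of "?P z * ?r - (?Q z)\<^sup>2"]
        by (simp add: R_def power2_diff power_mult_distrib power_mult[symmetric] algebra_simps)
    qed (use iX iP2 iQ4 in auto)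
    also have "\<dots> = (p * R + Q4) / 2" using iP2 iQ4 by (simp add: p_def Q4_def)
    finally show ?thesis .
  qed
  have bY: "Y \<le> (p * R + R\<^sup>2) / 2"
  proof -
    have "Y = (\<integral>z. ?r^3 * ?P z \<partial>?N)" by (simp add: Y_def)
    also have "\<dots> \<le> (\<integral>z. ((?P z)\<^sup>2 * R + R\<^sup>2) / 2 \<partial>?N)"
    proof (intro integral_mono)
      fix z
      have "0 \<le> (?P z * ?r - ?r\<^sup>2)\<^sup>2" by simp
      then show "?r^3 * ?P z \<le> ((?P z)\<^sup>2 * R + R\<^sup>2) / 2"
        unfolding R_def by (simp add: power2_diff power_mult_distrib power2_eq_square power3_eq_cube algebra_simps)
    qed (use iP iP2 in auto)
    also have "\<dots> = (p * R + R\<^sup>2) / 2" using iP2 by (simp add: p_def prob_space)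
    finally show ?thesis .
  qed
  have "P4 + 6 * PQ + 12 * R * p + 24 * X + 32 * Y + 3 * Q4 + 60 * R * q + 60 * R\<^sup>2
     \<le> 48 * p\<^sup>2 + 72 * (p * q) + 40 * (R * p) + 45 * q\<^sup>2 + 60 * (R * q) + 76 * R\<^sup>2"
    using bP bQ bPQ bX bY by (simp add: algebra_simps)
  also have "\<dots> \<le> 48 * (p + q + 2 * R)\<^sup>2"
    using mult_nonneg_nonneg[OF nn(1,2)] mult_nonneg_nonneg[OF nn(3,1)] mult_nonneg_nonneg[OF nn(3,2)]
      zero_le_power2[of q] zero_le_power2[of R]
    by (simp add: power2_eq_square algebra_simps)
  finally show ?case unfolding 2 4 .
qed

lemma min_one_lower:
  fixes u :: real shows "u\<^sup>2 - u^4 / 4 \<le> min 1 \<bar>u\<bar>"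
proof -
  have e: "u^4 = u\<^sup>2 * u\<^sup>2" by (simp add: power2_eq_square power4_eq_xxxx)
  have "0 \<le> (u\<^sup>2 - 2)\<^sup>2" by simp
  then have 1: "u\<^sup>2 - u^4 / 4 \<le> 1" unfolding power2_diff e by (simp add: power2_eq_square)
  have 2: "u\<^sup>2 - u^4 / 4 \<le> \<bar>u\<bar>" if "\<bar>u\<bar> \<le> 1"
  proof -
    have "\<bar>u\<bar> * \<bar>u\<bar> \<le> \<bar>u\<bar> * 1" using that by (intro mult_left_mono) auto
    then have "u\<^sup>2 \<le> \<bar>u\<bar>" by (simp add: power2_eq_square)
    moreover have "u^4 / 4 \<ge> 0" by simp
    ultimately show ?thesis by linarith
  qed
  show ?thesis using 1 2 by (cases "\<bar>u\<bar> \<le> 1") auto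
qed

text \<open>Integrate \<open>min_one_lower\<close> for \<open>u = t * Y\<close>, with \<open>t\<close> proportional to the inverse of the \<open>L\<^sup>2\<close> norm of \<open>Y\<close>.\<close>

lemma truncated_moment_lower:
  assumes P: "prob_space P" and Y: "Y \<in> borel_measurable P" "integrable P (\<lambda>x. (Y x)\<^sup>2)" "integrable P (\<lambda>x. (Y x)^4)"
    and m4: "(\<integral>x. (Y x)^4 \<partial>P) \<le> 48 * (\<integral>x. (Y x)\<^sup>2 \<partial>P)\<^sup>2"
  shows "min 1 (sqrt (\<integral>x. (Y x)\<^sup>2 \<partial>P)) / 50 \<le> (\<integral>x. min 1 \<bar>Y x\<bar> \<partial>P)"
proof -
  interpret prob_space P by (rule P)
  define s where "s = sqrt (\<integral>x. (Y x)\<^sup>2 \<partial>P)"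
  have s2: "(\<integral>x. (Y x)\<^sup>2 \<partial>P) = s\<^sup>2" by (simp add: s_def)
  have s0: "s \<ge> 0" by (simp add: s_def)
  have mi: "integrable P (\<lambda>x. min 1 \<bar>Y x\<bar>)"
    using Y(1) by (intro integrable_const_bound[of _ 1]) auto
  have nonneg: "(\<integral>x. min 1 \<bar>Y x\<bar> \<partial>P) \<ge> 0" by (intro Bochner_Integration.integral_nonneg) auto
  have scale: "(t\<^sup>2 * s\<^sup>2 - 12 * (t\<^sup>2 * s\<^sup>2)\<^sup>2) \<le> max 1 t * (\<integral>x. min 1 \<bar>Y x\<bar> \<partial>P)" if t: "t > 0" for t
  proof -
    have "t\<^sup>2 * s\<^sup>2 - 12 * (t\<^sup>2 * s\<^sup>2)\<^sup>2 = t\<^sup>2 * s\<^sup>2 - t^4 * (48 * (s\<^sup>2)\<^sup>2) / 4"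
      by (simp add: power_mult_distrib power_mult[symmetric])
    also have "\<dots> \<le> t\<^sup>2 * s\<^sup>2 - t^4 * (\<integral>x. (Y x)^4 \<partial>P) / 4"
      using m4 t unfolding s2 by (intro diff_left_mono divide_right_mono mult_left_mono) auto
    also have "\<dots> = (\<integral>x. (t * Y x)\<^sup>2 - (t * Y x)^4 / 4 \<partial>P)"
      using Y s2 by (simp add: power_mult_distrib)
    also have "\<dots> \<le> (\<integral>x. max 1 t * min 1 \<bar>Y x\<bar> \<partial>P)"
    proof (intro integral_mono)
      fix x
      have "(t * Y x)\<^sup>2 - (t * Y x)^4 / 4 \<le> min 1 \<bar>t * Y x\<bar>" by (rule min_one_lower)
      also have "\<dots> \<le> max 1 t * min 1 \<bar>Y x\<bar>"
      proof (cases "\<bar>Y x\<bar> \<le> 1")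
        case True
        have "t * \<bar>Y x\<bar> \<le> max 1 t * \<bar>Y x\<bar>" by (intro mult_right_mono) auto
        then show ?thesis using True t by (simp add: abs_mult min_def)
      next
        case False
        have "min 1 \<bar>t * Y x\<bar> \<le> 1" "1 \<le> max 1 t" by auto
        then have "min 1 \<bar>t * Y x\<bar> \<le> max 1 t" by (rule order_trans)
        then show ?thesis using False by (simp add: min_def[of 1 "\<bar>Y x\<bar>"])
      qed
      finally show "(t * Y x)\<^sup>2 - (t * Y x)^4 / 4 \<le> max 1 t * min 1 \<bar>Y x\<bar>" .
    qed (use mi Y in \<open>auto simp: power_mult_distrib\<close>)
    finally show ?thesis using mi by simp
  qed
  have "min 1 s / 50 \<le> (\<integral>x. min 1 \<bar>Y x\<bar> \<partial>P)"
  proof (cases "s = 0")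
    case True
    then show ?thesis using nonneg by simp
  next
    case False
    then have s: "s > 0" using s0 by simp
    \<comment> \<open>With \<open>w = t\<^sup>2 * s\<^sup>2 = 1 / 25\<close>, the lower bound \<open>w - 12 * w\<^sup>2\<close> from \<open>scale\<close> is at least \<open>1 / 50\<close>.\<close>
    define t where "t = 1 / (5 * s)"
    have ts: "t\<^sup>2 * s\<^sup>2 = 1 / 25" using s by (simp add: t_def power_divide power_mult_distrib)
    have "1 / 50 \<le> max 1 t * (\<integral>x. min 1 \<bar>Y x\<bar> \<partial>P)"
      using scale[of t] s unfolding ts by (simp add: t_def power2_eq_square)
    moreover have "max 1 t * min 1 s \<le> 1"
      using s by (auto simp: t_def max_def min_def field_simps)
    ultimately show ?thesis
    proof -
      let ?E = "\<integral>x. min 1 \<bar>Y x\<bar> \<partial>P"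
      assume 1: "1 / 50 \<le> max 1 t * ?E" and 2: "max 1 t * min 1 s \<le> 1"
      have "min 1 s * (1 / 50) \<le> min 1 s * (max 1 t * ?E)" using s by (intro mult_left_mono 1) auto
      also have "\<dots> = (max 1 t * min 1 s) * ?E" by simp
      also have "\<dots> \<le> 1 * ?E" by (intro mult_right_mono 2 nonneg)
      finally show ?thesis by simp
    qed
  qed
  then show ?thesis by (simp add: s_def)
qed

section \<open>Whitening a multivariate normal\<close>

text \<open>A Cholesky factorization that eliminates the last variable first, so that the factor is lower triangular and row
  \<open>i\<close> of \<open>R\<close> involves the coordinates up to \<open>i\<close>, as the coordinate-wise change of variables requires.\<close>

lemma pd_forms_sum_of_squares:
  fixes K :: "nat \<Rightarrow> nat \<Rightarrow> real"
  assumes "\<And>i j. i < d \<Longrightarrow> j < d \<Longrightarrow> K i j = K j i"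
    and "\<And>v. (\<exists>i<d. v i \<noteq> 0) \<Longrightarrow> (\<Sum>i<d. \<Sum>j<d. v i * K i j * v j) > 0"
  shows "\<exists>R. (\<forall>i<d. R i i > 0) \<and> (\<forall>i j. i < j \<longrightarrow> R i j = 0) \<and>
    (\<forall>i<d. \<forall>j<d. K i j = (\<Sum>k<d. R k i * R k j))"
  using assms
proof (induction d arbitrary: K)
  case 0
  then show ?case by (intro exI[of _ "\<lambda>_ _. 0"]) auto
next
  case (Suc d)
  define \<kappa> where "\<kappa> = K d d"
  have form: "(\<Sum>i<Suc d. \<Sum>j<Suc d. v i * K i j * v j)
     = (\<Sum>i<d. \<Sum>j<d. v i * K i j * v j) + 2 * v d * (\<Sum>i<d. K i d * v i) + \<kappa> * (v d)\<^sup>2" for v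
  proof -
    have "(\<Sum>i<Suc d. \<Sum>j<Suc d. v i * K i j * v j)
      = (\<Sum>i<d. \<Sum>j<d. v i * K i j * v j) + (\<Sum>i<d. v i * K i d * v d) + (\<Sum>j<d. v d * K d j * v j) + v d * K d d * v d"
      by (simp add: sum.distrib)
    also have "(\<Sum>j<d. v d * K d j * v j) = (\<Sum>i<d. v i * K i d * v d)"
      using Suc.prems(1) by (intro sum.cong) auto
    also have "(\<Sum>i<d. v i * K i d * v d) = v d * (\<Sum>i<d. K i d * v i)"
      by (simp add: sum_distrib_left mult_ac)
    finally show ?thesis by (simp add: \<kappa>_def power2_eq_square)
  qed
  have \<kappa>: "\<kappa> > 0"
    using Suc.prems(2)[of "\<lambda>i. if i = d then 1 else 0"] unfolding form by auto
  \<comment> \<open>The Schur complement of the last diagonal entry.\<close>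
  define K' where "K' i j = K i j - K i d * K j d / \<kappa>" for i j
  have sym': "K' i j = K' j i" if "i < d" "j < d" for i j using Suc.prems(1)[of i j] that by (simp add: K'_def)
  have pd': "(\<Sum>i<d. \<Sum>j<d. v i * K' i j * v j) > 0" if "\<exists>i<d. v i \<noteq> 0" for v
  proof -
    define s where "s = (\<Sum>i<d. K i d * v i)"
    \<comment> \<open>Extend \<open>v\<close> by the last coordinate that minimizes the form of \<open>K\<close>; the minimum is the form of \<open>K'\<close>.\<close>
    define w where "w i = (if i = d then - s / \<kappa> else v i)" for i
    have w: "\<exists>i<Suc d. w i \<noteq> 0"
    proof -
      from that obtain i where "i < d" "v i \<noteq> 0" by auto
      then show ?thesis by (intro exI[of _ i]) (auto simp: w_def)
    qed
    have "0 < (\<Sum>i<Suc d. \<Sum>j<Suc d. w i * K i j * w j)" by (rule Suc.prems(2)[OF w])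
    also have "\<dots> = (\<Sum>i<d. \<Sum>j<d. v i * K i j * v j) + 2 * (- s / \<kappa>) * s + \<kappa> * (- s / \<kappa>)\<^sup>2"
      unfolding form by (simp add: w_def s_def)
    also have "\<dots> = (\<Sum>i<d. \<Sum>j<d. v i * K i j * v j) - s * s / \<kappa>"
      using \<kappa> by (simp add: power2_eq_square field_simps)
    also have "s * s / \<kappa> = (\<Sum>i<d. \<Sum>j<d. v i * (K i d * K j d / \<kappa>) * v j)"
      by (simp add: s_def sum_product sum_divide_distrib mult_ac)
    finally show ?thesis by (simp add: K'_def right_diff_distrib left_diff_distrib sum_subtractf)
  qed
  have "\<exists>R. (\<forall>i<d. R i i > 0) \<and> (\<forall>i j. i < j \<longrightarrow> R i j = 0) \<and>
      (\<forall>i<d. \<forall>j<d. K' i j = (\<Sum>k<d. R k i * R k j))"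
    by (rule Suc.IH[OF sym' pd'])
  then obtain R' where "(\<forall>i<d. R' i i > 0) \<and> (\<forall>i j. i < j \<longrightarrow> R' i j = 0) \<and>
      (\<forall>i<d. \<forall>j<d. K' i j = (\<Sum>k<d. R' k i * R' k j))" ..
  then have R': "\<And>i. i < d \<Longrightarrow> R' i i > 0" "\<And>i j. i < j \<Longrightarrow> R' i j = 0"
    "\<And>i j. i < d \<Longrightarrow> j < d \<Longrightarrow> K' i j = (\<Sum>k<d. R' k i * R' k j)"
    by simp_all
  define R where "R k i = (if k < d then R' k i else if k = d \<and> i \<le> d then K i d / sqrt \<kappa> else 0)" for k i
  have "K i j = (\<Sum>k<Suc d. R k i * R k j)" if ij: "i < Suc d" "j < Suc d" for i j
  proof -
    have "(\<Sum>k<Suc d. R k i * R k j) = (\<Sum>k<d. R' k i * R' k j) + K i d * K j d / \<kappa>"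
      using ij \<kappa> by (simp add: R_def)
    also have "\<dots> = K i j"
    proof (cases "i < d \<and> j < d")
      case True
      then show ?thesis using R'(3)[of i j] by (simp add: K'_def)
    next
      case False
      then have "(\<Sum>k<d. R' k i * R' k j) = 0" using ij R'(2) by (intro sum.neutral) auto
      moreover have "K i d * K j d / \<kappa> = K i j"
        using False ij \<kappa> Suc.prems(1)[of i j] by (auto simp: \<kappa>_def less_Suc_eq)
      ultimately show ?thesis by simp
    qed
    finally show ?thesis by simp
  qed
  moreover have "R i i > 0" if "i < Suc d" for i
    using that R'(1) \<kappa> by (auto simp: R_def \<kappa>_def less_Suc_eq)
  moreover have "R i j = 0" if "i < j" for i j using that R'(2) by (auto simp: R_def)
  ultimately show ?case by (intro exI[of _ R]) auto
qed

interpretation lborel_prod: product_sigma_finite "\<lambda>_::nat. lborel :: real measure"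
  by unfold_locales

lemma sigma_finite_lebesgue_Rd: "sigma_finite_measure (lebesgue_Rd d)"
  unfolding lebesgue_Rd_def by (rule lborel_prod.sigma_finite) simp

definition triangular_map :: "nat \<Rightarrow> (nat \<Rightarrow> nat \<Rightarrow> real) \<Rightarrow> (nat \<Rightarrow> real) \<Rightarrow> (nat \<Rightarrow> real) \<Rightarrow> nat \<Rightarrow> real" where
  "triangular_map d R t x = (\<lambda>i\<in>{..<d}. (\<Sum>j\<le>i. R i j * x j) + t i)"

lemma triangular_map_measurable: "triangular_map d R t \<in> lebesgue_Rd d \<rightarrow>\<^sub>M lebesgue_Rd d"
  unfolding triangular_map_def[abs_def] lebesgue_Rd_def
proof (intro measurable_restrict)
  fix i assume "i \<in> {..<d}"
  then have [measurable]: "(\<lambda>x. x j) \<in> borel_measurable (Pi\<^sub>M {..<d} (\<lambda>_. lborel :: real measure))" if "j \<le> i" for j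
    using that measurable_component_singleton[of j "{..<d}" "\<lambda>_. lborel :: real measure"] by (simp cong: measurable_cong_sets)
  have "(\<lambda>x. (\<Sum>j\<le>i. R i j * x j) + t i) \<in> borel_measurable (Pi\<^sub>M {..<d} (\<lambda>_. lborel :: real measure))"
    by (intro borel_measurable_add borel_measurable_sum borel_measurable_times) auto
  then show "(\<lambda>x. (\<Sum>j\<le>i. R i j * x j) + t i) \<in> Pi\<^sub>M {..<d} (\<lambda>_. lborel) \<rightarrow>\<^sub>M lborel"
    by (simp cong: measurable_cong_sets)
qed

text \<open>Integrating over the last coordinate first, each step is an affine substitution on the real line.\<close>

lemma nn_integral_triangular_map:
  assumes "g \<in> borel_measurable (lebesgue_Rd d)" "\<And>i. i < d \<Longrightarrow> R i i > 0"
  shows "(\<integral>\<^sup>+ x. g x \<partial>lebesgue_Rd d) = ennreal (\<Prod>i<d. R i i) * (\<integral>\<^sup>+ x. g (triangular_map d R t x) \<partial>lebesgue_Rd d)"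
  using assms
proof (induction d arbitrary: g)
  case 0
  have "triangular_map 0 R t x = x" if "x \<in> space (lebesgue_Rd 0)" for x
    using that by (auto simp: triangular_map_def lebesgue_Rd_def space_PiM restrict_def)
  then show ?case by (simp cong: nn_integral_cong)
next
  case (Suc d)
  note gm = Suc.prems(1)
  have ins: "lebesgue_Rd (Suc d) = Pi\<^sub>M (insert d {..<d}) (\<lambda>_. lborel)"
    by (simp add: lebesgue_Rd_def lessThan_Suc)
  have fub: "(\<integral>\<^sup>+ x. h x \<partial>lebesgue_Rd (Suc d)) = (\<integral>\<^sup>+ x. \<integral>\<^sup>+ s. h (x(d := s)) \<partial>lborel \<partial>lebesgue_Rd d)"
    if "h \<in> borel_measurable (lebesgue_Rd (Suc d))" for h :: "(nat \<Rightarrow> real) \<Rightarrow> ennreal"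
    using that unfolding ins lebesgue_Rd_def[of d]
    by (intro lborel_prod.product_nn_integral_insert) auto
  define G where "G y = (\<integral>\<^sup>+ s. g (y(d := s)) \<partial>lborel)" for y
  have upd: "(\<lambda>(y, s). y(d := s)) \<in> lebesgue_Rd d \<Otimes>\<^sub>M lborel \<rightarrow>\<^sub>M lebesgue_Rd (Suc d)"
    unfolding ins lebesgue_Rd_def[of d] by (rule measurable_add_dim)
  have gu: "(\<lambda>(y, s). g (y(d := s))) \<in> borel_measurable (lebesgue_Rd d \<Otimes>\<^sub>M lborel)"
    using measurable_compose[OF upd gm] by (simp add: case_prod_unfold del: fun_upd_apply)
  have Gm: "G \<in> borel_measurable (lebesgue_Rd d)"
    unfolding G_def[abs_def] by (rule lborel.borel_measurable_nn_integral[OF gu])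
  have r: "R d d > 0" using Suc.prems(2) by simp
  have inner: "(\<integral>\<^sup>+ s. g (triangular_map (Suc d) R t (x(d := s))) \<partial>lborel) * ennreal (R d d)
      = G (triangular_map d R t x)" if x: "x \<in> space (lebesgue_Rd d)" for x
  proof -
    let ?y = "triangular_map d R t x"
    define u where "u = (\<Sum>j<d. R d j * x j) + t d"
    have e: "triangular_map (Suc d) R t (x(d := s)) = ?y(d := u + R d d * s)" for s
    proof
      fix i
      have "(\<Sum>j\<le>i. R i j * (x(d := s)) j) = (\<Sum>j\<le>i. R i j * x j)" if "i < d"
        using that by (intro sum.cong) auto
      moreover have "(\<Sum>j\<le>d. R d j * (x(d := s)) j) = (\<Sum>j<d. R d j * x j) + R d d * s"
        by (simp add: lessThan_Suc_atMost[symmetric])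
      ultimately show "triangular_map (Suc d) R t (x(d := s)) i = (?y(d := u + R d d * s)) i"
        by (auto simp: triangular_map_def u_def)
    qed
    have y: "?y \<in> space (lebesgue_Rd d)" using measurable_space[OF triangular_map_measurable x] .
    have gy: "(\<lambda>s. g (?y(d := s))) \<in> borel_measurable borel"
      using measurable_Pair2[OF gu y] by simp
    have "G ?y = ennreal \<bar>R d d\<bar> * (\<integral>\<^sup>+ s. g (?y(d := u + R d d * s)) \<partial>lborel)"
      unfolding G_def using r by (intro nn_integral_real_affine gy) auto
    then show ?thesis using r by (simp add: e mult.commute)
  qed
  have Tm: "(\<lambda>x. g (triangular_map (Suc d) R t x)) \<in> borel_measurable (lebesgue_Rd (Suc d))"
    by (rule measurable_compose[OF triangular_map_measurable gm])
  have Tu: "(\<lambda>(x, s). g (triangular_map (Suc d) R t (x(d := s)))) \<in> borel_measurable (lebesgue_Rd d \<Otimes>\<^sub>M lborel)"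
    using measurable_compose[OF upd Tm] by (simp add: case_prod_unfold del: fun_upd_apply)
  have "(\<integral>\<^sup>+ x. g x \<partial>lebesgue_Rd (Suc d)) = (\<integral>\<^sup>+ y. G y \<partial>lebesgue_Rd d)"
    unfolding fub[OF gm] G_def ..
  also have "\<dots> = ennreal (\<Prod>i<d. R i i) * (\<integral>\<^sup>+ x. G (triangular_map d R t x) \<partial>lebesgue_Rd d)"
    using Suc.prems(2) by (intro Suc.IH Gm) auto
  also have "(\<integral>\<^sup>+ x. G (triangular_map d R t x) \<partial>lebesgue_Rd d)
     = (\<integral>\<^sup>+ x. (\<integral>\<^sup>+ s. g (triangular_map (Suc d) R t (x(d := s))) \<partial>lborel) * ennreal (R d d) \<partial>lebesgue_Rd d)"
    by (intro nn_integral_cong) (simp add: inner)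
  also have "\<dots> = (\<integral>\<^sup>+ x. g (triangular_map (Suc d) R t x) \<partial>lebesgue_Rd (Suc d)) * ennreal (R d d)"
    unfolding fub[OF Tm] by (rule nn_integral_multc) (rule lborel.borel_measurable_nn_integral[OF Tu])
  also have "ennreal (\<Prod>i<d. R i i) * ((\<integral>\<^sup>+ x. g (triangular_map (Suc d) R t x) \<partial>lebesgue_Rd (Suc d)) * ennreal (R d d))
     = ennreal (\<Prod>i<Suc d. R i i) * (\<integral>\<^sup>+ x. g (triangular_map (Suc d) R t x) \<partial>lebesgue_Rd (Suc d))"
  proof -
    have "(\<Prod>i<d. R i i) \<ge> 0" using Suc.prems(2) by (intro prod_nonneg) (auto intro: less_imp_le)
    then show ?thesis using r by (simp add: ennreal_mult mult_ac)
  qed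
  finally show ?case .
qed

lemma mat_inv_props:
  assumes S: "S \<in> pos_def_mats d"
  shows "mat_inv S \<in> carrier_mat d d" "S * mat_inv S = 1\<^sub>m d" "mat_inv S * S = 1\<^sub>m d"
proof -
  have c: "S \<in> carrier_mat d d" using S by (simp add: pos_def_mats_def)
  have "Determinant.det S \<noteq> 0"
  proof
    assume "Determinant.det S = 0"
    then obtain v where v: "v \<in> carrier_vec d" "v \<noteq> 0\<^sub>v d" "S *\<^sub>v v = 0\<^sub>v d"
      using det_0_iff_vec_prod_zero[OF c] by auto
    then have "scalar_prod v (S *\<^sub>v v) = 0" by simp
    then show False using S v by (auto simp: pos_def_mats_def)
  qed
  then obtain B where B: "mat_inverse S = Some B"
    using mat_inverse(1)[OF c, of "()"] det_non_zero_imp_unit[OF c, of "()"]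
    by (cases "mat_inverse S") simp_all
  then show "mat_inv S \<in> carrier_mat d d" "S * mat_inv S = 1\<^sub>m d" "mat_inv S * S = 1\<^sub>m d"
    using mat_inverse(2)[OF c B] by auto
qed

lemma inverse_unique:
  fixes A :: "real mat"
  assumes "A \<in> carrier_mat d d" "B \<in> carrier_mat d d" "C \<in> carrier_mat d d" "A * B = 1\<^sub>m d" "C * A = 1\<^sub>m d"
  shows "B = C"
proof -
  have "B = (C * A) * B" using assms by simp
  also have "\<dots> = C * (A * B)" using assms by (intro assoc_mult_mat) auto
  also have "\<dots> = C" using assms by simp
  finally show ?thesis .
qed

lemma mat_inv_pos_def:
  assumes S: "S \<in> pos_def_mats d"
  shows "mat_inv S \<in> pos_def_mats d" "mat_inv (mat_inv S) = S"
proof -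
  let ?K = "mat_inv S"
  note K = mat_inv_props[OF S]
  have c: "S \<in> carrier_mat d d" and sym: "transpose_mat S = S" using S by (auto simp: pos_def_mats_def)
  have "transpose_mat (S * ?K) = transpose_mat ?K * S" using transpose_mult[OF c K(1)] sym by simp
  then have "transpose_mat ?K * S = 1\<^sub>m d" using K(2) by simp
  then have symK: "transpose_mat ?K = ?K" using inverse_unique[OF c K(1) _ K(2), of "transpose_mat ?K"] K(1) by simp
  have "scalar_prod v (?K *\<^sub>v v) > 0" if v: "v \<in> carrier_vec d" "v \<noteq> 0\<^sub>v d" for v
  proof -
    let ?w = "?K *\<^sub>v v"
    have w: "?w \<in> carrier_vec d" using K(1) v by simp
    have Sw: "S *\<^sub>v ?w = v" using assoc_mult_mat_vec[OF c K(1) v(1)] K(2) v by simp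
    have "S *\<^sub>v 0\<^sub>v d = 0\<^sub>v d" using c by (intro eq_vecI) auto
    then have "?w \<noteq> 0\<^sub>v d" using Sw v(2) by metis
    then have "scalar_prod ?w (S *\<^sub>v ?w) > 0" using S w by (auto simp: pos_def_mats_def)
    then show ?thesis unfolding Sw using comm_scalar_prod[OF w v(1)] by simp
  qed
  then show pd: "?K \<in> pos_def_mats d" using K(1) symK by (auto simp: pos_def_mats_def)
  show "mat_inv ?K = S"
    by (rule inverse_unique[OF K(1) mat_inv_props(1)[OF pd] c mat_inv_props(2)[OF pd] K(2)])
qed

lemma pos_def_factor:
  assumes K: "K \<in> pos_def_mats d"
  obtains R where "R \<in> carrier_mat d d" "\<And>i. i < d \<Longrightarrow> R $$ (i, i) > 0"
    "\<And>i j. i < j \<Longrightarrow> j < d \<Longrightarrow> R $$ (i, j) = 0" "K = transpose_mat R * R"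
proof -
  have c: "K \<in> carrier_mat d d" and sym: "transpose_mat K = K" using K by (auto simp: pos_def_mats_def)
  have s: "K $$ (i, j) = K $$ (j, i)" if "i < d" "j < d" for i j
    using that c arg_cong[OF sym, of "\<lambda>M. M $$ (i, j)"] by simp
  have p: "(\<Sum>i<d. \<Sum>j<d. v i * K $$ (i, j) * v j) > 0" if "\<exists>i<d. v i \<noteq> 0" for v
  proof -
    let ?v = "Matrix.vec d v"
    have "?v \<noteq> 0\<^sub>v d"
    proof
      assume e: "?v = 0\<^sub>v d"
      from that obtain i where i: "i < d" "v i \<noteq> 0" by auto
      then show False using arg_cong[OF e, of "\<lambda>u. vec_index u i"] by simp
    qed
    then have "0 < scalar_prod ?v (K *\<^sub>v ?v)" using K by (auto simp: pos_def_mats_def)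
    also have "\<dots> = (\<Sum>i<d. \<Sum>j<d. v i * K $$ (i, j) * v j)"
      using c by (simp add: scalar_prod_def sum_distrib_left atLeast0LessThan mult_ac)
    finally show ?thesis .
  qed
  have "\<exists>r. (\<forall>i<d. r i i > 0) \<and> (\<forall>i j. i < j \<longrightarrow> r i j = 0) \<and>
      (\<forall>i<d. \<forall>j<d. K $$ (i, j) = (\<Sum>k<d. r k i * r k j))"
    by (rule pd_forms_sum_of_squares[OF s p])
  then obtain r where "(\<forall>i<d. r i i > 0) \<and> (\<forall>i j. i < j \<longrightarrow> r i j = 0) \<and>
      (\<forall>i<d. \<forall>j<d. K $$ (i, j) = (\<Sum>k<d. r k i * r k j))" ..
  then have r: "\<And>i. i < d \<Longrightarrow> r i i > 0" "\<And>i j. i < j \<Longrightarrow> r i j = 0"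
    "\<And>i j. i < d \<Longrightarrow> j < d \<Longrightarrow> K $$ (i, j) = (\<Sum>k<d. r k i * r k j)"
    by simp_all
  let ?R = "Matrix.mat d d (\<lambda>(i, j). r i j)"
  show ?thesis
  proof (rule that[of ?R])
    show "K = transpose_mat ?R * ?R"
      using c by (intro eq_matI) (auto simp: r(3) scalar_prod_def atLeast0LessThan)
  qed (use r in auto)
qed

lemma std_normal_Rd_density:
  "std_normal_Rd d = density (lebesgue_Rd d) (\<lambda>z. ennreal (sample_density d std_normal_density z))"
proof -
  have "positive_density lborel std_normal_density"
    unfolding positive_density_def
  proof (intro conjI allI)
    interpret prob_space "density lborel std_normal_density" by (rule prob_space_normal_density) simp
    show "(\<integral>\<^sup>+ x. ennreal (std_normal_density x) \<partial>lborel) = 1"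
      using emeasure_space_1 by (simp add: emeasure_density cong: nn_integral_cong)
  qed (auto intro: normal_density_pos)
  from iid_samples_eq_density[OF sigma_finite_lborel this, of d]
  show ?thesis by (simp add: iid_samples_def std_normal_Rd_def std_normal_def lebesgue_Rd_def)
qed

lemma std_normal_density_prod:
  "sample_density d std_normal_density z = exp (- (1/2) * (\<Sum>i<d. (z i)\<^sup>2)) / (2 * pi) powr (real d / 2)"
proof -
  have "sample_density d std_normal_density z = (\<Prod>i<d. exp (- (z i)\<^sup>2 / 2) / sqrt (2 * pi))"
    unfolding sample_density_def std_normal_density_def by simp
  also have "\<dots> = exp (\<Sum>i<d. - (z i)\<^sup>2 / 2) / sqrt (2 * pi) ^ d"
    by (simp add: prod_dividef exp_sum)
  also have "sqrt (2 * pi) ^ d = (2 * pi) powr (real d / 2)"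
    by (simp add: powr_half_sqrt[symmetric] powr_realpow[symmetric] powr_powr)
  finally show ?thesis by (simp add: sum_distrib_left sum_negf)
qed

definition affine_image :: "nat \<Rightarrow> real vec \<Rightarrow> real mat \<Rightarrow> (nat \<Rightarrow> real) \<Rightarrow> nat \<Rightarrow> real" where
  "affine_image d \<mu> B z = (\<lambda>i\<in>{..<d}. vec_index (\<mu> + B *\<^sub>v Matrix.vec d z) i)"

lemma affine_image_measurable:
  assumes "\<mu> \<in> carrier_vec d" "B \<in> carrier_mat d d"
  shows "affine_image d \<mu> B \<in> lebesgue_Rd d \<rightarrow>\<^sub>M lebesgue_Rd d"
  unfolding affine_image_def[abs_def] lebesgue_Rd_def
proof (intro measurable_restrict)
  fix i assume i: "i \<in> {..<d}"
  have [measurable]: "(\<lambda>x. x j) \<in> borel_measurable (Pi\<^sub>M {..<d} (\<lambda>_. lborel :: real measure))" if "j < d" for j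
    using that measurable_component_singleton[of j "{..<d}" "\<lambda>_. lborel :: real measure"] by (simp cong: measurable_cong_sets)
  have "vec_index (\<mu> + B *\<^sub>v Matrix.vec d z) i = vec_index \<mu> i + (\<Sum>j<d. B $$ (i, j) * z j)" for z
    using i assms by (simp add: scalar_prod_def atLeast0LessThan)
  moreover have "(\<lambda>z. vec_index \<mu> i + (\<Sum>j<d. B $$ (i, j) * z j)) \<in> borel_measurable (Pi\<^sub>M {..<d} (\<lambda>_. lborel :: real measure))"
    by (intro borel_measurable_add borel_measurable_sum borel_measurable_times) auto
  ultimately show "(\<lambda>z. vec_index (\<mu> + B *\<^sub>v Matrix.vec d z) i) \<in> Pi\<^sub>M {..<d} (\<lambda>_. lborel) \<rightarrow>\<^sub>M lborel"
    by (simp cong: measurable_cong_sets)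
qed

text \<open>The matrix \<open>R\<close> maps \<open>x - \<mu>\<close> to standard normal variables, and \<open>B = R\<^sup>-\<^sup>1\<close> maps them back.\<close>

definition whitens :: "nat \<Rightarrow> real vec \<Rightarrow> real mat \<Rightarrow> real mat \<Rightarrow> real mat \<Rightarrow> bool" where
  "whitens d \<mu> S R B \<longleftrightarrow> R \<in> carrier_mat d d \<and> B \<in> carrier_mat d d \<and> R * B = 1\<^sub>m d \<and> B * R = 1\<^sub>m d \<and>
     mat_inv S = transpose_mat R * R \<and> Determinant.det S > 0 \<and>
     density (lebesgue_Rd d) (mvn_density d \<mu> S) = distr (std_normal_Rd d) (lebesgue_Rd d) (affine_image d \<mu> B)"

lemma whitensD:
  assumes "whitens d \<mu> S R B"
  shows "R \<in> carrier_mat d d" "B \<in> carrier_mat d d" "R * B = 1\<^sub>m d" "B * R = 1\<^sub>m d"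
    "mat_inv S = transpose_mat R * R" "Determinant.det S > 0"
    "density (lebesgue_Rd d) (mvn_density d \<mu> S) = distr (std_normal_Rd d) (lebesgue_Rd d) (affine_image d \<mu> B)"
  using assms by (simp_all add: whitens_def)

lemma quad_form_whitened:
  fixes R :: "real mat"
  assumes "R \<in> carrier_mat d d" "y \<in> carrier_vec d"
  shows "scalar_prod y ((transpose_mat R * R) *\<^sub>v y) = scalar_prod (R *\<^sub>v y) (R *\<^sub>v y)"
proof -
  have "(transpose_mat R * R) *\<^sub>v y = transpose_mat R *\<^sub>v (R *\<^sub>v y)"
    using assms by (intro assoc_mult_mat_vec) auto
  then show ?thesis using transpose_vec_mult_scalar[of R d d y "R *\<^sub>v y"] assms
      comm_scalar_prod[of y d "transpose_mat R *\<^sub>v (R *\<^sub>v y)"] by simp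
qed

text \<open>The triangular map \<open>x \<mapsto> R (x - \<mu>)\<close> turns the quadratic form in the exponent into a sum of squares, and its Jacobian
  \<open>det R\<close> equals \<open>1 / sqrt (det S)\<close>.\<close>

theorem mvn_whitening:
  assumes S: "S \<in> pos_def_mats d" and \<mu>: "\<mu> \<in> carrier_vec d"
  obtains R B where "whitens d \<mu> S R B" "mvn_density d \<mu> S \<in> borel_measurable (lebesgue_Rd d)"
proof -
  note K = mat_inv_props[OF S]
  have c: "S \<in> carrier_mat d d" using S by (simp add: pos_def_mats_def)
  obtain R where R: "R \<in> carrier_mat d d" "\<And>i. i < d \<Longrightarrow> R $$ (i, i) > 0"
    "\<And>i j. i < j \<Longrightarrow> j < d \<Longrightarrow> R $$ (i, j) = 0" "mat_inv S = transpose_mat R * R"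
    using pos_def_factor[OF mat_inv_pos_def(1)[OF S]] by blast
  have Rt: "transpose_mat R \<in> carrier_mat d d" using R(1) by simp
  define B where "B = S * transpose_mat R"
  have Bc: "B \<in> carrier_mat d d" using c Rt by (simp add: B_def)
  have BR: "B * R = 1\<^sub>m d" unfolding B_def using assoc_mult_mat[OF c Rt R(1)] R(4) K(2) by simp
  have RB: "R * B = 1\<^sub>m d" using mat_mult_left_right_inverse[OF Bc R(1) BR] .
  define \<delta> where "\<delta> = (\<Prod>i<d. R $$ (i, i))"
  have \<delta>: "\<delta> > 0" using R(2) by (auto simp: \<delta>_def intro: prod_pos)
  have detR: "Determinant.det R = \<delta>"
    using det_lower_triangular[OF R(3) R(1)] R(1) by (simp add: prod_list_diag_prod \<delta>_def atLeast0LessThan)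
  have "Determinant.det S * Determinant.det (mat_inv S) = 1"
    using det_mult[OF c K(1)] K(2) by simp
  then have detS: "Determinant.det S * \<delta>\<^sup>2 = 1"
    unfolding R(4) det_mult[OF Rt R(1)] det_transpose[OF R(1)] detR by (simp add: power2_eq_square)
  then have dS: "Determinant.det S = 1 / \<delta>\<^sup>2" using \<delta> by (simp add: field_simps)
  then have sS: "sqrt (Determinant.det S) = 1 / \<delta>" using \<delta> by (simp add: real_sqrt_divide)
  let ?r = "\<lambda>i j. R $$ (i, j)"
  define t where "t i = - vec_index (R *\<^sub>v \<mu>) i" for i
  define T where "T = triangular_map d ?r t"
  have T: "T x i = vec_index (R *\<^sub>v (Matrix.vec d x - \<mu>)) i" if i: "i < d" for x i
  proof -
    have "R *\<^sub>v (Matrix.vec d x - \<mu>) = R *\<^sub>v Matrix.vec d x - R *\<^sub>v \<mu>"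
      using R(1) \<mu> by (intro mult_minus_distrib_mat_vec) auto
    then have "vec_index (R *\<^sub>v (Matrix.vec d x - \<mu>)) i = (\<Sum>j<d. R $$ (i, j) * x j) + t i"
      using i R(1) \<mu> by (simp add: t_def scalar_prod_def atLeast0LessThan)
    also have "(\<Sum>j<d. R $$ (i, j) * x j) = (\<Sum>j\<le>i. R $$ (i, j) * x j)"
      using i R(3) by (intro sum.mono_neutral_right) auto
    finally show ?thesis using i by (simp add: T_def triangular_map_def)
  qed
  have Tv: "Matrix.vec d (T x) = R *\<^sub>v (Matrix.vec d x - \<mu>)" for x
    using R(1) by (intro eq_vecI) (auto simp: T)
  have inv: "affine_image d \<mu> B (T x) = x" if x: "x \<in> space (lebesgue_Rd d)" for x
  proof -
    have "B *\<^sub>v Matrix.vec d (T x) = (B * R) *\<^sub>v (Matrix.vec d x - \<mu>)"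
      unfolding Tv using Bc R(1) \<mu> by (intro assoc_mult_mat_vec[symmetric]) auto
    also have "\<dots> = Matrix.vec d x - \<mu>" using \<mu> by (simp add: BR)
    finally have "\<mu> + B *\<^sub>v Matrix.vec d (T x) = Matrix.vec d x" using \<mu> by (intro eq_vecI) auto
    then have "affine_image d \<mu> B (T x) = (\<lambda>i\<in>{..<d}. x i)" by (auto simp: affine_image_def restrict_def)
    then show ?thesis using x by (auto simp: lebesgue_Rd_def space_PiM PiE_iff extensional_def restrict_def)
  qed
  have dens: "mvn_density d \<mu> S x = \<delta> * sample_density d std_normal_density (T x)" for x
  proof -
    have y: "Matrix.vec d x - \<mu> \<in> carrier_vec d" using \<mu> by simp
    have "scalar_prod (R *\<^sub>v (Matrix.vec d x - \<mu>)) (R *\<^sub>v (Matrix.vec d x - \<mu>)) = (\<Sum>i<d. (T x i)\<^sup>2)"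
      unfolding Tv[symmetric] by (simp add: scalar_prod_def atLeast0LessThan power2_eq_square)
    then show ?thesis unfolding mvn_density_def R(4) quad_form_whitened[OF R(1) y] sS std_normal_density_prod
      using \<delta> by simp
  qed
  have Tm: "T \<in> lebesgue_Rd d \<rightarrow>\<^sub>M lebesgue_Rd d" unfolding T_def by (rule triangular_map_measurable)
  have \<phi>m: "sample_density d std_normal_density \<in> borel_measurable (lebesgue_Rd d)"
    unfolding lebesgue_Rd_def by (rule sample_density_measurable) simp
  have fm: "mvn_density d \<mu> S \<in> borel_measurable (lebesgue_Rd d)"
    unfolding dens[abs_def] using measurable_compose[OF Tm \<phi>m] by simp
  note Bm = affine_image_measurable[OF \<mu> Bc]
  have setsN: "sets (std_normal_Rd d) = sets (lebesgue_Rd d)" by (simp add: std_normal_Rd_density)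
  have BmN: "affine_image d \<mu> B \<in> std_normal_Rd d \<rightarrow>\<^sub>M lebesgue_Rd d"
    using Bm by (simp add: measurable_cong_sets[OF setsN refl])
  have "density (lebesgue_Rd d) (\<lambda>x. ennreal (mvn_density d \<mu> S x)) = distr (std_normal_Rd d) (lebesgue_Rd d) (affine_image d \<mu> B)"
  proof (rule measure_eqI)
    fix A assume "A \<in> sets (density (lebesgue_Rd d) (\<lambda>x. ennreal (mvn_density d \<mu> S x)))"
    then have A: "A \<in> sets (lebesgue_Rd d)" by simp
    let ?\<phi> = "\<lambda>z. ennreal (sample_density d std_normal_density z)"
    let ?g = "\<lambda>z. ?\<phi> z * indicator A (affine_image d \<mu> B z)"
    have im: "(\<lambda>z. indicator A (affine_image d \<mu> B z) :: ennreal) \<in> borel_measurable (lebesgue_Rd d)"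
      using measurable_compose[OF Bm borel_measurable_indicator[OF A]] .
    have gm: "?g \<in> borel_measurable (lebesgue_Rd d)" using \<phi>m im by measurable
    have "emeasure (density (lebesgue_Rd d) (\<lambda>x. ennreal (mvn_density d \<mu> S x))) A
       = (\<integral>\<^sup>+ x. ennreal (mvn_density d \<mu> S x) * indicator A x \<partial>lebesgue_Rd d)"
      using fm A by (intro emeasure_density) auto
    also have "\<dots> = (\<integral>\<^sup>+ x. ennreal \<delta> * ?g (T x) \<partial>lebesgue_Rd d)"
    proof (intro nn_integral_cong)
      fix x assume x: "x \<in> space (lebesgue_Rd d)"
      have "sample_density d std_normal_density (T x) \<ge> 0"
        by (auto simp: sample_density_def intro!: prod_nonneg)
      then show "ennreal (mvn_density d \<mu> S x) * indicator A x = ennreal \<delta> * ?g (T x)"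
        using \<delta> by (simp add: dens inv[OF x] ennreal_mult mult.assoc)
    qed
    also have "\<dots> = ennreal \<delta> * (\<integral>\<^sup>+ x. ?g (T x) \<partial>lebesgue_Rd d)"
      using measurable_compose[OF Tm gm] by (intro nn_integral_cmult)
    also have "\<dots> = (\<integral>\<^sup>+ z. ?g z \<partial>lebesgue_Rd d)"
      unfolding \<delta>_def T_def by (rule nn_integral_triangular_map[symmetric, OF gm R(2)])
    also have "\<dots> = (\<integral>\<^sup>+ z. indicator A (affine_image d \<mu> B z) \<partial>std_normal_Rd d)"
      unfolding std_normal_Rd_density using \<phi>m im by (intro nn_integral_density[symmetric]) auto
    also have "\<dots> = (\<integral>\<^sup>+ x. indicator A x \<partial>distr (std_normal_Rd d) (lebesgue_Rd d) (affine_image d \<mu> B))"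
      using BmN A by (intro nn_integral_distr[symmetric]) auto
    also have "\<dots> = emeasure (distr (std_normal_Rd d) (lebesgue_Rd d) (affine_image d \<mu> B)) A"
      using A by simp
    finally show "emeasure (density (lebesgue_Rd d) (\<lambda>x. ennreal (mvn_density d \<mu> S x))) A
       = emeasure (distr (std_normal_Rd d) (lebesgue_Rd d) (affine_image d \<mu> B)) A" .
  qed simp
  then have "whitens d \<mu> S R B" using R(1,4) Bc BR RB dS \<delta> by (simp add: whitens_def)
  then show ?thesis using fm by (rule that)
qed

section \<open>Log-likelihood ratios of two normals\<close>

abbreviation sqnorm :: "real vec \<Rightarrow> real" where
  "sqnorm v \<equiv> scalar_prod v v"

definition frob_sq :: "nat \<Rightarrow> real mat \<Rightarrow> real" where
  "frob_sq d M = (\<Sum>i<d. \<Sum>j<d. (M $$ (i, j))\<^sup>2)"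

lemma sqnorm_sum: "v \<in> carrier_vec d \<Longrightarrow> sqnorm v = (\<Sum>i<d. (vec_index v i)\<^sup>2)"
  by (auto simp: scalar_prod_def power2_eq_square atLeast0LessThan)

lemma sqnorm_nonneg: "sqnorm v \<ge> 0"
  by (auto simp: scalar_prod_def intro!: sum_nonneg)

lemma frob_nonneg: "frob_sq d M \<ge> 0"
  by (auto simp: frob_sq_def intro!: sum_nonneg)

lemma frob_transpose: "M \<in> carrier_mat d d \<Longrightarrow> frob_sq d (transpose_mat M) = frob_sq d M"
  unfolding frob_sq_def by (subst sum.swap) (auto intro!: sum.cong)

lemma frob_cols:
  assumes "M \<in> carrier_mat d d" shows "frob_sq d M = (\<Sum>j<d. sqnorm (col M j))"
proof -
  have "frob_sq d M = (\<Sum>j<d. \<Sum>i<d. (M $$ (i, j))\<^sup>2)" unfolding frob_sq_def by (rule sum.swap)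
  then show ?thesis using assms by (auto simp: scalar_prod_def power2_eq_square atLeast0LessThan intro!: sum.cong)
qed

lemma frob_mult_le:
  assumes A: "A \<in> carrier_mat d d" and X: "X \<in> carrier_mat d d"
    and b: "\<And>y. y \<in> carrier_vec d \<Longrightarrow> sqnorm (A *\<^sub>v y) \<le> c * sqnorm y"
  shows "frob_sq d (A * X) \<le> c * frob_sq d X"
proof -
  have "frob_sq d (A * X) = (\<Sum>j<d. sqnorm (A *\<^sub>v col X j))"
    using A X by (subst frob_cols) (auto intro!: sum.cong)
  also have "\<dots> \<le> (\<Sum>j<d. c * sqnorm (col X j))" using X by (intro sum_mono b) auto
  finally show ?thesis by (simp add: frob_cols[OF X] sum_distrib_left)
qed

lemma frob_mult_ge:
  assumes A: "A \<in> carrier_mat d d" and X: "X \<in> carrier_mat d d"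
    and b: "\<And>y. y \<in> carrier_vec d \<Longrightarrow> c * sqnorm y \<le> sqnorm (A *\<^sub>v y)"
  shows "c * frob_sq d X \<le> frob_sq d (A * X)"
proof -
  have "c * frob_sq d X = (\<Sum>j<d. c * sqnorm (col X j))" by (simp add: frob_cols[OF X] sum_distrib_left)
  also have "\<dots> \<le> (\<Sum>j<d. sqnorm (A *\<^sub>v col X j))" using X by (intro sum_mono b) auto
  also have "\<dots> = frob_sq d (A * X)"
    using A X by (subst frob_cols) (auto intro!: sum.cong)
  finally show ?thesis .
qed

lemma sqnorm_mult_le_frob:
  assumes "P \<in> carrier_mat d d" "y \<in> carrier_vec d"
  shows "sqnorm (P *\<^sub>v y) \<le> frob_sq d P * sqnorm y"
proof -
  have "sqnorm (P *\<^sub>v y) = (\<Sum>i<d. (\<Sum>j<d. P $$ (i, j) * vec_index y j)\<^sup>2)"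
    using assms by (subst sqnorm_sum[of _ d]) (auto simp: scalar_prod_def atLeast0LessThan intro!: sum.cong)
  also have "\<dots> \<le> (\<Sum>i<d. (\<Sum>j<d. (P $$ (i, j))\<^sup>2) * (\<Sum>j<d. (vec_index y j)\<^sup>2))"
    by (intro sum_mono Cauchy_Schwarz_ineq_sum)
  also have "\<dots> = frob_sq d P * sqnorm y"
    by (simp add: frob_sq_def sqnorm_sum[OF assms(2)] sum_distrib_right)
  finally show ?thesis .
qed

lemma sqnorm_minus:
  assumes "a \<in> carrier_vec d" "b \<in> carrier_vec d"
  shows "sqnorm (a - b) = sqnorm a + sqnorm b - 2 * scalar_prod a b"
  using assms comm_scalar_prod[OF assms]
  by (simp add: minus_scalar_prod_distrib[of _ d] scalar_prod_minus_distrib[of _ d])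

lemma sqnorm_add:
  assumes "a \<in> carrier_vec d" "b \<in> carrier_vec d"
  shows "sqnorm (a + b) = sqnorm a + sqnorm b + 2 * scalar_prod a b"
  using assms comm_scalar_prod[OF assms]
  by (simp add: add_scalar_prod_distrib[of _ d] scalar_prod_add_distrib[of _ d])

lemma frob_diff_inverse_transpose:
  assumes G: "G \<in> carrier_mat d d" and H: "H \<in> carrier_mat d d" and GH: "G * H = 1\<^sub>m d"
  shows "frob_sq d (G - transpose_mat H) = frob_sq d G + frob_sq d H - 2 * real d"
proof -
  have "(\<Sum>i<d. \<Sum>j<d. G $$ (i, j) * H $$ (j, i)) = (\<Sum>i<d. (G * H) $$ (i, i))"
    using G H by (auto simp: scalar_prod_def atLeast0LessThan intro!: sum.cong)
  also have "\<dots> = d" by (simp add: GH)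
  finally have c: "(\<Sum>i<d. \<Sum>j<d. G $$ (i, j) * H $$ (j, i)) = d" .
  have "frob_sq d (G - transpose_mat H) = (\<Sum>i<d. \<Sum>j<d. (G $$ (i, j) - H $$ (j, i))\<^sup>2)"
    using G H by (auto simp: frob_sq_def intro!: sum.cong)
  also have "\<dots> = frob_sq d G + (\<Sum>i<d. \<Sum>j<d. (H $$ (j, i))\<^sup>2) - 2 * (\<Sum>i<d. \<Sum>j<d. G $$ (i, j) * H $$ (j, i))"
    by (simp add: power2_diff frob_sq_def sum.distrib sum_subtractf sum_distrib_left mult.assoc)
  also have "(\<Sum>i<d. \<Sum>j<d. (H $$ (j, i))\<^sup>2) = frob_sq d H" unfolding frob_sq_def by (rule sum.swap)
  finally show ?thesis by (simp add: c)
qed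

text \<open>For \<open>H = G\<^sup>-\<^sup>1\<close> and \<open>P = G - H\<^sup>T\<close> one has \<open>P P\<^sup>T = G G\<^sup>T - 2 I + H\<^sup>T H\<close>, whence \<open>G G\<^sup>T \<le> 2 I + P P\<^sup>T\<close>.
  Thus the divergence controls the operator norm of \<open>G\<^sup>T\<close>.\<close>

lemma transpose_expansion_bound:
  assumes G: "G \<in> carrier_mat d d" and H: "H \<in> carrier_mat d d" and GH: "G * H = 1\<^sub>m d"
    and y: "y \<in> carrier_vec d"
  shows "sqnorm (transpose_mat G *\<^sub>v y) \<le> (2 + frob_sq d (G - transpose_mat H)) * sqnorm y"
proof -
  let ?P = "G - transpose_mat H"
  have P: "?P \<in> carrier_mat d d" using G H by auto
  have "transpose_mat ?P = transpose_mat G - H" using G H by (intro eq_matI) auto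
  then have Py: "transpose_mat ?P *\<^sub>v y = transpose_mat G *\<^sub>v y - H *\<^sub>v y"
    using G H y by (simp add: minus_mult_distrib_mat_vec[of _ d d])
  have "scalar_prod (transpose_mat G *\<^sub>v y) (H *\<^sub>v y) = scalar_prod y (G *\<^sub>v (H *\<^sub>v y))"
    using G H y by (intro transpose_vec_mult_scalar) auto
  also have "G *\<^sub>v (H *\<^sub>v y) = (G * H) *\<^sub>v y" using assoc_mult_mat_vec[OF G H y] by simp
  finally have c: "scalar_prod (transpose_mat G *\<^sub>v y) (H *\<^sub>v y) = sqnorm y" using y by (simp add: GH)
  have "sqnorm (transpose_mat ?P *\<^sub>v y) = sqnorm (transpose_mat G *\<^sub>v y) + sqnorm (H *\<^sub>v y) - 2 * sqnorm y"
    unfolding Py using G H y by (subst sqnorm_minus[of _ d]) (auto simp: c)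
  moreover have "sqnorm (transpose_mat ?P *\<^sub>v y) \<le> frob_sq d ?P * sqnorm y"
    using sqnorm_mult_le_frob[of "transpose_mat ?P" d y] P y by (simp add: frob_transpose)
  ultimately show ?thesis using sqnorm_nonneg[of "H *\<^sub>v y"] by (simp add: algebra_simps)
qed

text \<open>The left side is the variance of the log-likelihood ratio of two normals, and \<open>J\<close> their Jeffreys divergence.
  With \<open>P = G - H\<^sup>T\<close> the divergence is half of \<open>frob_sq d P + sqnorm u + w\<close>, while \<open>G\<^sup>T G - I = G\<^sup>T P\<close>, so the variance
  costs one factor of \<open>G\<^sup>T\<close>, that is, a factor \<open>2 + 2 * J\<close> by \<open>transpose_expansion_bound\<close>.\<close>

lemma variance_le_divergence:
  assumes G: "G \<in> carrier_mat d d" and H: "H \<in> carrier_mat d d"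
    and GH: "G * H = 1\<^sub>m d" and HG: "H * G = 1\<^sub>m d" and u: "u \<in> carrier_vec d" and w: "w \<ge> (0::real)"
    and J: "2 * J = frob_sq d G + frob_sq d H - 2 * real d + sqnorm u + w"
  shows "frob_sq d (transpose_mat G * G - 1\<^sub>m d) / 2 + sqnorm (transpose_mat G *\<^sub>v u) \<le> 4 * (J * (1 + J))"
proof -
  let ?P = "G - transpose_mat H"
  let ?c = "2 + frob_sq d ?P"
  have P: "?P \<in> carrier_mat d d" and Gt: "transpose_mat G \<in> carrier_mat d d" and Ht: "transpose_mat H \<in> carrier_mat d d"
    using G H by auto
  have "transpose_mat G * ?P = transpose_mat G * G - transpose_mat G * transpose_mat H"
    by (rule mult_minus_distrib_mat[OF Gt G Ht])
  also have "transpose_mat G * transpose_mat H = transpose_mat (H * G)" using transpose_mult[OF H G] by simp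
  finally have e: "transpose_mat G * G - 1\<^sub>m d = transpose_mat G * ?P" by (simp add: HG)
  have b1: "frob_sq d (transpose_mat G * ?P) \<le> ?c * frob_sq d ?P"
    by (rule frob_mult_le[OF Gt P transpose_expansion_bound[OF G H GH]])
  have b2: "sqnorm (transpose_mat G *\<^sub>v u) \<le> ?c * sqnorm u"
    by (rule transpose_expansion_bound[OF G H GH u])
  have J2: "2 * J = frob_sq d ?P + sqnorm u + w" unfolding frob_diff_inverse_transpose[OF G H GH] using J by simp
  note nn = frob_nonneg[of d ?P] sqnorm_nonneg[of u]
  have "frob_sq d (transpose_mat G * G - 1\<^sub>m d) / 2 + sqnorm (transpose_mat G *\<^sub>v u) \<le> ?c * (frob_sq d ?P / 2 + sqnorm u)"
    unfolding e using b1 b2 by (simp add: distrib_left)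
  also have "\<dots> \<le> (2 + 2 * J) * (2 * J)" using J2 w nn by (intro mult_mono) auto
  finally show ?thesis by (simp add: algebra_simps)
qed

definition log_normalizer :: "nat \<Rightarrow> real mat \<Rightarrow> real" where
  "log_normalizer d S = ln ((2 * pi) powr (real d / 2) * sqrt (Determinant.det S))"

lemma ln_mvn_density:
  assumes "Determinant.det S > 0"
  shows "ln (mvn_density d \<mu> S x) =
    - (1 / 2) * scalar_prod (Matrix.vec d x - \<mu>) (mat_inv S *\<^sub>v (Matrix.vec d x - \<mu>)) - log_normalizer d S"
proof -
  have "(2 * pi) powr (real d / 2) * sqrt (Determinant.det S) > 0" using assms by simp
  then show ?thesis unfolding mvn_density_def log_normalizer_def by (subst ln_div) auto
qed

lemma positive_density_mvn:
  assumes S: "S \<in> pos_def_mats d" and \<mu>: "\<mu> \<in> carrier_vec d"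
  shows "positive_density (lebesgue_Rd d) (mvn_density d \<mu> S)"
proof -
  obtain R B where w: "whitens d \<mu> S R B" and m: "mvn_density d \<mu> S \<in> borel_measurable (lebesgue_Rd d)"
    using mvn_whitening[OF S \<mu>] by blast
  interpret N: prob_space "std_normal_Rd d" by (rule prob_space_std_normal_Rd)
  have "affine_image d \<mu> B \<in> lebesgue_Rd d \<rightarrow>\<^sub>M lebesgue_Rd d"
    by (rule affine_image_measurable[OF \<mu> whitensD(2)[OF w]])
  then have "affine_image d \<mu> B \<in> std_normal_Rd d \<rightarrow>\<^sub>M lebesgue_Rd d"
    by (simp add: std_normal_Rd_density)
  then have "prob_space (density (lebesgue_Rd d) (\<lambda>x. ennreal (mvn_density d \<mu> S x)))"
    unfolding whitensD(7)[OF w] by (rule N.prob_space_distr)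
  from prob_space.emeasure_space_1[OF this]
  have "(\<integral>\<^sup>+ x. ennreal (mvn_density d \<mu> S x) \<partial>lebesgue_Rd d) = 1"
    using m by (simp add: emeasure_density cong: nn_integral_cong)
  then show ?thesis using m whitensD(6)[OF w] by (auto simp: positive_density_def mvn_density_def)
qed

lemma sq_integrable_transfer:
  assumes D: "density L f = distr N L \<phi>" and \<phi>: "\<phi> \<in> N \<rightarrow>\<^sub>M L" and h: "h \<in> borel_measurable L"
    and s: "sq_integrable N (\<lambda>z. h (\<phi> z))"
  shows "sq_integrable (density L f) h"
proof -
  have m: "(\<lambda>x. (h x)\<^sup>2) \<in> borel_measurable L" using h by measurable
  have "integrable (distr N L \<phi>) (\<lambda>x. (h x)\<^sup>2)"
    using s integrable_distr_eq[OF \<phi> m] by (simp add: sq_integrable_def)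
  then show ?thesis using h by (simp add: sq_integrable_def D)
qed

text \<open>In the whitened variable of the first density its own exponent is \<open>- sqnorm z / 2\<close>, and that of the second density
  is \<open>- sqnorm (u + G z) / 2\<close>.\<close>

lemma whitened_log_ratio:
  assumes \<mu>0: "\<mu>0 \<in> carrier_vec d" and \<mu>1: "\<mu>1 \<in> carrier_vec d"
    and w0: "whitens d \<mu>0 S0 R0 B0" and w1: "whitens d \<mu>1 S1 R1 B1"
  shows "log_ratio (mvn_density d \<mu>0 S0) (mvn_density d \<mu>1 S1) (affine_image d \<mu>0 B0 z)
    = quadratic d (\<lambda>i j. (transpose_mat (R1 * B0) * (R1 * B0) - 1\<^sub>m d) $$ (i, j) / 2)
        (\<lambda>i. vec_index (transpose_mat (R1 * B0) *\<^sub>v (R1 *\<^sub>v (\<mu>0 - \<mu>1))) i)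
        (sqnorm (R1 *\<^sub>v (\<mu>0 - \<mu>1)) / 2 + (log_normalizer d S1 - log_normalizer d S0)) z"
proof -
  let ?G = "R1 * B0" and ?u = "R1 *\<^sub>v (\<mu>0 - \<mu>1)" and ?z = "Matrix.vec d z"
  let ?x = "Matrix.vec d (affine_image d \<mu>0 B0 z)"
  have c: "R0 \<in> carrier_mat d d" "B0 \<in> carrier_mat d d" "R0 * B0 = 1\<^sub>m d" "mat_inv S0 = transpose_mat R0 * R0"
    "R1 \<in> carrier_mat d d" "mat_inv S1 = transpose_mat R1 * R1"
    using whitensD[OF w0] whitensD[OF w1] by simp_all
  have z: "?z \<in> carrier_vec d" by simp
  have Bz: "B0 *\<^sub>v ?z \<in> carrier_vec d" using c by simp
  have G: "?G \<in> carrier_mat d d" using c by simp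
  have u: "?u \<in> carrier_vec d" using c \<mu>0 \<mu>1 by simp
  have x: "?x = \<mu>0 + B0 *\<^sub>v ?z" using c \<mu>0 by (intro eq_vecI) (auto simp: affine_image_def)
  have x0: "?x - \<mu>0 = B0 *\<^sub>v ?z" unfolding x using c \<mu>0 by (intro eq_vecI) auto
  have x1: "?x - \<mu>1 = (\<mu>0 - \<mu>1) + B0 *\<^sub>v ?z" unfolding x using c \<mu>0 \<mu>1 by (intro eq_vecI) auto
  have d0: "?x - \<mu>0 \<in> carrier_vec d" and d1: "?x - \<mu>1 \<in> carrier_vec d" using \<mu>0 \<mu>1 by simp_all
  have "R0 *\<^sub>v (?x - \<mu>0) = (R0 * B0) *\<^sub>v ?z" unfolding x0 by (rule assoc_mult_mat_vec[OF c(1,2) z, symmetric])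
  then have q0: "scalar_prod (?x - \<mu>0) (mat_inv S0 *\<^sub>v (?x - \<mu>0)) = sqnorm ?z"
    unfolding c(4) quad_form_whitened[OF c(1) d0] by (simp add: c(3))
  have "R1 *\<^sub>v (?x - \<mu>1) = ?u + R1 *\<^sub>v (B0 *\<^sub>v ?z)"
    unfolding x1 using c \<mu>0 \<mu>1 Bz by (intro mult_add_distrib_mat_vec) auto
  also have "R1 *\<^sub>v (B0 *\<^sub>v ?z) = ?G *\<^sub>v ?z" by (rule assoc_mult_mat_vec[OF c(5,2) z, symmetric])
  finally have "R1 *\<^sub>v (?x - \<mu>1) = ?u + ?G *\<^sub>v ?z" .
  then have q1: "scalar_prod (?x - \<mu>1) (mat_inv S1 *\<^sub>v (?x - \<mu>1)) = sqnorm (?u + ?G *\<^sub>v ?z)"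
    unfolding c(6) quad_form_whitened[OF c(5) d1] by simp
  have exp: "sqnorm (?u + ?G *\<^sub>v ?z) = sqnorm ?u + scalar_prod ?z ((transpose_mat ?G * ?G) *\<^sub>v ?z)
      + 2 * scalar_prod (transpose_mat ?G *\<^sub>v ?u) ?z"
    using sqnorm_add[OF u, of "?G *\<^sub>v ?z"] quad_form_whitened[OF G z] transpose_vec_mult_scalar[OF G z u] G by simp
  have l: "scalar_prod (transpose_mat ?G *\<^sub>v ?u) ?z = (\<Sum>i<d. vec_index (transpose_mat ?G *\<^sub>v ?u) i * z i)"
    by (simp add: scalar_prod_def atLeast0LessThan)
  have M: "transpose_mat ?G * ?G \<in> carrier_mat d d" using G by simp
  have "scalar_prod ?z (M *\<^sub>v ?z) = (\<Sum>i<d. \<Sum>j<d. M $$ (i, j) * (z i * z j))"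
    if "M \<in> carrier_mat d d" for M
    using that by (simp add: scalar_prod_def atLeast0LessThan sum_distrib_left mult_ac)
  from this[OF M] have qd: "scalar_prod ?z ((transpose_mat ?G * ?G) *\<^sub>v ?z)
      = (\<Sum>i<d. \<Sum>j<d. (transpose_mat ?G * ?G) $$ (i, j) * (z i * z j))" .
  have "(\<Sum>i<d. \<Sum>j<d. (M - 1\<^sub>m d) $$ (i, j) / 2 * (z i * z j))
      = ((\<Sum>i<d. \<Sum>j<d. M $$ (i, j) * (z i * z j)) - sqnorm ?z) / 2" if "M \<in> carrier_mat d d" for M
  proof -
    have "(\<Sum>i<d. \<Sum>j<d. (M - 1\<^sub>m d) $$ (i, j) / 2 * (z i * z j))
      = (\<Sum>i<d. \<Sum>j<d. M $$ (i, j) * (z i * z j) / 2 - (if i = j then z i * z j / 2 else 0))"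
      using that by (intro sum.cong refl) (auto simp: field_simps)
    also have "\<dots> = (\<Sum>i<d. \<Sum>j<d. M $$ (i, j) * (z i * z j)) / 2 - (\<Sum>i<d. z i * z i / 2)"
      by (simp add: sum_subtractf sum_divide_distrib)
    also have "(\<Sum>i<d. z i * z i / 2) = sqnorm ?z / 2"
      by (simp add: scalar_prod_def atLeast0LessThan sum_divide_distrib)
    finally show ?thesis by (simp add: diff_divide_distrib)
  qed
  from this[OF M] show ?thesis
    unfolding log_ratio_def ln_mvn_density[OF whitensD(6)[OF w0]] ln_mvn_density[OF whitensD(6)[OF w1]] q0 q1 exp qd l quadratic_def
    by (simp add: field_simps)
qed

lemma quadratic_add_const: "quadratic d A b c z - m = quadratic d A b (c - m) z"
  by (simp add: quadratic_def)

text \<open>The moment formulas for quadratic polynomials, read off for \<open>whitened_log_ratio\<close>.\<close>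

lemma gaussian_pair:
  assumes S0: "S0 \<in> pos_def_mats d" and S1: "S1 \<in> pos_def_mats d"
    and \<mu>0: "\<mu>0 \<in> carrier_vec d" and \<mu>1: "\<mu>1 \<in> carrier_vec d"
    and w0: "whitens d \<mu>0 S0 R0 B0" and w1: "whitens d \<mu>1 S1 R1 B1"
  defines "f \<equiv> mvn_density d \<mu>0 S0" and "g \<equiv> mvn_density d \<mu>1 S1" and "G \<equiv> R1 * B0" and "u \<equiv> R1 *\<^sub>v (\<mu>0 - \<mu>1)"
  shows "kl (lebesgue_Rd d) f g = (frob_sq d G - real d + sqnorm u) / 2 + (log_normalizer d S1 - log_normalizer d S0)"
    "log_ratio_var (lebesgue_Rd d) f g = frob_sq d (transpose_mat G * G - 1\<^sub>m d) / 2 + sqnorm (transpose_mat G *\<^sub>v u)"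
    "integrable (density (lebesgue_Rd d) f) (\<lambda>x. (log_ratio f g x)\<^sup>2)"
    "integrable (density (lebesgue_Rd d) f) (\<lambda>x. (log_ratio f g x)^4)"
    "(\<integral>x. (log_ratio f g x)^4 \<partial>density (lebesgue_Rd d) f) \<le> 48 * (\<integral>x. (log_ratio f g x)\<^sup>2 \<partial>density (lebesgue_Rd d) f)\<^sup>2"
proof -
  let ?L = "lebesgue_Rd d" and ?N = "std_normal_Rd d" and ?\<phi> = "affine_image d \<mu>0 B0"
  define A where "A i j = (transpose_mat G * G - 1\<^sub>m d) $$ (i, j) / 2" for i j
  define b where "b i = vec_index (transpose_mat G *\<^sub>v u) i" for i
  define c where "c = sqnorm u / 2 + (log_normalizer d S1 - log_normalizer d S0)"
  have lr: "log_ratio f g (?\<phi> z) = quadratic d A b c z" for z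
    unfolding f_def g_def whitened_log_ratio[OF \<mu>0 \<mu>1 w0 w1]
    by (simp add: A_def[abs_def] b_def[abs_def] c_def G_def u_def)
  note cc = whitensD(1)[OF w1] whitensD(2)[OF w0]
  have G: "G \<in> carrier_mat d d" using cc by (simp add: G_def)
  have u: "u \<in> carrier_vec d" using cc \<mu>0 \<mu>1 by (simp add: u_def)
  have sym: "A i j = A j i" if "i < d" "j < d" for i j
    using that G by (simp add: A_def scalar_prod_def mult.commute)
  have trA: "(\<Sum>i<d. A i i) = (frob_sq d G - d) / 2"
  proof -
    have "(\<Sum>i<d. A i i) = (\<Sum>i<d. ((\<Sum>k<d. (G $$ (k, i))\<^sup>2) - 1) / 2)"
      using G by (intro sum.cong) (auto simp: A_def scalar_prod_def atLeast0LessThan power2_eq_square)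
    also have "\<dots> = ((\<Sum>i<d. \<Sum>k<d. (G $$ (k, i))\<^sup>2) - d) / 2"
      by (simp add: sum_divide_distrib[symmetric] sum_subtractf)
    also have "(\<Sum>i<d. \<Sum>k<d. (G $$ (k, i))\<^sup>2) = frob_sq d G" unfolding frob_sq_def by (rule sum.swap)
    finally show ?thesis .
  qed
  have nA: "2 * (\<Sum>i<d. \<Sum>j<d. (A i j)\<^sup>2) = frob_sq d (transpose_mat G * G - 1\<^sub>m d) / 2"
    by (simp add: A_def frob_sq_def power_divide sum_divide_distrib[symmetric])
  have nb: "(\<Sum>i<d. (b i)\<^sup>2) = sqnorm (transpose_mat G *\<^sub>v u)"
    using G u by (subst sqnorm_sum[of _ d]) (auto simp: b_def)
  have "?\<phi> \<in> ?L \<rightarrow>\<^sub>M ?L" using cc \<mu>0 by (intro affine_image_measurable)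
  then have \<phi>: "?\<phi> \<in> ?N \<rightarrow>\<^sub>M ?L" by (simp add: std_normal_Rd_density)
  have fm: "f \<in> borel_measurable ?L" and gm: "g \<in> borel_measurable ?L"
    using positive_densityD(1)[OF positive_density_mvn[OF S0 \<mu>0]] positive_densityD(1)[OF positive_density_mvn[OF S1 \<mu>1]]
    by (simp_all add: f_def g_def)
  have lm: "log_ratio f g \<in> borel_measurable ?L" by (rule log_ratio_measurable[OF fm gm])
  have D': "density ?L f = distr ?N ?L ?\<phi>" using whitensD(7)[OF w0] by (simp add: f_def)
  have I: "(\<integral>x. h x \<partial>density ?L f) = (\<integral>z. h (?\<phi> z) \<partial>?N)" if "h \<in> borel_measurable ?L" for h :: "_ \<Rightarrow> real"
    unfolding D' by (rule integral_distr[OF \<phi> that])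
  show k: "kl ?L f g = (frob_sq d G - real d + sqnorm u) / 2 + (log_normalizer d S1 - log_normalizer d S0)"
  proof -
    have "kl ?L f g = (\<integral>z. quadratic d A b c z \<partial>?N)" unfolding kl_def I[OF lm] lr ..
    also have "\<dots> = c + (\<Sum>i<d. A i i)" by (rule quadratic_mean) (rule sym)
    finally show ?thesis unfolding trA c_def by (simp add: field_simps)
  qed
  let ?m = "kl ?L f g"
  have "log_ratio_var ?L f g = (\<integral>z. (quadratic d A b (c - ?m) z)\<^sup>2 \<partial>?N)"
    unfolding log_ratio_var_def using lm by (subst I) (simp_all add: lr quadratic_add_const)
  also have "\<dots> = (c - ?m + (frob_sq d G - d) / 2)\<^sup>2 + frob_sq d (transpose_mat G * G - 1\<^sub>m d) / 2 + sqnorm (transpose_mat G *\<^sub>v u)"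
    by (subst quadratic_second_moment[OF sym]) (simp_all add: trA nA nb)
  also have "c - ?m + (frob_sq d G - d) / 2 = 0" unfolding k c_def by (simp add: field_simps)
  finally show "log_ratio_var ?L f g = frob_sq d (transpose_mat G * G - 1\<^sub>m d) / 2 + sqnorm (transpose_mat G *\<^sub>v u)"
    by simp
  have int: "integrable (density ?L f) (\<lambda>x. (log_ratio f g x)^k)" for k
  proof -
    have m: "(\<lambda>x. (log_ratio f g x)^k) \<in> borel_measurable ?L" using lm by measurable
    show ?thesis unfolding D' using integrable_distr_eq[OF \<phi> m]
      poly_growth_integrable[OF poly_growth_power[OF poly_growth_quadratic]] by (simp add: lr)
  qed
  show "integrable (density ?L f) (\<lambda>x. (log_ratio f g x)\<^sup>2)" "integrable (density ?L f) (\<lambda>x. (log_ratio f g x)^4)"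
    by (rule int)+
  show "(\<integral>x. (log_ratio f g x)^4 \<partial>density ?L f) \<le> 48 * (\<integral>x. (log_ratio f g x)\<^sup>2 \<partial>density ?L f)\<^sup>2"
    using quadratic_fourth_moment[where b = b and c = c and d = d and A = A, OF sym] lm by (simp add: I lr)
qed

lemma inverse_of_whitening:
  assumes w0: "whitens d \<mu>0 S0 R0 B0" and w1: "whitens d \<mu>1 S1 R1 B1"
  shows "(R1 * B0) * (R0 * B1) = 1\<^sub>m d"
proof -
  have c: "R0 \<in> carrier_mat d d" "B0 \<in> carrier_mat d d" "B0 * R0 = 1\<^sub>m d"
    "R1 \<in> carrier_mat d d" "B1 \<in> carrier_mat d d" "R1 * B1 = 1\<^sub>m d"
    using whitensD[OF w0] whitensD[OF w1] by simp_all
  have "(R1 * B0) * (R0 * B1) = R1 * (B0 * (R0 * B1))" using c by (intro assoc_mult_mat) auto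
  also have "B0 * (R0 * B1) = (B0 * R0) * B1" by (rule assoc_mult_mat[symmetric, OF c(2,1,5)])
  finally show ?thesis using c by simp
qed

text \<open>The normalizing constants cancel in the symmetrized divergence.\<close>

lemma mvn_jeffreys:
  assumes S0: "S0 \<in> pos_def_mats d" and S1: "S1 \<in> pos_def_mats d"
    and \<mu>0: "\<mu>0 \<in> carrier_vec d" and \<mu>1: "\<mu>1 \<in> carrier_vec d"
    and w0: "whitens d \<mu>0 S0 R0 B0" and w1: "whitens d \<mu>1 S1 R1 B1"
  shows "2 * jeffreys (lebesgue_Rd d) (mvn_density d \<mu>0 S0) (mvn_density d \<mu>1 S1)
    = frob_sq d (R1 * B0) + frob_sq d (R0 * B1) - 2 * real d + sqnorm (R1 *\<^sub>v (\<mu>0 - \<mu>1)) + sqnorm (R0 *\<^sub>v (\<mu>1 - \<mu>0))"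
  unfolding jeffreys_kl gaussian_pair(1)[OF S0 S1 \<mu>0 \<mu>1 w0 w1]
    gaussian_pair(1)[OF S1 S0 \<mu>1 \<mu>0 w1 w0]
  by (simp add: field_simps)

theorem mvn_variance_le_jeffreys:
  assumes S0: "S0 \<in> pos_def_mats d" and S1: "S1 \<in> pos_def_mats d"
    and \<mu>0: "\<mu>0 \<in> carrier_vec d" and \<mu>1: "\<mu>1 \<in> carrier_vec d"
  defines "J \<equiv> jeffreys (lebesgue_Rd d) (mvn_density d \<mu>0 S0) (mvn_density d \<mu>1 S1)"
  shows "log_ratio_var (lebesgue_Rd d) (mvn_density d \<mu>0 S0) (mvn_density d \<mu>1 S1) \<le> 4 * (J * (1 + J))"
proof -
  obtain R0 B0 where w0: "whitens d \<mu>0 S0 R0 B0" using mvn_whitening[OF S0 \<mu>0] by blast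
  obtain R1 B1 where w1: "whitens d \<mu>1 S1 R1 B1" using mvn_whitening[OF S1 \<mu>1] by blast
  note c = whitensD(1,2)[OF w0] whitensD(1,2)[OF w1]
  show ?thesis
    unfolding gaussian_pair(2)[OF S0 S1 \<mu>0 \<mu>1 w0 w1]
  proof (rule variance_le_divergence)
    show "2 * J = frob_sq d (R1 * B0) + frob_sq d (R0 * B1) - 2 * real d + sqnorm (R1 *\<^sub>v (\<mu>0 - \<mu>1)) + sqnorm (R0 *\<^sub>v (\<mu>1 - \<mu>0))"
      unfolding J_def by (rule mvn_jeffreys[OF S0 S1 \<mu>0 \<mu>1 w0 w1])
    show "(R1 * B0) * (R0 * B1) = 1\<^sub>m d" "(R0 * B1) * (R1 * B0) = 1\<^sub>m d"
      by (rule inverse_of_whitening[OF w0 w1] inverse_of_whitening[OF w1 w0])+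
  qed (use c \<mu>0 \<mu>1 sqnorm_nonneg in auto)
qed

section \<open>Upper bound for graphical models\<close>

text \<open>Vertices, as singletons, and edges: \<open>{i, j}\<close> belongs to this set exactly when the entry \<open>(i, j)\<close> of a precision matrix of
  the model is unconstrained, diagonal entries included.\<close>

definition cliques :: "nat \<Rightarrow> nat set set \<Rightarrow> nat set set" where
  "cliques d E = (\<lambda>i. {i}) ` {..<d} \<union> E"

definition index_pairs :: "nat \<Rightarrow> nat set set \<Rightarrow> (nat \<times> nat) set" where
  "index_pairs d \<sigma> = {(i, j). i < d \<and> j < d \<and> {i, j} \<in> \<sigma>}"

lemma finite_index_pairs: "finite (index_pairs d \<sigma>)"
  by (rule finite_subset[of _ "{..<d} \<times> {..<d}"]) (auto simp: index_pairs_def)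

lemma finite_graph: "simple_graph {..<d::nat} E \<Longrightarrow> finite E"
  by (rule finite_subset[of _ "Pow {..<d}"]) (auto simp: simple_graph_def)

lemma finite_cliques: "simple_graph {..<d} E \<Longrightarrow> finite (cliques d E)"
  by (auto simp: cliques_def finite_graph)

lemma card_cliques:
  assumes "simple_graph {..<d} E" shows "card (cliques d E) = card E + d"
proof -
  have "(\<lambda>i. {i}) ` {..<d} \<inter> E = {}" using assms by (auto simp: simple_graph_def)
  moreover have "card ((\<lambda>i. {i}) ` {..<d}) = d" by (subst card_image) auto
  ultimately show ?thesis using finite_graph[OF assms] by (simp add: cliques_def card_Un_disjoint)
qed

lemma clique_pair:
  assumes "simple_graph {..<d} E" "e \<in> cliques d E"
  obtains i j where "i < d" "j < d" "e = {i, j}"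
proof (cases "e \<in> E")
  case True
  then have "card e = 2" "e \<subseteq> {..<d}" using assms by (auto simp: simple_graph_def)
  then show ?thesis using that by (auto simp: card_2_iff)
next
  case False
  then obtain i where "i < d" "e = {i, i}" using assms by (auto simp: cliques_def)
  then show ?thesis using that by blast
qed

lemma card_index_pairs:
  assumes "simple_graph {..<d} E" "\<sigma> \<subseteq> cliques d E"
  shows "card \<sigma> \<le> card (index_pairs d \<sigma>)" "card (index_pairs d \<sigma>) \<le> 2 * card \<sigma>"
proof -
  have fin: "finite \<sigma>" using finite_cliques[OF assms(1)] assms(2) by (rule finite_subset[rotated])
  have "\<sigma> \<subseteq> (\<lambda>(i, j). {i, j}) ` index_pairs d \<sigma>"
  proof
    fix e assume e: "e \<in> \<sigma>"
    then obtain i j where "i < d" "j < d" "e = {i, j}" using clique_pair[OF assms(1)] assms(2) by blast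
    then show "e \<in> (\<lambda>(i, j). {i, j}) ` index_pairs d \<sigma>"
      using e by (intro image_eqI[of _ _ "(i, j)"]) (auto simp: index_pairs_def)
  qed
  then show "card \<sigma> \<le> card (index_pairs d \<sigma>)"
    using finite_index_pairs by (meson surj_card_le)
  have "index_pairs d \<sigma> = (\<Union>e\<in>\<sigma>. {(i, j). i < d \<and> j < d \<and> {i, j} = e})"
    by (auto simp: index_pairs_def)
  then have "card (index_pairs d \<sigma>) \<le> (\<Sum>e\<in>\<sigma>. card {(i, j). i < d \<and> j < d \<and> {i, j} = e})"
    using card_UN_le[OF fin] by simp
  also have "\<dots> \<le> (\<Sum>e\<in>\<sigma>. 2)"
  proof (rule sum_mono)
    fix e assume "e \<in> \<sigma>"
    then obtain a b where "e = {a, b}" using clique_pair[OF assms(1)] assms(2) by blast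
    then have "{(i, j). i < d \<and> j < d \<and> {i, j} = e} \<subseteq> {(a, b), (b, a)}"
      by (auto simp: doubleton_eq_iff)
    from card_mono[OF _ this] show "card {(i, j). i < d \<and> j < d \<and> {i, j} = e} \<le> 2"
      using card_insert_le_m1[of 2 "{(b, a)}" "(a, b)"] by (auto intro: order_trans)
  qed
  finally show "card (index_pairs d \<sigma>) \<le> 2 * card \<sigma>" by simp
qed

definition suff_stat :: "nat + nat \<times> nat \<Rightarrow> (nat \<Rightarrow> real) \<Rightarrow> real" where
  "suff_stat a x = (case a of Inl i \<Rightarrow> x i | Inr p \<Rightarrow> x (fst p) * x (snd p))"

definition stat_index :: "nat \<Rightarrow> nat set set \<Rightarrow> (nat + nat \<times> nat) set" where
  "stat_index d E = Inl ` {..<d} \<union> Inr ` index_pairs d (cliques d E)"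

lemma card_stat_index:
  assumes "simple_graph {..<d} E"
  shows "finite (stat_index d E)" "card (stat_index d E) \<le> 3 * (card E + d)"
proof -
  show "finite (stat_index d E)" by (simp add: stat_index_def finite_index_pairs)
  have "card (stat_index d E) \<le> card (Inl ` {..<d} :: (nat + nat \<times> nat) set)
      + card (Inr ` index_pairs d (cliques d E) :: (nat + nat \<times> nat) set)"
    unfolding stat_index_def by (rule card_Un_le)
  also have "\<dots> = d + card (index_pairs d (cliques d E))" by (simp add: card_image)
  also have "\<dots> \<le> 3 * (card E + d)"
    using card_index_pairs(2)[OF assms order_refl] by (simp add: card_cliques[OF assms])
  finally show "card (stat_index d E) \<le> 3 * (card E + d)" .
qed

text \<open>Expanding the exponent gives coordinates and products of coordinates; the products off the graph have coefficient \<open>0\<close>.\<close>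

lemma mvn_exponential_family:
  assumes S: "S \<in> graph_covs d E" and \<mu>: "\<mu> \<in> carrier_vec d"
  shows "\<exists>c w. \<forall>x. ln (mvn_density d \<mu> S x) = c + (\<Sum>a\<in>stat_index d E. w a * suff_stat a x)"
proof -
  have Sp: "S \<in> pos_def_mats d" using S by (simp add: graph_covs_def)
  obtain R B where w: "whitens d \<mu> S R B" using mvn_whitening[OF Sp \<mu>] by blast
  note det = whitensD(6)[OF w]
  define K where "K = mat_inv S"
  have Kc: "K \<in> carrier_mat d d" using mat_inv_props[OF Sp] by (simp add: K_def)
  have K0: "K $$ (i, j) = 0" if "i < d" "j < d" "(i, j) \<notin> index_pairs d (cliques d E)" for i j
    using S that by (auto simp: graph_covs_def K_def index_pairs_def cliques_def)
  define m where "m i = vec_index \<mu> i" for i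
  define l where "l i = (\<Sum>j<d. K $$ (i, j) * m j) + (\<Sum>j<d. K $$ (j, i) * m j)" for i
  define v where "v a = (case a of Inl i \<Rightarrow> l i / 2 | Inr p \<Rightarrow> - K $$ p / 2)" for a
  define c where "c = - (1/2) * (\<Sum>i<d. \<Sum>j<d. K $$ (i, j) * (m i * m j)) - log_normalizer d S"
  have "ln (mvn_density d \<mu> S x) = c + (\<Sum>a\<in>stat_index d E. v a * suff_stat a x)" for x
  proof -
    let ?v = "Matrix.vec d x - \<mu>"
    have "scalar_prod ?v (K *\<^sub>v ?v) = (\<Sum>i<d. \<Sum>j<d. K $$ (i, j) * ((x i - m i) * (x j - m j)))"
      using Kc \<mu> by (simp add: scalar_prod_def atLeast0LessThan sum_distrib_left m_def mult_ac)
    also have "\<dots> = (\<Sum>i<d. \<Sum>j<d. K $$ (i, j) * (x i * x j)) - (\<Sum>i<d. \<Sum>j<d. K $$ (i, j) * m j * x i)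
        - (\<Sum>i<d. \<Sum>j<d. K $$ (i, j) * m i * x j) + (\<Sum>i<d. \<Sum>j<d. K $$ (i, j) * (m i * m j))"
      by (simp add: sum_subtractf[symmetric] sum.distrib[symmetric] algebra_simps)
    also have "(\<Sum>i<d. \<Sum>j<d. K $$ (i, j) * m i * x j) = (\<Sum>i<d. \<Sum>j<d. K $$ (j, i) * m j * x i)"
      by (rule sum.swap)
    also have "(\<Sum>i<d. \<Sum>j<d. K $$ (i, j) * (x i * x j)) - (\<Sum>i<d. \<Sum>j<d. K $$ (i, j) * m j * x i)
        - (\<Sum>i<d. \<Sum>j<d. K $$ (j, i) * m j * x i) + (\<Sum>i<d. \<Sum>j<d. K $$ (i, j) * (m i * m j))
      = (\<Sum>i<d. \<Sum>j<d. K $$ (i, j) * (x i * x j)) - (\<Sum>i<d. l i * x i) + (\<Sum>i<d. \<Sum>j<d. K $$ (i, j) * (m i * m j))"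
      by (simp add: l_def distrib_right sum.distrib sum_distrib_right)
    finally have q: "scalar_prod ?v (K *\<^sub>v ?v)
      = (\<Sum>i<d. \<Sum>j<d. K $$ (i, j) * (x i * x j)) - (\<Sum>i<d. l i * x i) + (\<Sum>i<d. \<Sum>j<d. K $$ (i, j) * (m i * m j))" .
    have "(\<Sum>i<d. \<Sum>j<d. K $$ (i, j) * (x i * x j)) = (\<Sum>p\<in>{..<d} \<times> {..<d}. K $$ p * (x (fst p) * x (snd p)))"
      by (simp add: sum.cartesian_product case_prod_unfold)
    also have "\<dots> = (\<Sum>p\<in>index_pairs d (cliques d E). K $$ p * (x (fst p) * x (snd p)))"
      using K0 by (intro sum.mono_neutral_right) (auto simp: index_pairs_def)
    finally have p: "(\<Sum>i<d. \<Sum>j<d. K $$ (i, j) * (x i * x j))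
      = (\<Sum>p\<in>index_pairs d (cliques d E). K $$ p * (x (fst p) * x (snd p)))" .
    have "(\<Sum>a\<in>stat_index d E. v a * suff_stat a x)
      = (\<Sum>i<d. l i / 2 * x i) + (\<Sum>p\<in>index_pairs d (cliques d E). - K $$ p / 2 * (x (fst p) * x (snd p)))"
      unfolding stat_index_def
      by (subst sum.union_disjoint) (auto simp: finite_index_pairs sum.reindex v_def suff_stat_def)
    also have "\<dots> = (\<Sum>i<d. l i * x i) / 2 - (\<Sum>p\<in>index_pairs d (cliques d E). K $$ p * (x (fst p) * x (snd p))) / 2"
      by (simp add: sum_divide_distrib sum_negf)
    finally show ?thesis
      unfolding ln_mvn_density[OF det] K_def[symmetric] q p by (simp add: c_def field_simps)
  qed
  then show ?thesis by blast
qed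

lemma suff_stat_sq_integrable:
  assumes S: "S \<in> pos_def_mats d" and \<mu>: "\<mu> \<in> carrier_vec d" and a: "a \<in> stat_index d E"
  shows "sq_integrable (density (lebesgue_Rd d) (mvn_density d \<mu> S)) (suff_stat a)"
proof -
  obtain R B where w: "whitens d \<mu> S R B" using mvn_whitening[OF S \<mu>] by blast
  note B = whitensD(2)[OF w]
  have "affine_image d \<mu> B \<in> lebesgue_Rd d \<rightarrow>\<^sub>M lebesgue_Rd d" by (rule affine_image_measurable[OF \<mu> B])
  then have \<phi>: "affine_image d \<mu> B \<in> std_normal_Rd d \<rightarrow>\<^sub>M lebesgue_Rd d" by (simp add: std_normal_Rd_density)
  have m: "(\<lambda>x. x i) \<in> borel_measurable (lebesgue_Rd d)" if "i < d" for i
    using that measurable_component_singleton[of i "{..<d}" "\<lambda>_. lborel :: real measure"]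
    by (simp add: lebesgue_Rd_def cong: measurable_cong_sets)
  have pg: "poly_growth d (\<lambda>z. affine_image d \<mu> B z i)" if i: "i < d" for i
  proof -
    have "affine_image d \<mu> B z i = vec_index \<mu> i + (\<Sum>j<d. B $$ (i, j) * z j)" for z
      using i B \<mu> by (simp add: affine_image_def scalar_prod_def atLeast0LessThan)
    then show ?thesis
      by (auto intro!: poly_growth_add poly_growth_const poly_growth_sum poly_growth_mult poly_growth_coord)
  qed
  have sm: "suff_stat a \<in> borel_measurable (lebesgue_Rd d)"
    using a unfolding suff_stat_def[abs_def] stat_index_def index_pairs_def
    by (auto intro!: borel_measurable_times m)
  have "poly_growth d (\<lambda>z. suff_stat a (affine_image d \<mu> B z))"
    using a unfolding suff_stat_def stat_index_def index_pairs_def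
    by (auto intro!: poly_growth_mult pg)
  then have "sq_integrable (std_normal_Rd d) (\<lambda>z. suff_stat a (affine_image d \<mu> B z))"
    by (rule poly_growth_sq_integrable)
  then show ?thesis by (rule sq_integrable_transfer[OF whitensD(7)[OF w] \<phi> sm])
qed

lemma one_in_pos_def_mats: "1\<^sub>m d \<in> pos_def_mats d"
proof -
  have "scalar_prod v v > 0" if v: "v \<in> carrier_vec d" "v \<noteq> 0\<^sub>v d" for v :: "real vec"
  proof -
    obtain i where i: "i < d" "vec_index v i \<noteq> 0"
      using v by (metis carrier_vecD eq_vecI index_zero_vec)
    have "0 < (vec_index v i)\<^sup>2" using i by simp
    also have "\<dots> \<le> (\<Sum>i<d. (vec_index v i)\<^sup>2)" using i by (intro member_le_sum) auto
    finally show ?thesis by (simp add: sqnorm_sum[OF v(1)])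
  qed
  then show ?thesis by (auto simp: pos_def_mats_def)
qed

lemma mat_inv_eq:
  assumes "S \<in> pos_def_mats d" "B \<in> carrier_mat d d" "S * B = 1\<^sub>m d"
  shows "mat_inv S = B"
  using mat_inv_props[OF assms(1)] assms inverse_unique[of S d B "mat_inv S"] by (auto simp: pos_def_mats_def)

lemma normal_graphical_models_nonempty: "normal_graphical_models d E \<noteq> {}"
proof -
  have "mat_inv (1\<^sub>m d :: real mat) = 1\<^sub>m d" by (rule mat_inv_eq[OF one_in_pos_def_mats]) auto
  then have "1\<^sub>m d \<in> graph_covs d E" using one_in_pos_def_mats by (auto simp: graph_covs_def)
  then have "mvn_density d (0\<^sub>v d) (1\<^sub>m d) \<in> normal_graphical_models d E"
    unfolding normal_graphical_models_def by (intro CollectI exI conjI refl) auto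
  then show ?thesis by blast
qed

theorem graphical_model_minimax_le:
  assumes d: "d \<ge> 1" and n: "n \<ge> 1" and E: "simple_graph {..<d} E"
  shows "minimax_risk (lebesgue_Rd d) n (normal_graphical_models d E)
      \<le> ennreal (21 * min 1 (sqrt (real (card E + d) / real n)))"
proof -
  let ?F = "normal_graphical_models d E" and ?L = "lebesgue_Rd d"
  have mem: "\<exists>\<mu> S. f = mvn_density d \<mu> S \<and> \<mu> \<in> carrier_vec d \<and> S \<in> graph_covs d E \<and> S \<in> pos_def_mats d"
    if "f \<in> ?F" for f using that by (auto simp: normal_graphical_models_def graph_covs_def)
  have pd: "positive_density ?L f" if "f \<in> ?F" for f
    using mem[OF that] positive_density_mvn by blast
  have one: "minimax_risk ?L n ?F \<le> 1"
    by (rule minimax_risk_le_1[OF sigma_finite_lebesgue_Rd pd normal_graphical_models_nonempty])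
  have ne: "stat_index d E \<noteq> {}" using d by (auto simp: stat_index_def lessThan_empty_iff)
  have K4: "(4::real) > 0" by simp
  have "minimax_risk ?L n ?F \<le> ennreal (6 * sqrt 4 * sqrt (card (stat_index d E) / n))"
  proof (rule exponential_family_minimax_le[where T = suff_stat, OF sigma_finite_lebesgue_Rd pd
        normal_graphical_models_nonempty card_stat_index(1)[OF E] ne n K4])
    fix f assume "f \<in> ?F"
    from mem[OF this] show "\<exists>c w. \<forall>x. ln (f x) = c + (\<Sum>a\<in>stat_index d E. w a * suff_stat a x)"
      using mvn_exponential_family by blast
  next
    fix f a assume "f \<in> ?F" "a \<in> stat_index d E"
    then show "sq_integrable (density ?L f) (suff_stat a)" using mem suff_stat_sq_integrable by blast
  next
    fix f g assume "f \<in> ?F" "g \<in> ?F"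
    then show "log_ratio_var ?L f g \<le> 4 * (jeffreys ?L f g * (1 + jeffreys ?L f g))"
      using mem[of f] mem[of g] mvn_variance_le_jeffreys by blast
  qed
  also have "\<dots> \<le> ennreal (21 * sqrt (real (card E + d) / real n))"
  proof (rule ennreal_leI)
    have "real (card (stat_index d E)) \<le> real (3 * (card E + d))"
      using card_stat_index(2)[OF E] by (rule of_nat_mono)
    then have "card (stat_index d E) / n \<le> 3 * (real (card E + d) / real n)"
      using n by (simp add: divide_right_mono)
    then have "sqrt (card (stat_index d E) / n) \<le> sqrt 3 * sqrt (real (card E + d) / real n)"
      by (simp add: real_sqrt_mult[symmetric])
    moreover have "sqrt 3 \<le> 7 / 4" by (rule real_le_lsqrt) (auto simp: power2_eq_square)
    then have "sqrt 3 * sqrt (real (card E + d) / real n) \<le> 7 / 4 * sqrt (real (card E + d) / real n)"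
      by (intro mult_right_mono) auto
    ultimately show "6 * sqrt 4 * sqrt (card (stat_index d E) / n) \<le> 21 * sqrt (real (card E + d) / real n)"
      by simp
  qed
  finally have rate: "minimax_risk ?L n ?F \<le> ennreal (21 * sqrt (real (card E + d) / real n))" .
  show ?thesis
  proof (cases "sqrt (real (card E + d) / real n) \<le> 1")
    case True
    from min.absorb2[OF this] rate show ?thesis by (simp only:)
  next
    case False
    have "(1::ennreal) \<le> ennreal 21" by simp
    with one have "minimax_risk ?L n ?F \<le> ennreal 21" by (rule order_trans)
    then show ?thesis using False by (simp add: min_def)
  qed
qed

section \<open>Lower bound for graphical models\<close>

lemma one_minus_exp_lower:
  fixes u :: real shows "min 1 \<bar>u\<bar> / 2 \<le> \<bar>1 - exp (- u)\<bar>"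
proof (cases "u \<ge> 0")
  case False
  then have "- u \<le> exp (- u) - 1" using exp_ge_add_one_self[of "- u"] by simp
  then show ?thesis using False by (auto simp: min_def abs_if)
next
  case True
  have b: "v / 2 \<le> 1 - exp (- v)" if v: "0 \<le> v" "v \<le> 1" for v :: real
  proof -
    have "1 + v \<le> exp v" by (rule exp_ge_add_one_self)
    then have "exp (- v) \<le> 1 / (1 + v)" using v by (simp add: exp_minus field_simps)
    moreover have "1 / (1 + v) \<le> 1 - v / 2"
    proof -
      have "v * v \<le> v * 1" using v by (intro mult_left_mono) auto
      then show ?thesis using v by (simp add: field_simps)
    qed
    ultimately show ?thesis by simp
  qed
  show ?thesis
  proof (cases "u \<le> 1")
    case True
    then show ?thesis using b[of u] \<open>u \<ge> 0\<close> by simp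
  next
    case False
    then have "exp (- u) \<le> exp (- 1)" by simp
    moreover have "1 / 2 \<le> 1 - exp (- 1 :: real)" using b[of 1] by simp
    ultimately have "1 / 2 \<le> 1 - exp (- u)" by linarith
    moreover have "min 1 \<bar>u\<bar> \<le> 1" by simp
    ultimately show ?thesis by linarith
  qed
qed

text \<open>The ratio \<open>g / f\<close> is \<open>exp (- Y)\<close> for the log-likelihood ratio \<open>Y\<close>, so that twice the total variation is the expectation
  of \<open>\<bar>1 - exp (- Y)\<bar>\<close> under \<open>f\<close>.\<close>

lemma tv_dist_ge_truncated:
  assumes f: "positive_density L f" and g: "positive_density L g"
  shows "ennreal ((\<integral>x. min 1 \<bar>log_ratio f g x\<bar> \<partial>density L f) / 4) \<le> tv_dist L f g"
proof -
  interpret prob_space "density L f" by (rule prob_space_positive_density[OF f])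
  note [measurable] = positive_densityD(1)[OF f] positive_densityD(1)[OF g]
  have lm[measurable]: "log_ratio f g \<in> borel_measurable L" by measurable
  let ?m = "\<lambda>x. min 1 \<bar>log_ratio f g x\<bar>"
  have fpos: "\<And>x. f x \<ge> 0" using positive_densityD(2)[OF f] by (simp add: less_imp_le)
  have mm: "?m \<in> borel_measurable L" by measurable
  have "integrable (density L f) ?m" using mm by (intro integrable_const_bound[of _ 1]) auto
  then have int: "integrable L (\<lambda>x. f x * ?m x)" using fpos mm by (simp add: integrable_density)
  have e: "(\<integral>x. ?m x \<partial>density L f) = (\<integral>x. f x * ?m x \<partial>L)"
    using fpos mm by (simp add: integral_density)
  have "(\<integral>x. f x * ?m x / 2 \<partial>L) \<le> (\<integral>x. \<bar>f x - g x\<bar> \<partial>L)"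
  proof (rule integral_mono)
    fix x
    have p: "f x > 0" "g x > 0" using positive_densityD(2)[OF f] positive_densityD(2)[OF g] by auto
    then have "exp (- log_ratio f g x) = g x / f x" by (simp add: log_ratio_def exp_diff)
    then have "f x * (1 - exp (- log_ratio f g x)) = f x - g x" using p by (simp add: field_simps)
    then have "f x * \<bar>1 - exp (- log_ratio f g x)\<bar> = \<bar>f x - g x\<bar>"
      using p by (simp add: abs_mult flip: \<open>f x * (1 - exp (- log_ratio f g x)) = f x - g x\<close>)
    moreover have "f x * (?m x / 2) \<le> f x * \<bar>1 - exp (- log_ratio f g x)\<bar>"
      using p by (intro mult_left_mono one_minus_exp_lower) auto
    ultimately show "f x * ?m x / 2 \<le> \<bar>f x - g x\<bar>" by simp
  qed (use int positive_density_integrable(1)[OF f] positive_density_integrable(1)[OF g] in auto)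
  then have "(\<integral>x. ?m x \<partial>density L f) / 4 \<le> (\<integral>x. \<bar>f x - g x\<bar> \<partial>L) / 2" by (simp add: e)
  then show ?thesis unfolding tv_dist_eq_integral[OF f g] by (rule ennreal_leI)
qed

text \<open>The \<open>L\<^sup>2\<close> norm of the log-likelihood ratio dominates its standard deviation, and \<open>truncated_moment_lower\<close> compares it
  with the truncated expectation of \<open>tv_dist_ge_truncated\<close>.\<close>

lemma tv_dist_ge_variance:
  assumes f: "positive_density L f" and g: "positive_density L g"
    and i: "integrable (density L f) (\<lambda>x. (log_ratio f g x)\<^sup>2)" "integrable (density L f) (\<lambda>x. (log_ratio f g x)^4)"
    and m4: "(\<integral>x. (log_ratio f g x)^4 \<partial>density L f) \<le> 48 * (\<integral>x. (log_ratio f g x)\<^sup>2 \<partial>density L f)\<^sup>2"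
  shows "ennreal (min 1 (sqrt (log_ratio_var L f g)) / 200) \<le> tv_dist L f g"
proof -
  interpret prob_space "density L f" by (rule prob_space_positive_density[OF f])
  let ?D = "density L f"
  have lm: "log_ratio f g \<in> borel_measurable ?D"
    using log_ratio_measurable[OF positive_densityD(1)[OF f] positive_densityD(1)[OF g]] by simp
  have sq: "sq_integrable ?D (log_ratio f g)" using lm i by (simp add: sq_integrable_def)
  have li: "integrable ?D (log_ratio f g)" by (rule sq_integrable_integrable[OF sq])
  have "log_ratio_var L f g = (\<integral>x. (log_ratio f g x)\<^sup>2 - 2 * kl L f g * log_ratio f g x + (kl L f g)\<^sup>2 \<partial>?D)"
    unfolding log_ratio_var_def by (simp add: power2_diff algebra_simps)
  also have "\<dots> = (\<integral>x. (log_ratio f g x)\<^sup>2 \<partial>?D) - 2 * kl L f g * kl L f g + (kl L f g)\<^sup>2"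
  proof -
    have "measure ?D (space L) = 1" using prob_space by simp
    then show ?thesis using i(1) li by (simp add: kl_def)
  qed
  also have "\<dots> \<le> (\<integral>x. (log_ratio f g x)\<^sup>2 \<partial>?D)" by (simp add: power2_eq_square)
  finally have v: "log_ratio_var L f g \<le> (\<integral>x. (log_ratio f g x)\<^sup>2 \<partial>?D)" .
  have "min 1 (sqrt (log_ratio_var L f g)) / 50 \<le> min 1 (sqrt (\<integral>x. (log_ratio f g x)\<^sup>2 \<partial>?D)) / 50"
    using v by (intro divide_right_mono min.mono) auto
  also have "\<dots> \<le> (\<integral>x. min 1 \<bar>log_ratio f g x\<bar> \<partial>?D)"
    by (rule truncated_moment_lower[OF prob_space_axioms lm i m4])
  finally have "min 1 (sqrt (log_ratio_var L f g)) / 200 \<le> (\<integral>x. min 1 \<bar>log_ratio f g x\<bar> \<partial>?D) / 4" by simp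
  then show ?thesis using tv_dist_ge_truncated[OF f g] by (meson ennreal_leI order_trans)
qed

lemma congruence_factor:
  fixes R :: "real mat"
  assumes R: "R \<in> carrier_mat d d" and X: "X \<in> carrier_mat d d" and Y: "Y \<in> carrier_mat d d"
  shows "transpose_mat X * ((transpose_mat R * R) * Y) = transpose_mat (R * X) * (R * Y)"
proof -
  have Rt: "transpose_mat R \<in> carrier_mat d d" and Xt: "transpose_mat X \<in> carrier_mat d d"
    and RY: "R * Y \<in> carrier_mat d d" using R X Y by auto
  have "(transpose_mat R * R) * Y = transpose_mat R * (R * Y)" by (rule assoc_mult_mat[OF Rt R Y])
  then have "transpose_mat X * ((transpose_mat R * R) * Y) = (transpose_mat X * transpose_mat R) * (R * Y)"
    using assoc_mult_mat[OF Xt Rt RY] by simp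
  then show ?thesis by (simp add: transpose_mult[OF R X])
qed

lemma scalar_prod_sum:
  "w \<in> carrier_vec d \<Longrightarrow> scalar_prod v w = (\<Sum>i<d. vec_index v i * vec_index w i)"
  by (auto simp: scalar_prod_def atLeast0LessThan)

text \<open>The operator norms of \<open>M\<close> and \<open>M\<^sup>T\<close> agree, since \<open>sqnorm (M\<^sup>T y)\<close> is the scalar product of \<open>y\<close> and \<open>M (M\<^sup>T y)\<close>.\<close>

lemma sqnorm_transpose_le:
  assumes M: "M \<in> carrier_mat d d" and b: "\<And>y. y \<in> carrier_vec d \<Longrightarrow> sqnorm (M *\<^sub>v y) \<le> c * sqnorm y"
    and y: "y \<in> carrier_vec d"
  shows "sqnorm (transpose_mat M *\<^sub>v y) \<le> c * sqnorm y"
proof -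
  let ?w = "transpose_mat M *\<^sub>v y"
  have w: "?w \<in> carrier_vec d" using M y by simp
  have Mw: "M *\<^sub>v ?w \<in> carrier_vec d" using M w by simp
  have "sqnorm ?w = scalar_prod y (M *\<^sub>v ?w)" by (rule transpose_vec_mult_scalar[OF M w y])
  also have "\<dots> = (\<Sum>i<d. vec_index y i * vec_index (M *\<^sub>v ?w) i)"
    using Mw by (rule scalar_prod_sum)
  finally have "(sqnorm ?w)\<^sup>2 \<le> sqnorm y * sqnorm (M *\<^sub>v ?w)"
    using Cauchy_Schwarz_ineq_sum[of "vec_index y" "vec_index (M *\<^sub>v ?w)" "{..<d}"]
    by (simp add: sqnorm_sum[OF y] sqnorm_sum[OF Mw])
  also have "\<dots> \<le> sqnorm y * (c * sqnorm ?w)" by (intro mult_left_mono b w sqnorm_nonneg)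
  finally have k: "sqnorm ?w * sqnorm ?w \<le> sqnorm ?w * (c * sqnorm y)" by (simp add: power2_eq_square mult_ac)
  show ?thesis
  proof (cases "sqnorm ?w = 0")
    case True
    have "0 \<le> sqnorm (M *\<^sub>v y)" by (rule sqnorm_nonneg)
    then show ?thesis using b[OF y] True by linarith
  next
    case False
    then have "sqnorm ?w > 0" using sqnorm_nonneg[of ?w] by linarith
    then show ?thesis using k by simp
  qed
qed

lemma inverse_factor_bounds:
  assumes R: "R \<in> carrier_mat d d" and B: "B \<in> carrier_mat d d" and RB: "R * B = 1\<^sub>m d" and BR: "B * R = 1\<^sub>m d"
    and b: "\<And>y. y \<in> carrier_vec d \<Longrightarrow> sqnorm y / 2 \<le> sqnorm (R *\<^sub>v y)"
       "\<And>y. y \<in> carrier_vec d \<Longrightarrow> sqnorm (R *\<^sub>v y) \<le> 2 * sqnorm y"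
    and y: "y \<in> carrier_vec d"
  shows "sqnorm (transpose_mat B *\<^sub>v y) \<le> 2 * sqnorm y" "1 / 2 * sqnorm y \<le> sqnorm (transpose_mat B *\<^sub>v y)"
proof -
  have "sqnorm (B *\<^sub>v v) \<le> 2 * sqnorm v" if v: "v \<in> carrier_vec d" for v
  proof -
    have "R *\<^sub>v (B *\<^sub>v v) = v" using assoc_mult_mat_vec[OF R B v] v by (simp add: RB)
    then show ?thesis using b(1)[of "B *\<^sub>v v"] B v by simp
  qed
  then show "sqnorm (transpose_mat B *\<^sub>v y) \<le> 2 * sqnorm y"
    by (intro sqnorm_transpose_le[OF B _ y])
  have Bt: "transpose_mat B \<in> carrier_mat d d" and Rt: "transpose_mat R \<in> carrier_mat d d" using R B by auto
  have By: "transpose_mat B *\<^sub>v y \<in> carrier_vec d" using Bt y by simp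
  have "transpose_mat R * transpose_mat B = transpose_mat (B * R)" using transpose_mult[OF B R] by simp
  then have "transpose_mat R *\<^sub>v (transpose_mat B *\<^sub>v y) = y"
    using assoc_mult_mat_vec[OF Rt Bt y] y by (simp add: BR)
  then have "sqnorm y \<le> 2 * sqnorm (transpose_mat B *\<^sub>v y)"
    using sqnorm_transpose_le[OF R b(2) By] by simp
  then show "1 / 2 * sqnorm y \<le> sqnorm (transpose_mat B *\<^sub>v y)" by simp
qed

text \<open>The Frobenius norm bounds the operator norm, so the eigenvalues of \<open>K\<close> lie between \<open>1 / 2\<close> and \<open>3 / 2\<close>.\<close>

definition near_identity :: "nat \<Rightarrow> real mat \<Rightarrow> bool" where
  "near_identity d K \<longleftrightarrow> K \<in> carrier_mat d d \<and> transpose_mat K = K \<and> frob_sq d (K - 1\<^sub>m d) \<le> 1 / 4"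

lemma near_identity_form:
  assumes K: "near_identity d K" and y: "y \<in> carrier_vec d"
  shows "sqnorm y / 2 \<le> scalar_prod y (K *\<^sub>v y)" "scalar_prod y (K *\<^sub>v y) \<le> 2 * sqnorm y"
proof -
  let ?D = "K - 1\<^sub>m d"
  have Kc: "K \<in> carrier_mat d d" and fr: "frob_sq d ?D \<le> 1 / 4" using K by (auto simp: near_identity_def)
  have D: "?D \<in> carrier_mat d d" using Kc by auto
  have Dy: "?D *\<^sub>v y \<in> carrier_vec d" using D y by simp
  have "?D *\<^sub>v y = K *\<^sub>v y - y" using Kc y by (subst minus_mult_distrib_mat_vec[of _ d d]) auto
  then have e: "scalar_prod y (?D *\<^sub>v y) = scalar_prod y (K *\<^sub>v y) - sqnorm y"
    using Kc y by (simp add: scalar_prod_minus_distrib[of _ d])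
  have "(scalar_prod y (?D *\<^sub>v y))\<^sup>2 \<le> sqnorm y * sqnorm (?D *\<^sub>v y)"
    using Cauchy_Schwarz_ineq_sum[of "vec_index y" "vec_index (?D *\<^sub>v y)" "{..<d}"] Dy
    unfolding sqnorm_sum[OF y] sqnorm_sum[OF Dy] scalar_prod_def[of y "?D *\<^sub>v y"]
    by (auto simp: atLeast0LessThan)
  also have "\<dots> \<le> sqnorm y * (1 / 4 * sqnorm y)"
    by (intro mult_left_mono order_trans[OF sqnorm_mult_le_frob[OF D y]] mult_right_mono fr sqnorm_nonneg)
  also have "\<dots> = (sqnorm y / 2)\<^sup>2" by (simp add: power2_eq_square)
  finally have "\<bar>scalar_prod y (?D *\<^sub>v y)\<bar> \<le> sqnorm y / 2"
    using abs_le_square_iff[of "scalar_prod y (?D *\<^sub>v y)" "sqnorm y / 2"] sqnorm_nonneg[of y] by simp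
  then show "sqnorm y / 2 \<le> scalar_prod y (K *\<^sub>v y)" "scalar_prod y (K *\<^sub>v y) \<le> 2 * sqnorm y"
    unfolding e using sqnorm_nonneg[of y] by linarith+
qed

lemma near_identity_pos_def:
  assumes K: "near_identity d K" shows "K \<in> pos_def_mats d"
proof -
  have "scalar_prod v (K *\<^sub>v v) > 0" if v: "v \<in> carrier_vec d" "v \<noteq> 0\<^sub>v d" for v
  proof -
    have "scalar_prod v (1\<^sub>m d *\<^sub>v v) > 0" using one_in_pos_def_mats[of d] v unfolding pos_def_mats_def by blast
    then have "sqnorm v > 0" using v by simp
    then show ?thesis using near_identity_form(1)[OF K v(1)] by simp
  qed
  then show ?thesis using K by (auto simp: pos_def_mats_def near_identity_def)
qed

text \<open>With \<open>\<Delta> = K1 - K0\<close>, the matrices \<open>G - H\<^sup>T\<close> and \<open>G\<^sup>T G - I\<close>, on which divergence and variance depend, are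
  \<open>B1\<^sup>T \<Delta> B0\<close> and \<open>B0\<^sup>T \<Delta> B0\<close>.  Near the identity each factor changes the squared Frobenius norm by a factor
  between \<open>1 / 2\<close> and \<open>2\<close>.\<close>

lemma near_identity_pair:
  assumes K0: "near_identity d K0" and K1: "near_identity d K1"
  defines "f \<equiv> mvn_density d (0\<^sub>v d) (mat_inv K0)" and "g \<equiv> mvn_density d (0\<^sub>v d) (mat_inv K1)"
  shows "jeffreys (lebesgue_Rd d) f g \<le> 2 * frob_sq d (K1 - K0)"
    "ennreal (min 1 (sqrt (frob_sq d (K1 - K0) / 8)) / 200) \<le> tv_dist (lebesgue_Rd d) f g"
    "integrable (density (lebesgue_Rd d) f) (log_ratio f g)"
proof -
  let ?L = "lebesgue_Rd d" and ?S0 = "mat_inv K0" and ?S1 = "mat_inv K1" and ?\<mu> = "0\<^sub>v d :: real vec"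
  note p0 = mat_inv_pos_def[OF near_identity_pos_def[OF K0]] and p1 = mat_inv_pos_def[OF near_identity_pos_def[OF K1]]
  have \<mu>: "?\<mu> \<in> carrier_vec d" by simp
  obtain R0 B0 where w0: "whitens d ?\<mu> ?S0 R0 B0" using mvn_whitening[OF p0(1) \<mu>] by blast
  obtain R1 B1 where w1: "whitens d ?\<mu> ?S1 R1 B1" using mvn_whitening[OF p1(1) \<mu>] by blast
  have c: "R0 \<in> carrier_mat d d" "B0 \<in> carrier_mat d d" "R1 \<in> carrier_mat d d" "B1 \<in> carrier_mat d d"
    and i: "R0 * B0 = 1\<^sub>m d" "B0 * R0 = 1\<^sub>m d" "R1 * B1 = 1\<^sub>m d" "B1 * R1 = 1\<^sub>m d"
    and k: "K0 = transpose_mat R0 * R0" "K1 = transpose_mat R1 * R1"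
    using whitensD[OF w0] whitensD[OF w1] p0(2) p1(2) by simp_all
  have kc: "K0 \<in> carrier_mat d d" "K1 \<in> carrier_mat d d" using K0 K1 by (auto simp: near_identity_def)
  let ?\<Delta> = "K1 - K0"
  have \<Delta>: "?\<Delta> \<in> carrier_mat d d" using kc by auto
  have Rb0: "sqnorm y / 2 \<le> sqnorm (R0 *\<^sub>v y)" "sqnorm (R0 *\<^sub>v y) \<le> 2 * sqnorm y" if "y \<in> carrier_vec d" for y
    using near_identity_form[OF K0 that] quad_form_whitened[OF c(1) that] unfolding k(1)[symmetric] by simp_all
  have Rb1: "sqnorm y / 2 \<le> sqnorm (R1 *\<^sub>v y)" "sqnorm (R1 *\<^sub>v y) \<le> 2 * sqnorm y" if "y \<in> carrier_vec d" for y
    using near_identity_form[OF K1 that] quad_form_whitened[OF c(3) that] unfolding k(2)[symmetric] by simp_all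
  note Bb0 = inverse_factor_bounds[OF c(1,2) i(1,2) Rb0] and Bb1 = inverse_factor_bounds[OF c(3,4) i(3,4) Rb1]
  have B0t: "transpose_mat B0 \<in> carrier_mat d d" and B1t: "transpose_mat B1 \<in> carrier_mat d d" using c by auto
  have \<Delta>B: "?\<Delta> * B0 \<in> carrier_mat d d" using \<Delta> c by simp
  have diff: "transpose_mat X * (?\<Delta> * B0) = transpose_mat (R1 * X) * (R1 * B0) - transpose_mat (R0 * X) * (R0 * B0)"
    if X: "X \<in> carrier_mat d d" for X
  proof -
    have "?\<Delta> * B0 = K1 * B0 - K0 * B0" by (rule minus_mult_distrib_mat[OF kc(2,1) c(2)])
    then have "transpose_mat X * (?\<Delta> * B0) = transpose_mat X * (K1 * B0) - transpose_mat X * (K0 * B0)"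
      using mult_minus_distrib_mat[of "transpose_mat X" d d "K1 * B0" d "K0 * B0"] X kc c by simp
    then show ?thesis using congruence_factor[OF c(3) X c(2)] congruence_factor[OF c(1) X c(2)] k by simp
  qed
  let ?G = "R1 * B0" and ?H = "R0 * B1"
  have G: "?G \<in> carrier_mat d d" and H: "?H \<in> carrier_mat d d" using c by auto
  have \<Delta>t: "transpose_mat (?\<Delta> * B0) = transpose_mat B0 * transpose_mat ?\<Delta>" by (rule transpose_mult[OF \<Delta> c(2)])
  have \<Delta>tc: "transpose_mat ?\<Delta> \<in> carrier_mat d d" using \<Delta> by simp
  have fr1: "frob_sq d (?\<Delta> * B0) = frob_sq d (transpose_mat B0 * transpose_mat ?\<Delta>)"
    using frob_transpose[OF \<Delta>B] by (simp add: \<Delta>t)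
  have fr2: "frob_sq d (?\<Delta> * B0) \<le> 2 * frob_sq d ?\<Delta>"
    unfolding fr1 using frob_mult_le[OF B0t \<Delta>tc Bb0(1)] by (simp add: frob_transpose[OF \<Delta>])
  have fr3: "1 / 2 * frob_sq d ?\<Delta> \<le> frob_sq d (?\<Delta> * B0)"
    unfolding fr1 using frob_mult_ge[OF B0t \<Delta>tc Bb0(2)] by (simp add: frob_transpose[OF \<Delta>])
  have P: "?G - transpose_mat ?H = transpose_mat B1 * (?\<Delta> * B0)"
    unfolding diff[OF c(4)] i transpose_one
    using left_mult_one_mat[OF G] right_mult_one_mat[of "transpose_mat ?H" d d] H by simp
  have J2: "2 * jeffreys ?L f g = frob_sq d (?G - transpose_mat ?H)"
    unfolding f_def g_def mvn_jeffreys[OF p0(1) p1(1) \<mu> \<mu> w0 w1]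
      frob_diff_inverse_transpose[OF G H inverse_of_whitening[OF w0 w1]]
  proof -
    have "?\<mu> - ?\<mu> = ?\<mu>" by (intro eq_vecI) auto
    moreover have "R1 *\<^sub>v ?\<mu> = ?\<mu>" "R0 *\<^sub>v ?\<mu> = ?\<mu>" using c by (auto intro!: eq_vecI)
    ultimately show "frob_sq d ?G + frob_sq d ?H - 2 * real d + sqnorm (R1 *\<^sub>v (?\<mu> - ?\<mu>)) + sqnorm (R0 *\<^sub>v (?\<mu> - ?\<mu>))
        = frob_sq d ?G + frob_sq d ?H - 2 * real d" by simp
  qed
  have "frob_sq d (?G - transpose_mat ?H) \<le> 2 * frob_sq d (?\<Delta> * B0)"
    unfolding P by (rule frob_mult_le[OF B1t \<Delta>B Bb1(1)])
  then show "jeffreys ?L f g \<le> 2 * frob_sq d ?\<Delta>" using J2 fr2 by simp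
  note gp = gaussian_pair[OF p0(1) p1(1) \<mu> \<mu> w0 w1, folded f_def g_def]
  have f: "positive_density ?L f" and g: "positive_density ?L g"
    unfolding f_def g_def by (rule positive_density_mvn[OF p0(1) \<mu>] positive_density_mvn[OF p1(1) \<mu>])+
  have "1 / 2 * frob_sq d (?\<Delta> * B0) \<le> frob_sq d (transpose_mat B0 * (?\<Delta> * B0))"
    by (rule frob_mult_ge[OF B0t \<Delta>B Bb0(2)])
  also have "transpose_mat B0 * (?\<Delta> * B0) = transpose_mat ?G * ?G - 1\<^sub>m d"
    unfolding diff[OF c(2)] by (simp add: i)
  finally have "frob_sq d ?\<Delta> / 8 \<le> log_ratio_var ?L f g"
    unfolding gp(2) using fr3 sqnorm_nonneg[of "transpose_mat ?G *\<^sub>v (R1 *\<^sub>v (?\<mu> - ?\<mu>))"] by linarith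
  then have "min 1 (sqrt (frob_sq d ?\<Delta> / 8)) / 200 \<le> min 1 (sqrt (log_ratio_var ?L f g)) / 200"
    by (intro divide_right_mono min.mono) auto
  then show "ennreal (min 1 (sqrt (frob_sq d ?\<Delta> / 8)) / 200) \<le> tv_dist ?L f g"
    using tv_dist_ge_variance[OF f g gp(3-5)] by (meson ennreal_leI order_trans)
  interpret prob_space "density ?L f" by (rule prob_space_positive_density[OF f])
  have "sq_integrable (density ?L f) (log_ratio f g)"
    using gp(3) log_ratio_measurable[OF positive_densityD(1)[OF f] positive_densityD(1)[OF g]]
    by (simp add: sq_integrable_def)
  then show "integrable (density ?L f) (log_ratio f g)" by (rule sq_integrable_integrable)
qed

definition perturbed :: "nat \<Rightarrow> real \<Rightarrow> nat set set \<Rightarrow> real mat" where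
  "perturbed d \<delta> \<sigma> = Matrix.mat d d (\<lambda>(i, j). of_bool (i = j) + \<delta> * of_bool ({i, j} \<in> \<sigma>))"

lemma sum_index_pairs:
  "(\<Sum>i<d. \<Sum>j<d. c * of_bool ({i, j} \<in> \<sigma>)) = c * real (card (index_pairs d \<sigma>))"
proof -
  have "(\<Sum>i<d. \<Sum>j<d. c * of_bool ({i, j} \<in> \<sigma>)) = (\<Sum>p\<in>{..<d} \<times> {..<d}. if p \<in> index_pairs d \<sigma> then c else 0)"
    unfolding sum.cartesian_product by (intro sum.cong) (auto simp: index_pairs_def)
  also have "\<dots> = (\<Sum>p\<in>index_pairs d \<sigma>. c)"
    by (intro sum.mono_neutral_cong_right) (auto simp: index_pairs_def)
  finally show ?thesis by simp
qed

lemma frob_perturbed_diff: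
  "frob_sq d (perturbed d \<delta> \<tau> - perturbed d \<delta> \<sigma>) = \<delta>\<^sup>2 * real (card (index_pairs d (sym_diff \<sigma> \<tau>)))"
  unfolding sum_index_pairs[symmetric] frob_sq_def
  by (intro sum.cong refl) (auto simp: perturbed_def of_bool_def)

lemma perturbed_empty: "perturbed d \<delta> {} = 1\<^sub>m d"
  by (intro eq_matI) (auto simp: perturbed_def)

lemma near_identity_perturbed:
  assumes E: "simple_graph {..<d} E" and \<sigma>: "\<sigma> \<subseteq> cliques d E"
    and \<delta>: "8 * \<delta>\<^sup>2 * real (card E + d) \<le> 1"
  shows "near_identity d (perturbed d \<delta> \<sigma>)"
proof -
  have "card (index_pairs d \<sigma>) \<le> 2 * card \<sigma>" by (rule card_index_pairs(2)[OF E \<sigma>])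
  also have "card \<sigma> \<le> card E + d"
    using card_mono[OF finite_cliques[OF E] \<sigma>] by (simp add: card_cliques[OF E])
  finally have "real (card (index_pairs d \<sigma>)) \<le> 2 * real (card E + d)" by linarith
  then have "\<delta>\<^sup>2 * real (card (index_pairs d \<sigma>)) \<le> \<delta>\<^sup>2 * (2 * real (card E + d))"
    by (intro mult_left_mono) auto
  also have "\<dots> = (8 * \<delta>\<^sup>2 * real (card E + d)) / 4" by simp
  also have "\<dots> \<le> 1 / 4" using \<delta> by (rule divide_right_mono) simp
  finally have "frob_sq d (perturbed d \<delta> \<sigma> - perturbed d \<delta> {}) \<le> 1 / 4"
    unfolding frob_perturbed_diff by simp
  moreover have "transpose_mat (perturbed d \<delta> \<sigma>) = perturbed d \<delta> \<sigma>"
    by (intro eq_matI) (auto simp: perturbed_def insert_commute)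
  ultimately show ?thesis by (simp add: near_identity_def perturbed_empty) (simp add: perturbed_def)
qed

text \<open>The separation is linear in the Hamming distance \<open>h\<close> because \<open>sqrt h \<ge> h / sqrt N\<close> for \<open>h \<le> N\<close>; at distances of order \<open>N\<close>,
  which dominate, this loses only a constant.\<close>

theorem graphical_model_minimax_ge:
  assumes d: "d \<ge> 1" and n: "n \<ge> 1" and E: "simple_graph {..<d} E"
  shows "ennreal (1 / 12800 * min 1 (sqrt (real (card E + d) / real n)))
    \<le> minimax_risk (lebesgue_Rd d) n (normal_graphical_models d E)"
proof -
  let ?L = "lebesgue_Rd d" and ?I = "cliques d E"
  define N where "N = real (card E + d)"
  define M where "M = max (real n) N"
  \<comment> \<open>\<open>M \<ge> N\<close> keeps all perturbed matrices near the identity, and \<open>M \<ge> n\<close> bounds the divergence of neighbours.\<close>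
  define \<delta> where "\<delta> = 1 / sqrt (8 * M)"
  define \<kappa> where "\<kappa> = \<delta> / (200 * sqrt (8 * N))"
  define f where "f \<sigma> = mvn_density d (0\<^sub>v d) (mat_inv (perturbed d \<delta> \<sigma>))" for \<sigma>
  have N: "N \<ge> 1" using d by (simp add: N_def)
  have M: "M \<ge> N" "M \<ge> n" "M > 0" using N by (auto simp: M_def)
  have \<delta>: "\<delta> > 0" "\<delta>\<^sup>2 = 1 / (8 * M)" using M by (simp_all add: \<delta>_def power_divide)
  have \<delta>N: "8 * \<delta>\<^sup>2 * N \<le> 1" and \<delta>n: "8 * \<delta>\<^sup>2 * n \<le> 1" using M by (simp_all add: \<delta>(2))
  have \<kappa>: "\<kappa> > 0" using \<delta> N by (simp add: \<kappa>_def)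
  note near = near_identity_perturbed[OF E _ \<delta>N[unfolded N_def]]
  have cN: "real (card ?I) = N" by (simp add: card_cliques[OF E] N_def)
  have symd: "sym_diff \<sigma> \<tau> \<subseteq> ?I" if "\<sigma> \<subseteq> ?I" "\<tau> \<subseteq> ?I" for \<sigma> \<tau> using that by auto
  have "ennreal (\<kappa> * card ?I / 8) \<le> minimax_risk ?L n (normal_graphical_models d E)"
  proof (rule assouad_minimax_ge[where f = f, OF sigma_finite_lebesgue_Rd finite_cliques[OF E]])
    show "?I \<noteq> {}" using d by (auto simp: cliques_def lessThan_empty_iff)
    show "\<kappa> \<ge> 0" using \<kappa> by simp
  next
    fix \<sigma> assume s: "\<sigma> \<subseteq> ?I"
    note p = mat_inv_pos_def[OF near_identity_pos_def[OF near[OF s]]]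
    have "mat_inv (perturbed d \<delta> \<sigma>) \<in> graph_covs d E"
    proof -
      have "perturbed d \<delta> \<sigma> $$ (i, j) = 0" if "i < d" "j < d" "i \<noteq> j" "{i, j} \<notin> E" for i j
        using s that by (auto simp: perturbed_def cliques_def)
      then show ?thesis using p by (simp add: graph_covs_def)
    qed
    then show "f \<sigma> \<in> normal_graphical_models d E"
      unfolding normal_graphical_models_def f_def by (intro CollectI exI conjI refl) auto
    show "positive_density ?L (f \<sigma>)" unfolding f_def by (rule positive_density_mvn[OF p(1)]) simp
  next
    fix \<sigma> \<tau> assume s: "\<sigma> \<subseteq> ?I" and t: "\<tau> \<subseteq> ?I"
    show "integrable (density ?L (f \<sigma>)) (log_ratio (f \<sigma>) (f \<tau>))"
      unfolding f_def by (rule near_identity_pair(3)[OF near[OF s] near[OF t]])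
    let ?h = "real (card (sym_diff \<sigma> \<tau>))"
    have h1: "?h \<le> real (card (index_pairs d (sym_diff \<sigma> \<tau>)))"
      using card_index_pairs(1)[OF E symd[OF s t]] by simp
    have "card (sym_diff \<sigma> \<tau>) \<le> card ?I" by (rule card_mono[OF finite_cliques[OF E] symd[OF s t]])
    then have hN: "?h \<le> N" using cN by linarith
    have "\<delta> * ?h / sqrt (8 * N) \<le> \<delta> * (sqrt ?h / sqrt 8)"
    proof -
      have "?h = sqrt ?h * sqrt ?h" by simp
      also have "\<dots> \<le> sqrt ?h * sqrt N" using hN by (intro mult_left_mono) auto
      finally have "?h / sqrt (8 * N) \<le> sqrt ?h * sqrt N / sqrt (8 * N)" by (intro divide_right_mono) (use N in auto)
      also have "\<dots> = sqrt ?h / sqrt 8" using N by (simp add: real_sqrt_mult)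
      finally have "\<delta> * (?h / sqrt (8 * N)) \<le> \<delta> * (sqrt ?h / sqrt 8)" using \<delta>(1) by (intro mult_left_mono) auto
      then show ?thesis by simp
    qed
    also have "\<dots> = sqrt (\<delta>\<^sup>2 * ?h / 8)" using \<delta>(1) by (simp add: real_sqrt_mult real_sqrt_divide)
    also have "\<dots> = min 1 (sqrt (\<delta>\<^sup>2 * ?h / 8))"
    proof -
      have "\<delta>\<^sup>2 * ?h \<le> \<delta>\<^sup>2 * N" using hN by (intro mult_left_mono) auto
      then have "\<delta>\<^sup>2 * ?h / 8 \<le> 1" using \<delta>N by simp
      then have "sqrt (\<delta>\<^sup>2 * ?h / 8) \<le> 1" by simp
      then show ?thesis by simp
    qed
    also have "\<dots> \<le> min 1 (sqrt (frob_sq d (perturbed d \<delta> \<tau> - perturbed d \<delta> \<sigma>) / 8))"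
      unfolding frob_perturbed_diff using h1
      by (intro min.mono order_refl real_sqrt_le_mono divide_right_mono mult_left_mono) auto
    finally have "\<kappa> * ?h \<le> min 1 (sqrt (frob_sq d (perturbed d \<delta> \<tau> - perturbed d \<delta> \<sigma>) / 8)) / 200"
      by (simp add: \<kappa>_def)
    then show "ennreal (\<kappa> * ?h) \<le> tv_dist ?L (f \<sigma>) (f \<tau>)"
      unfolding f_def using near_identity_pair(2)[OF near[OF s] near[OF t]] by (meson ennreal_leI order_trans)
  next
    fix \<sigma> e assume s: "\<sigma> \<subseteq> ?I" and e: "e \<in> ?I" "e \<notin> \<sigma>"
    have t: "insert e \<sigma> \<subseteq> ?I" using s e by simp
    have sd: "sym_diff \<sigma> (insert e \<sigma>) = {e}" using e by auto
    have "jeffreys ?L (f \<sigma>) (f (insert e \<sigma>)) \<le> 2 * frob_sq d (perturbed d \<delta> (insert e \<sigma>) - perturbed d \<delta> \<sigma>)"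
      unfolding f_def by (rule near_identity_pair(1)[OF near[OF s] near[OF t]])
    also have "\<dots> = 2 * (\<delta>\<^sup>2 * real (card (index_pairs d {e})))" unfolding frob_perturbed_diff sd ..
    also have "\<dots> \<le> 2 * (\<delta>\<^sup>2 * 2)"
      using card_index_pairs(2)[OF E, of "{e}"] e by (intro mult_left_mono) auto
    finally have "real n * jeffreys ?L (f \<sigma>) (f (insert e \<sigma>)) \<le> real n * (2 * (\<delta>\<^sup>2 * 2))"
      by (intro mult_left_mono) auto
    also have "\<dots> \<le> 1 / 2" using \<delta>n by (simp add: mult_ac)
    finally show "real n * jeffreys ?L (f \<sigma>) (f (insert e \<sigma>)) \<le> 1 / 2" .
  qed
  moreover have "\<kappa> * card ?I / 8 = 1 / 12800 * min 1 (sqrt (real (card E + d) / real n))"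
  proof -
    have "\<kappa> * card ?I / 8 = N / (1600 * (sqrt (8 * M) * sqrt (8 * N)))" unfolding cN \<kappa>_def \<delta>_def by simp
    also have "sqrt (8 * M) * sqrt (8 * N) = 8 * (sqrt M * sqrt N)" by (simp add: real_sqrt_mult)
    also have "N / (1600 * (8 * (sqrt M * sqrt N))) = 1 / 12800 * (N / sqrt N / sqrt M)" by simp
    also have "N / sqrt N = sqrt N" using N by (simp add: real_div_sqrt)
    also have "sqrt N / sqrt M = min 1 (sqrt (N / n))"
    proof (cases "N \<le> n")
      case True
      then have "sqrt (N / n) \<le> 1" using n by simp
      from min.absorb2[OF this] have "min 1 (sqrt (N / n)) = sqrt N / sqrt n" by (simp only: real_sqrt_divide)
      moreover have "M = n" using True by (simp add: M_def max_def)
      ultimately show ?thesis by simp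
    next
      case False
      then have "1 \<le> N / n" using n by (simp add: pos_le_divide_eq)
      then have "1 \<le> sqrt (N / n)" by simp
      then show ?thesis using False N by (simp add: M_def max_def min_def)
    qed
    finally show ?thesis by (simp add: N_def)
  qed
  ultimately show ?thesis by simp
qed

theorem theorem1p1:
  "\<exists>c C :: real. c > 0 \<and> C > 0 \<and>
     (\<forall>(d::nat) (n::nat) (E :: nat set set).
        d \<ge> 1 \<longrightarrow> n \<ge> 1 \<longrightarrow> simple_graph {..<d} E \<longrightarrow>
          ennreal (c * min 1 (sqrt (real (card E + d) / real n)))
            \<le> minimax_risk (lebesgue_Rd d) n (normal_graphical_models d E)
        \<and> minimax_risk (lebesgue_Rd d) n (normal_graphical_models d E)
            \<le> ennreal (C * min 1 (sqrt (real (card E + d) / real n))))"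
proof (intro exI conjI allI impI)
  show "(1 / 12800 :: real) > 0" "(21 :: real) > 0" by simp_all
qed (rule graphical_model_minimax_ge graphical_model_minimax_le; assumption)+

end
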